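(* Let $r>0$ and let $\tilde h(x,t,w)$ be a real-valued, real analytic function of its three real arguments. For a function $u$, define the (quasilinear) operator $$P_u(D)v := \left((D_x)^2 + (x^r D_t)^2 + \big(x^r\,\tilde h(x,t,u(x,t))\,D_t\big)^2\right)v,\qquad (x,t)\in\mathbb{R}^2,$$ where $D_x=-i\,\partial/\partial x$ and $D_t=-i\,\partial/\partial t$. Let $(x_0,t_0)\in\mathbb{R}^2$, let $f$ be real analytic in a neighborhood of $(x_0,t_0)$, and let $u$ be a real-valued $C^\infty$ function in a neighborhood of $(x_0,t_0)$ satisfying $$P_u(D)u = \left((D_x)^2 + (x^r D_t)^2 + \big(x^r\,\tilde h(x,t,u)\,D_t\big)^2\right)u = f$$ there. Then $u$ is real analytic in a neighborhood of $(x_0,t_0)$.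
   Context: The vector fields $D_x$, $x^rD_t$ and $x^r\tilde h(x,t,u)D_t$ have coefficients depending on the solution $u$ itself, so the equation is a non-linear sum of squares of vector fields. Real analyticity of $f$ and of the solution is meant locally near the given point $(x_0,t_0)$. *)

theory Defs
  imports "HOL-Analysis.Analysis"
begin

definition pdx :: "(real \<Rightarrow> real \<Rightarrow> real) \<Rightarrow> real \<Rightarrow> real \<Rightarrow> real" where
  "pdx g = (\<lambda>x t. deriv (\<lambda>s. g s t) x)"

definition pdt :: "(real \<Rightarrow> real \<Rightarrow> real) \<Rightarrow> real \<Rightarrow> real \<Rightarrow> real" where
  "pdt g = (\<lambda>x t. deriv (\<lambda>s. g x s) t)"

fun iter_pd :: "bool list \<Rightarrow> (real \<Rightarrow> real \<Rightarrow> real) \<Rightarrow> real \<Rightarrow> real \<Rightarrow> real" where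
  "iter_pd [] g = g"
| "iter_pd (b # bs) g = (if b then pdx else pdt) (iter_pd bs g)"

definition smooth2_on :: "(real \<times> real) set \<Rightarrow> (real \<Rightarrow> real \<Rightarrow> real) \<Rightarrow> bool" where
  "smooth2_on U g \<longleftrightarrow>
     (\<forall>bs. (\<forall>(x,t)\<in>U. (\<lambda>s. iter_pd bs g s t) differentiable (at x)
                     \<and> (\<lambda>s. iter_pd bs g x s) differentiable (at t))
          \<and> continuous_on U (\<lambda>(x,t). iter_pd bs g x t))"

definition real_analytic2_at :: "(real \<Rightarrow> real \<Rightarrow> real) \<Rightarrow> real \<Rightarrow> real \<Rightarrow> bool" where
  "real_analytic2_at g x0 t0 \<longleftrightarrow>
     (\<exists>(c :: nat \<times> nat \<Rightarrow> real) e. e > 0 \<and>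
        (\<forall>x t. \<bar>x - x0\<bar> < e \<longrightarrow> \<bar>t - t0\<bar> < e \<longrightarrow>
           ((\<lambda>(j,k). c (j,k) * (x - x0)^j * (t - t0)^k) has_sum g x t) UNIV))"

definition real_analytic3_at ::
  "(real \<Rightarrow> real \<Rightarrow> real \<Rightarrow> real) \<Rightarrow> real \<Rightarrow> real \<Rightarrow> real \<Rightarrow> bool" where
  "real_analytic3_at g x0 t0 w0 \<longleftrightarrow>
     (\<exists>(c :: nat \<times> nat \<times> nat \<Rightarrow> real) e. e > 0 \<and>
        (\<forall>x t w. \<bar>x - x0\<bar> < e \<longrightarrow> \<bar>t - t0\<bar> < e \<longrightarrow> \<bar>w - w0\<bar> < e \<longrightarrow>
           ((\<lambda>(j,k,l). c (j,k,l) * (x - x0)^j * (t - t0)^k * (w - w0)^l) has_sum g x t w) UNIV))"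

definition real_analytic2_near :: "(real \<Rightarrow> real \<Rightarrow> real) \<Rightarrow> real \<times> real \<Rightarrow> bool" where
  "real_analytic2_near g p \<longleftrightarrow>
     (\<exists>V. open V \<and> p \<in> V \<and> (\<forall>(x,t)\<in>V. real_analytic2_at g x t))"

text \<open>Squares of vector fields: (D_x)^2 v = - v_xx, and for a real coefficient a,
  (a D_t)^2 v = a (-i d/dt)(a (-i d/dt) v) = - a d/dt (a dv/dt).\<close>
definition Dx_sq :: "(real \<Rightarrow> real \<Rightarrow> real) \<Rightarrow> real \<Rightarrow> real \<Rightarrow> real" where
  "Dx_sq v = (\<lambda>x t. - pdx (pdx v) x t)"

definition aDt_sq :: "(real \<Rightarrow> real \<Rightarrow> real) \<Rightarrow> (real \<Rightarrow> real \<Rightarrow> real) \<Rightarrow> real \<Rightarrow> real \<Rightarrow> real" where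
  "aDt_sq a v = (\<lambda>x t. - (a x t * pdt (\<lambda>y s. a y s * pdt v y s) x t))"

definition P_op :: "nat \<Rightarrow> (real \<Rightarrow> real \<Rightarrow> real \<Rightarrow> real) \<Rightarrow> (real \<Rightarrow> real \<Rightarrow> real)
                    \<Rightarrow> (real \<Rightarrow> real \<Rightarrow> real) \<Rightarrow> real \<Rightarrow> real \<Rightarrow> real" where
  "P_op r h u v = (\<lambda>x t. Dx_sq v x t + aDt_sq (\<lambda>y s. y ^ r) v x t
                        + aDt_sq (\<lambda>y s. y ^ r * h y s (u y s)) v x t)"

end

theory Submission
  imports Defs "HOL-Library.Function_Algebras"
begin

text \<open>
  Write X, T for the partial derivatives, m = x^r, Y = mT and H(x,t) = h(x,t,u(x,t)); the equation
  becomes XXu + Y((1 + H^2)Yu) = H (YH) (Yu) - f.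

  Powers of T come first. On a small square, let rho be a cutoff that is a square of a function of
  x^(r+1) times a square of a function of t, so that X rho is a multiple of m and commutators with
  W_p = rho^p T^p / p! stay in the span of X and Y. The Leibniz rule makes p |-> W_p g multiplicative
  in the sense of Cauchy products. Applying T W_p to the equation and testing with T W_p u bounds
  XTW_p u and YTW_p u in L2; since T falls on everything, a one-dimensional Sobolev inequality in t
  and the bound |TW_p u| <= C |XTW_p u| in x (mixed norms) give an algebra norm. A generating sum y
  of these quantities satisfies y <= C(eps + (eps + y)^2) on a small square, hence stays small by
  continuity in its parameter. So |T^p u| <= C K^p p!.

  The X derivatives follow pointwise: nu_k g = sum over p, q of |X^q T^p g| s^p eps^q / (p+q+k)! is
  submultiplicative, so the equation expresses X^2 u with two derivatives gained from the shift k = 2,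
  and continuity in eps closes a bound on nu_0 u. Both times the norm of h(x,t,u) is controlled by
  inserting the power series of h. The Taylor series of u then converges to u.
\<close>

section \<open>The differential ring of smooth functions\<close>

text \<open>The obstacle is that T alone is not controlled by X and Y where m vanishes. A generic
  cutoff would leave p \<rho>^(p-1) (X \<rho>) T^p u in the commutator of X with \<rho>^p T^p, with
  a bare T; the x-derivative of a function of x^(r+1) is divisible by x^r and turns that T into a Y.
  Smallness has three sources. Commutator terms have one index less and so gain a factor of the
  generating parameter. The coefficient 1 + H^2 is frozen at the center, and the difference is
  small. The right side is tested against a function whose supremum in x costs sqrt(b - a); it
  contains a product of two factors that are controlled only in L2 in x, so it is estimated in L1 in
  x, which is why three norms in x run side by side. All generating sums are truncated, hence
  polynomials in their parameter: finiteness is never an issue, and both continuity arguments say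
  that such a sum starts below a threshold and cannot equal it. The bounds do not depend on the
  truncation.\<close>

lemma iter_pd_append: "iter_pd (bs @ cs) g = iter_pd bs (iter_pd cs g)"
  by (induction bs) auto

text \<open>Scalars are carried as constant functions so that every formula lives in one commutative
  ring of functions and ring normalisation applies to it.\<close>

definition constf :: "real \<Rightarrow> real \<Rightarrow> real \<Rightarrow> real" where
  "constf c = (\<lambda>x t. c)"

lemma constf_apply [simp]: "constf c x t = c"
  by (simp add: constf_def)

lemma constf_add: "constf (a + b) = constf a + constf b"
  and constf_mult: "constf (a * b) = constf a * constf b"
  and constf_0 [simp]: "constf 0 = 0"
  and constf_1 [simp]: "constf 1 = 1"
  by (auto simp: constf_def fun_eq_iff)

definition fx :: "real \<Rightarrow> real \<Rightarrow> real" where "fx = (\<lambda>x t. x)"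
definition ft :: "real \<Rightarrow> real \<Rightarrow> real" where "ft = (\<lambda>x t. t)"

lemma fx_apply [simp]: "fx x t = x" and ft_apply [simp]: "ft x t = t"
  by (simp_all add: fx_def ft_def)

lemma power_fun_app [simp]: "(f ^ n) x = (f x :: 'a :: monoid_mult) ^ n"
  by (induction n) auto

lemma sum_fun_app [simp]: "(sum f A) x = (\<Sum>i\<in>A. f i x :: 'a :: comm_monoid_add)"
  by (induction A rule: infinite_finite_induct) auto

locale plane_domain =
  fixes D :: "(real \<times> real) set"
  assumes open_D: "open D"
begin

definition sm :: "(real \<Rightarrow> real \<Rightarrow> real) set" where
  "sm = {g. smooth2_on D g}"

text \<open>Cutting off to 0 outside D makes the ring rules hold as equations between functions, although
  HOL derivatives outside D are junk.\<close>

definition dX :: "(real \<Rightarrow> real \<Rightarrow> real) \<Rightarrow> real \<Rightarrow> real \<Rightarrow> real" where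
  "dX g = (\<lambda>x t. if (x, t) \<in> D then pdx g x t else 0)"

definition dT :: "(real \<Rightarrow> real \<Rightarrow> real) \<Rightarrow> real \<Rightarrow> real \<Rightarrow> real" where
  "dT g = (\<lambda>x t. if (x, t) \<in> D then pdt g x t else 0)"

lemma ev_x: "(x, t) \<in> D \<Longrightarrow> eventually (\<lambda>s. (s, t) \<in> D) (nhds x)"
  using open_D by (intro eventually_compose_filterlim[OF eventually_nhds_in_open[of D "(x,t)"]])
    (auto intro!: tendsto_intros filterlim_ident simp: tendsto_ident_at)

lemma ev_t: "(x, t) \<in> D \<Longrightarrow> eventually (\<lambda>s. (x, s) \<in> D) (nhds t)"
  using open_D by (intro eventually_compose_filterlim[OF eventually_nhds_in_open[of D "(x,t)"]])
    (auto intro!: tendsto_intros filterlim_ident simp: tendsto_ident_at)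

lemma pdx_cong: "(\<And>x t. (x, t) \<in> D \<Longrightarrow> g x t = h x t) \<Longrightarrow> (x, t) \<in> D \<Longrightarrow> pdx g x t = pdx h x t"
  unfolding pdx_def by (intro deriv_cong_ev refl) (auto elim!: eventually_mono dest: ev_x)

lemma pdt_cong: "(\<And>x t. (x, t) \<in> D \<Longrightarrow> g x t = h x t) \<Longrightarrow> (x, t) \<in> D \<Longrightarrow> pdt g x t = pdt h x t"
  unfolding pdt_def by (intro deriv_cong_ev refl) (auto elim!: eventually_mono dest: ev_t)

lemma iter_pd_cong:
  "(\<And>x t. (x, t) \<in> D \<Longrightarrow> g x t = h x t) \<Longrightarrow> (x, t) \<in> D \<Longrightarrow> iter_pd bs g x t = iter_pd bs h x t"
proof (induction bs arbitrary: x t)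
  case (Cons b bs)
  then show ?case
    by (cases b) (auto intro: pdx_cong pdt_cong)
qed auto

text \<open>Weaker than the usual C^1: the partial derivatives exist, but only the function itself
  is required to be continuous. Continuity of the derivatives comes from imposing the condition on
  them in turn, so \<open>sm\<close> is, up to values outside \<open>D\<close>, the largest class of
  such functions closed under both derivatives.\<close>

definition C1 :: "(real \<Rightarrow> real \<Rightarrow> real) \<Rightarrow> bool" where
  "C1 g \<longleftrightarrow> (\<forall>(x,t)\<in>D. (\<lambda>s. g s t) differentiable (at x) \<and> (\<lambda>s. g x s) differentiable (at t))
     \<and> continuous_on D (\<lambda>(x,t). g x t)"

lemma sm_iff: "g \<in> sm \<longleftrightarrow> (\<forall>bs. C1 (iter_pd bs g))"
  by (auto simp: sm_def smooth2_on_def C1_def)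

lemma C1_cong:
  assumes "\<And>x t. (x, t) \<in> D \<Longrightarrow> g x t = h x t" "C1 h" shows "C1 g"
proof -
  have "(\<lambda>s. g s t) differentiable (at x)" "(\<lambda>s. g x s) differentiable (at t)" if "(x,t) \<in> D" for x t
  proof -
    have "(\<lambda>s. h s t) differentiable (at x)" "(\<lambda>s. h x s) differentiable (at t)"
      using assms(2) that by (auto simp: C1_def)
    then obtain a b where ab: "((\<lambda>s. h s t) has_real_derivative a) (at x)" "((\<lambda>s. h x s) has_real_derivative b) (at t)"
      by (auto simp: real_differentiable_def)
    have "((\<lambda>s. g s t) has_real_derivative a) (at x)"
      using ab(1) by (subst DERIV_cong_ev[OF refl _ refl, of _ "\<lambda>s. h s t"])
        (use that in \<open>auto intro!: eventually_mono[OF ev_x] assms(1)\<close>)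
    moreover have "((\<lambda>s. g x s) has_real_derivative b) (at t)"
      using ab(2) by (subst DERIV_cong_ev[OF refl _ refl, of _ "\<lambda>s. h x s"])
        (use that in \<open>auto intro!: eventually_mono[OF ev_t] assms(1)\<close>)
    ultimately show "(\<lambda>s. g s t) differentiable (at x)" "(\<lambda>s. g x s) differentiable (at t)"
      by (auto simp: real_differentiable_def)
  qed
  moreover have "continuous_on D (\<lambda>(x,t). g x t)"
    using assms by (subst continuous_on_cong[OF refl, of _ _ "\<lambda>(x,t). h x t"]) (auto simp: C1_def)
  ultimately show ?thesis by (auto simp: C1_def)
qed

text \<open>Induction on the word of derivatives shows that each of them agrees on \<open>D\<close>
  with a member of \<open>A\<close>. To prove smoothness it is therefore enough to exhibit a class
  of functions that is stable under differentiation.\<close>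

lemma sm_coinduct:
  assumes "g \<in> A"
    and "\<And>g. g \<in> A \<Longrightarrow> C1 g"
    and "\<And>g. g \<in> A \<Longrightarrow> \<exists>g'\<in>A. \<forall>x t. (x,t) \<in> D \<longrightarrow> pdx g x t = g' x t"
    and "\<And>g. g \<in> A \<Longrightarrow> \<exists>g'\<in>A. \<forall>x t. (x,t) \<in> D \<longrightarrow> pdt g x t = g' x t"
  shows "g \<in> sm"
proof -
  have *: "\<exists>g'\<in>A. \<forall>x t. (x,t) \<in> D \<longrightarrow> iter_pd bs g x t = g' x t" for bs
  proof (induction bs)
    case Nil
    then show ?case using assms(1) by auto
  next
    case (Cons b bs)
    then obtain g' where g': "g' \<in> A" "\<And>x t. (x,t) \<in> D \<Longrightarrow> iter_pd bs g x t = g' x t" by auto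
    show ?case
    proof (cases b)
      case True
      then show ?thesis using assms(3)[OF g'(1)] pdx_cong[OF g'(2)] by fastforce
    next
      case False
      then show ?thesis using assms(4)[OF g'(1)] pdt_cong[OF g'(2)] by fastforce
    qed
  qed
  show ?thesis unfolding sm_iff
    using * assms(2) C1_cong by metis
qed

lemma sm_cong:
  assumes "\<And>x t. (x, t) \<in> D \<Longrightarrow> g x t = h x t" "h \<in> sm" shows "g \<in> sm"
  unfolding sm_iff
proof
  fix bs
  show "C1 (iter_pd bs g)"
  proof (rule C1_cong)
    show "iter_pd bs g x t = iter_pd bs h x t" if "(x,t) \<in> D" for x t
      by (rule iter_pd_cong) (use assms(1) that in auto)
    show "C1 (iter_pd bs h)" using assms(2) sm_iff by blast
  qed
qed

lemma C1_sm: "g \<in> sm \<Longrightarrow> C1 g"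
  using sm_iff[of g] iter_pd.simps(1) by metis

lemma pdx_sm: "g \<in> sm \<Longrightarrow> pdx g \<in> sm"
  unfolding sm_iff
proof
  fix bs assume "\<forall>bs. C1 (iter_pd bs g)"
  then have "C1 (iter_pd (bs @ [True]) g)" by blast
  then show "C1 (iter_pd bs (pdx g))" by (simp add: iter_pd_append)
qed

lemma pdt_sm: "g \<in> sm \<Longrightarrow> pdt g \<in> sm"
  unfolding sm_iff
proof
  fix bs assume "\<forall>bs. C1 (iter_pd bs g)"
  then have "C1 (iter_pd (bs @ [False]) g)" by blast
  then show "C1 (iter_pd bs (pdt g))" by (simp add: iter_pd_append)
qed

lemma dX_sm [simp, intro]: "g \<in> sm \<Longrightarrow> dX g \<in> sm"
  by (rule sm_cong[OF _ pdx_sm]) (auto simp: dX_def)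

lemma dT_sm [simp, intro]: "g \<in> sm \<Longrightarrow> dT g \<in> sm"
  by (rule sm_cong[OF _ pdt_sm]) (auto simp: dT_def)

lemma C1_dx: "C1 g \<Longrightarrow> (x, t) \<in> D \<Longrightarrow> ((\<lambda>s. g s t) has_real_derivative dX g x t) (at x)"
  unfolding C1_def dX_def pdx_def using DERIV_deriv_iff_real_differentiable by fastforce

lemma C1_dt: "C1 g \<Longrightarrow> (x, t) \<in> D \<Longrightarrow> ((\<lambda>s. g x s) has_real_derivative dT g x t) (at t)"
  unfolding C1_def dT_def pdt_def using DERIV_deriv_iff_real_differentiable by fastforce

lemma sm_dx: "g \<in> sm \<Longrightarrow> (x, t) \<in> D \<Longrightarrow> ((\<lambda>s. g s t) has_real_derivative dX g x t) (at x)"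
  by (rule C1_dx[OF C1_sm])

lemma sm_dt: "g \<in> sm \<Longrightarrow> (x, t) \<in> D \<Longrightarrow> ((\<lambda>s. g x s) has_real_derivative dT g x t) (at t)"
  by (rule C1_dt[OF C1_sm])

lemma sm_cont: "g \<in> sm \<Longrightarrow> continuous_on D (\<lambda>(x,t). g x t)"
  using C1_sm C1_def by blast

lemma dX_eqI: "((\<lambda>s. g s t) has_real_derivative a) (at x) \<Longrightarrow> (x, t) \<in> D \<Longrightarrow> dX g x t = a"
  by (auto simp: dX_def pdx_def DERIV_imp_deriv)

lemma dT_eqI: "((\<lambda>s. g x s) has_real_derivative a) (at t) \<Longrightarrow> (x, t) \<in> D \<Longrightarrow> dT g x t = a"
  by (auto simp: dT_def pdt_def DERIV_imp_deriv)

lemma dX_out: "(x, t) \<notin> D \<Longrightarrow> dX g x t = 0" and dT_out: "(x, t) \<notin> D \<Longrightarrow> dT g x t = 0"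
  by (auto simp: dX_def dT_def)

lemma dX_cong: "(\<And>x t. (x, t) \<in> D \<Longrightarrow> g x t = h x t) \<Longrightarrow> dX g = dX h"
  using pdx_cong by (fastforce simp: dX_def fun_eq_iff)

lemma dT_cong: "(\<And>x t. (x, t) \<in> D \<Longrightarrow> g x t = h x t) \<Longrightarrow> dT g = dT h"
  using pdt_cong by (fastforce simp: dT_def fun_eq_iff)

text \<open>The product rule turns one product into a sum of products, so smoothness of products
  cannot be shown one derivative at a time. The whole algebra generated by \<open>sm\<close> serves
  as the stable class in \<open>sm_coinduct\<close>, and thereby turns out to be \<open>sm\<close>
  itself.\<close>

inductive salg :: "(real \<Rightarrow> real \<Rightarrow> real) \<Rightarrow> bool" where
  base: "g \<in> sm \<Longrightarrow> salg g"
| add: "salg g \<Longrightarrow> salg h \<Longrightarrow> k = g + h \<Longrightarrow> salg k"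
| mult: "salg g \<Longrightarrow> salg h \<Longrightarrow> k = g * h \<Longrightarrow> salg k"

lemma C1_add: assumes "C1 g" "C1 h" shows "C1 (g + h)"
  using assms unfolding C1_def plus_fun_def
  by (auto simp: case_prod_beta intro!: derivative_intros continuous_intros)

lemma C1_mult: assumes "C1 g" "C1 h" shows "C1 (g * h)"
  using assms unfolding C1_def times_fun_def
  by (auto simp: case_prod_beta intro!: derivative_intros continuous_intros)

lemma C1_deriv:
  assumes "C1 g" "C1 h"
  shows C1_dX_add: "dX (g + h) = dX g + dX h" and C1_dT_add: "dT (g + h) = dT g + dT h"
    and C1_dX_mult: "dX (g * h) = dX g * h + g * dX h" and C1_dT_mult: "dT (g * h) = dT g * h + g * dT h"
proof -
  note d = C1_dx[OF assms(1)] C1_dt[OF assms(1)] C1_dx[OF assms(2)] C1_dt[OF assms(2)]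
  show "dX (g + h) = dX g + dX h"
  proof (intro ext)
    fix x t show "dX (g + h) x t = (dX g + dX h) x t"
    proof (cases "(x, t) \<in> D")
      case True
      then show ?thesis by (intro dX_eqI) (auto intro!: derivative_eq_intros d)
    qed (simp add: dX_out)
  qed
  show "dT (g + h) = dT g + dT h"
  proof (intro ext)
    fix x t show "dT (g + h) x t = (dT g + dT h) x t"
    proof (cases "(x, t) \<in> D")
      case True
      then show ?thesis by (intro dT_eqI) (auto intro!: derivative_eq_intros d)
    qed (simp add: dT_out)
  qed
  show "dX (g * h) = dX g * h + g * dX h"
  proof (intro ext)
    fix x t show "dX (g * h) x t = (dX g * h + g * dX h) x t"
    proof (cases "(x, t) \<in> D")
      case True
      then show ?thesis by (intro dX_eqI) (auto intro!: derivative_eq_intros d)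
    qed (simp add: dX_out)
  qed
  show "dT (g * h) = dT g * h + g * dT h"
  proof (intro ext)
    fix x t show "dT (g * h) x t = (dT g * h + g * dT h) x t"
    proof (cases "(x, t) \<in> D")
      case True
      then show ?thesis by (intro dT_eqI) (auto intro!: derivative_eq_intros d)
    qed (simp add: dT_out)
  qed
qed

lemma salg_C1: "salg g \<Longrightarrow> C1 g"
  by (induction rule: salg.induct) (blast intro: C1_sm C1_add C1_mult)+

lemma salg_dX: "salg g \<Longrightarrow> salg (dX g)"
proof (induction rule: salg.induct)
  case (mult g h k)
  then show ?case
    by (metis C1_dX_mult salg.add salg.mult salg_C1)
qed (metis salg.base dX_sm, metis salg.add C1_dX_add salg_C1)

lemma salg_dT: "salg g \<Longrightarrow> salg (dT g)"
proof (induction rule: salg.induct)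
  case (mult g h k)
  then show ?case
    by (metis C1_dT_mult salg.add salg.mult salg_C1)
qed (metis salg.base dT_sm, metis salg.add C1_dT_add salg_C1)

lemma salg_sm: assumes "salg g" shows "g \<in> sm"
proof (rule sm_coinduct[of g "Collect salg"])
  fix g assume g: "g \<in> Collect salg"
  show "C1 g" using g by (simp add: salg_C1)
  show "\<exists>g'\<in>Collect salg. \<forall>x t. (x,t) \<in> D \<longrightarrow> pdx g x t = g' x t"
    using g salg_dX by (intro bexI[of _ "dX g"]) (auto simp: dX_def)
  show "\<exists>g'\<in>Collect salg. \<forall>x t. (x,t) \<in> D \<longrightarrow> pdt g x t = g' x t"
    using g salg_dT by (intro bexI[of _ "dT g"]) (auto simp: dT_def)
qed (use assms in simp)

lemma sm_add [simp, intro]: "g \<in> sm \<Longrightarrow> h \<in> sm \<Longrightarrow> g + h \<in> sm"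
  and sm_mult [simp, intro]: "g \<in> sm \<Longrightarrow> h \<in> sm \<Longrightarrow> g * h \<in> sm"
  by (simp_all only: salg_sm[OF salg.add[OF salg.base salg.base refl]] salg_sm[OF salg.mult[OF salg.base salg.base refl]])

lemma dX_add [simp]: "g \<in> sm \<Longrightarrow> h \<in> sm \<Longrightarrow> dX (g + h) = dX g + dX h"
  and dT_add [simp]: "g \<in> sm \<Longrightarrow> h \<in> sm \<Longrightarrow> dT (g + h) = dT g + dT h"
  and dX_mult [simp]: "g \<in> sm \<Longrightarrow> h \<in> sm \<Longrightarrow> dX (g * h) = dX g * h + g * dX h"
  and dT_mult [simp]: "g \<in> sm \<Longrightarrow> h \<in> sm \<Longrightarrow> dT (g * h) = dT g * h + g * dT h"
  by (simp_all only: C1_sm C1_dX_add C1_dT_add C1_dX_mult C1_dT_mult)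

lemma dX_constf [simp]: "dX (constf c) = 0" and dT_constf [simp]: "dT (constf c) = 0"
  by (auto simp: fun_eq_iff dX_def pdx_def dT_def pdt_def)

lemma C1_basic: "C1 (constf c)" "C1 fx" "C1 ft"
  by (auto simp: C1_def case_prod_beta intro!: continuous_intros)

lemma sm_basic [simp, intro]: "constf c \<in> sm" "fx \<in> sm" "ft \<in> sm"
proof -
  let ?A = "{fx, ft} \<union> range constf"
  have 1: "\<exists>g'\<in>?A. \<forall>x t. (x,t) \<in> D \<longrightarrow> pdx g x t = g' x t" if "g \<in> ?A" for g
  proof -
    have "pdx fx = constf 1" "pdx ft = constf 0" "pdx (constf a) = constf 0" for a
      by (simp_all add: pdx_def fx_def ft_def constf_def)
    then show ?thesis using that by fastforce
  qed
  have 2: "\<exists>g'\<in>?A. \<forall>x t. (x,t) \<in> D \<longrightarrow> pdt g x t = g' x t" if "g \<in> ?A" for g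
  proof -
    have "pdt fx = constf 0" "pdt ft = constf 1" "pdt (constf a) = constf 0" for a
      by (simp_all add: pdt_def fx_def ft_def constf_def)
    then show ?thesis using that by fastforce
  qed
  have 3: "C1 g" if "g \<in> ?A" for g using that C1_basic by auto
  show "constf c \<in> sm" "fx \<in> sm" "ft \<in> sm"
    using sm_coinduct[OF _ 3 1 2, of "constf c"] sm_coinduct[OF _ 3 1 2, of fx] sm_coinduct[OF _ 3 1 2, of ft]
    by blast+
qed

lemma dX_fx: "(x, t) \<in> D \<Longrightarrow> dX fx x t = 1" and dT_ft: "(x, t) \<in> D \<Longrightarrow> dT ft x t = 1"
  and dX_ft [simp]: "dX ft = 0" and dT_fx [simp]: "dT fx = 0"
  by (auto simp: fun_eq_iff dX_def pdx_def dT_def pdt_def)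

lemma sm_0 [simp, intro]: "0 \<in> sm" and sm_1 [simp, intro]: "1 \<in> sm"
  using sm_basic(1)[of 0] sm_basic(1)[of 1] by simp_all

lemma dXT_01 [simp]: "dX 0 = 0" "dX 1 = 0" "dT 0 = 0" "dT 1 = 0"
  using dX_constf[of 0] dX_constf[of 1] dT_constf[of 0] dT_constf[of 1] by simp_all

lemma uminus_constf: "- g = constf (-1) * g"
  by (auto simp: fun_eq_iff)

lemma sm_uminus [simp, intro]: "g \<in> sm \<Longrightarrow> - g \<in> sm"
  and dX_uminus [simp]: "g \<in> sm \<Longrightarrow> dX (- g) = - dX g"
  and dT_uminus [simp]: "g \<in> sm \<Longrightarrow> dT (- g) = - dT g"
  by (simp_all only: uminus_constf sm_mult sm_basic dX_mult dT_mult dX_constf dT_constf mult_zero_left add_0_left)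

lemma sm_minus [simp, intro]: "g \<in> sm \<Longrightarrow> h \<in> sm \<Longrightarrow> g - h \<in> sm"
  and dX_minus [simp]: "g \<in> sm \<Longrightarrow> h \<in> sm \<Longrightarrow> dX (g - h) = dX g - dX h"
  and dT_minus [simp]: "g \<in> sm \<Longrightarrow> h \<in> sm \<Longrightarrow> dT (g - h) = dT g - dT h"
  by (simp_all only: diff_conv_add_uminus sm_add sm_uminus dX_add dT_add dX_uminus dT_uminus)

lemma sm_power [simp, intro]: "g \<in> sm \<Longrightarrow> g ^ n \<in> sm"
  by (induction n) auto

lemma sm_sum [simp, intro]: "(\<And>i. i \<in> A \<Longrightarrow> g i \<in> sm) \<Longrightarrow> sum g A \<in> sm"
  by (induction A rule: infinite_finite_induct) auto

lemma dX_sum [simp]: "(\<And>i. i \<in> A \<Longrightarrow> g i \<in> sm) \<Longrightarrow> dX (sum g A) = (\<Sum>i\<in>A. dX (g i))"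
  by (induction A rule: infinite_finite_induct) auto

lemma dT_sum [simp]: "(\<And>i. i \<in> A \<Longrightarrow> g i \<in> sm) \<Longrightarrow> dT (sum g A) = (\<Sum>i\<in>A. dT (g i))"
  by (induction A rule: infinite_finite_induct) auto

lemma dX_power:
  assumes "g \<in> sm" shows "dX (g ^ n) = constf (real n) * g ^ (n - 1) * dX g"
proof (induction n)
  case (Suc n)
  have *: "g * (constf (real n) * g ^ (n - 1) * dX g) = constf (real n) * g ^ n * dX g"
    by (cases n) (simp_all add: mult_ac)
  have "dX (g ^ Suc n) = dX g * g ^ n + g * (constf (real n) * g ^ (n - 1) * dX g)"
    using assms by (simp only: power_Suc dX_mult sm_power Suc)
  also have "\<dots> = constf (real (Suc n)) * g ^ n * dX g"
    unfolding * of_nat_Suc constf_add by (simp add: algebra_simps)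
  finally show ?case by (simp only: diff_Suc_1)
qed (simp only: power_0 dXT_01 of_nat_0 constf_0 mult_zero_left)

lemma dT_power:
  assumes "g \<in> sm" shows "dT (g ^ n) = constf (real n) * g ^ (n - 1) * dT g"
proof (induction n)
  case (Suc n)
  have *: "g * (constf (real n) * g ^ (n - 1) * dT g) = constf (real n) * g ^ n * dT g"
    by (cases n) (simp_all add: mult_ac)
  have "dT (g ^ Suc n) = dT g * g ^ n + g * (constf (real n) * g ^ (n - 1) * dT g)"
    using assms by (simp only: power_Suc dT_mult sm_power Suc)
  also have "\<dots> = constf (real (Suc n)) * g ^ n * dT g"
    unfolding * of_nat_Suc constf_add by (simp add: algebra_simps)
  finally show ?case by (simp only: diff_Suc_1)
qed (simp only: power_0 dXT_01 of_nat_0 constf_0 mult_zero_left)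

text \<open>Near the point, \<open>g\<close> is its value on a lower edge plus an integral of
  \<open>dT g\<close> in t. Differentiating under the integral in x and then applying the
  fundamental theorem in t produces the mixed derivative in the other order.\<close>

lemma dX_dT:
  assumes g: "g \<in> sm"
  shows "dX (dT g) = dT (dX g)"
proof (intro ext)
  fix x0 t0
  show "dX (dT g) x0 t0 = dT (dX g) x0 t0"
  proof (cases "(x0, t0) \<in> D")
    case True
    then obtain e where e: "e > 0" "cball (x0,t0) e \<subseteq> D"
      using open_D open_contains_cball by blast
    define d where "d = e / 2"
    have d: "d > 0" using e by (simp add: d_def)
    have inD: "(x, t) \<in> D" if "\<bar>x - x0\<bar> \<le> d" "\<bar>t - t0\<bar> \<le> d" for x t
    proof -
      have "dist (x0,t0) (x,t) \<le> \<bar>x0 - x\<bar> + \<bar>t0 - t\<bar>"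
        using sqrt_sum_squares_le_sum_abs by (simp add: dist_Pair_Pair dist_real_def)
      then have "dist (x0,t0) (x,t) \<le> e" using that by (auto simp: d_def abs_minus_commute)
      then show ?thesis using e(2) by (meson mem_cball subsetD)
    qed
    define U where "U = {x0 - d<..<x0 + d}"
    let ?a = "t0 - d"
    have contT: "continuous_on (cbox ?a t) (\<lambda>s. dT g x s)" if "x \<in> U" "t \<in> {t0-d..t0+d}" for x t
      by (rule continuous_on_compose2[OF sm_cont[OF dT_sm[OF g]], of _ "\<lambda>s. (x,s)", simplified])
        (use that in \<open>auto intro!: continuous_intros inD simp: U_def\<close>)
    have eq: "g x t = g x ?a + integral (cbox ?a t) (dT g x)" if "x \<in> U" "t \<in> {t0-d..t0+d}" for x t
    proof -
      have "((dT g x) has_integral (g x t - g x ?a)) {?a..t}"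
        by (rule fundamental_theorem_of_calculus)
          (use that in \<open>auto simp: U_def has_real_derivative_iff_has_vector_derivative[symmetric]
              intro!: has_field_derivative_at_within[OF sm_dt[OF g]] inD\<close>)
      then show ?thesis by (simp add: integral_unique)
    qed
    have der: "((\<lambda>x. integral (cbox ?a t) (dT g x)) has_field_derivative integral (cbox ?a t) (dX (dT g) x)) (at x within U)"
      if "x \<in> U" "t \<in> {t0-d..t0+d}" for x t
    proof (rule leibniz_rule_field_derivative)
      show "((\<lambda>x. dT g x s) has_real_derivative dX (dT g) y s) (at y within U)"
        if "y \<in> U" "s \<in> cbox ?a t" for y s
        using that \<open>t \<in> _\<close> by (intro has_field_derivative_at_within[OF sm_dx[OF dT_sm[OF g]]] inD) (auto simp: U_def)
      show "dT g y integrable_on cbox ?a t" if "y \<in> U" for y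
        using contT[OF that \<open>t \<in> _\<close>] by (rule integrable_continuous)
      show "continuous_on (U \<times> cbox ?a t) (\<lambda>(x, y). dX (dT g) x y)"
        by (rule continuous_on_subset[OF sm_cont]) (use g \<open>t \<in> _\<close> in \<open>auto intro!: inD simp: U_def\<close>)
    qed (use that in \<open>auto simp: U_def\<close>)
    have eq2: "dX g x0 t = dX g x0 ?a + integral (cbox ?a t) (dX (dT g) x0)" if "t \<in> {t0-d..t0+d}" for t
    proof -
      have x0: "x0 \<in> U" using d by (auto simp: U_def)
      have "((\<lambda>x. g x ?a + integral (cbox ?a t) (dT g x)) has_real_derivative
          (dX g x0 ?a + integral (cbox ?a t) (dX (dT g) x0))) (at x0 within U)"
        by (intro derivative_intros der[OF x0 that] has_field_derivative_at_within[OF sm_dx[OF g]] inD) (use d in auto)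
      then have "((\<lambda>x. g x ?a + integral (cbox ?a t) (dT g x)) has_real_derivative
          (dX g x0 ?a + integral (cbox ?a t) (dX (dT g) x0))) (at x0)"
        using x0 by (subst (asm) at_within_open) (auto simp: U_def)
      then have "((\<lambda>x. g x t) has_real_derivative
          (dX g x0 ?a + integral (cbox ?a t) (dX (dT g) x0))) (at x0)"
      proof (rule has_field_derivative_transform_within_open[of _ _ _ U])
        show "g y ?a + integral (cbox ?a t) (dT g y) = g y t" if "y \<in> U" for y
          using eq[OF that \<open>t \<in> _\<close>] by simp
      qed (use x0 in \<open>simp_all add: U_def\<close>)
      then show ?thesis using that d by (intro dX_eqI inD) auto
    qed
    have "continuous_on {?a..t0+d} (\<lambda>s. dX (dT g) x0 s)"
      by (rule continuous_on_compose2[OF sm_cont[OF dX_sm[OF dT_sm[OF g]]], of _ "\<lambda>s. (x0,s)", simplified])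
        (use d in \<open>auto intro!: continuous_intros inD\<close>)
    then have "((\<lambda>t. integral {?a..t} (dX (dT g) x0)) has_real_derivative dX (dT g) x0 t0) (at t0 within {?a..t0+d})"
      by (rule integral_has_real_derivative) (use d in auto)
    then have "((\<lambda>t. integral {?a..t} (dX (dT g) x0)) has_real_derivative dX (dT g) x0 t0) (at t0)"
      using d by (subst (asm) at_within_interior) auto
    then have "((\<lambda>t. dX g x0 ?a + integral {?a..t} (dX (dT g) x0)) has_real_derivative dX (dT g) x0 t0) (at t0)"
      by (auto intro!: derivative_eq_intros)
    then have "((\<lambda>t. dX g x0 t) has_real_derivative dX (dT g) x0 t0) (at t0)"
    proof (rule has_field_derivative_transform_within_open[of _ _ _ "{?a<..<t0+d}"])
      show "dX g x0 ?a + integral {?a..t} (dX (dT g) x0) = dX g x0 t" if "t \<in> {?a<..<t0+d}" for t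
        using eq2[of t] that by simp
    qed (use d in simp_all)
    then show ?thesis using dT_eqI[OF _ True] by metis
  qed (simp add: dX_out dT_out)
qed

lemma dTn_sm [simp, intro]: "g \<in> sm \<Longrightarrow> (dT ^^ p) g \<in> sm"
  and dXn_sm [simp, intro]: "g \<in> sm \<Longrightarrow> (dX ^^ p) g \<in> sm"
  by (induction p) auto

lemma dX_dTn: "g \<in> sm \<Longrightarrow> dX ((dT ^^ p) g) = (dT ^^ p) (dX g)"
  by (induction p) (simp_all add: dX_dT del: dX_mult)

lemma dT_dXn: "g \<in> sm \<Longrightarrow> dT ((dX ^^ p) g) = (dX ^^ p) (dT g)"
  by (induction p) (simp_all add: dX_dT[symmetric])

section \<open>Words of derivatives, termwise differentiation and weighted C^k bounds\<close>

fun dw :: "bool list \<Rightarrow> (real \<Rightarrow> real \<Rightarrow> real) \<Rightarrow> real \<Rightarrow> real \<Rightarrow> real" where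
  "dw [] g = g"
| "dw (b # bs) g = (if b then dX else dT) (dw bs g)"

lemma dw_sm [simp, intro]: "g \<in> sm \<Longrightarrow> dw bs g \<in> sm"
  by (induction bs) auto

lemma dw_append: "dw (bs @ cs) g = dw bs (dw cs g)"
  by (induction bs) auto

lemma dw_add [simp]: "g \<in> sm \<Longrightarrow> h \<in> sm \<Longrightarrow> dw bs (g + h) = dw bs g + dw bs h"
proof (induction bs)
  case (Cons b bs)
  then show ?case by (cases b) (simp_all only: dw.simps if_True if_False dX_add dT_add dw_sm)
qed (simp only: dw.simps)

lemma dw_minus [simp]: "g \<in> sm \<Longrightarrow> h \<in> sm \<Longrightarrow> dw bs (g - h) = dw bs g - dw bs h"
proof (induction bs)
  case (Cons b bs)
  then show ?case by (cases b) (simp_all only: dw.simps if_True if_False dX_minus dT_minus dw_sm)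
qed (simp only: dw.simps)

lemma dw_0 [simp]: "dw bs 0 = 0"
proof (induction bs)
  case (Cons b bs)
  then show ?case by (cases b) (simp_all only: dw.simps if_True if_False dXT_01)
qed (simp only: dw.simps)

lemma dw_sum: "(\<And>i. i \<in> A \<Longrightarrow> g i \<in> sm) \<Longrightarrow> dw bs (sum g A) = (\<Sum>i\<in>A. dw bs (g i))"
  by (induction A rule: infinite_finite_induct) simp_all

lemma dw_replicate: "dw (replicate p False) g = (dT ^^ p) g"
  by (induction p) auto

lemma dw_replicate_X: "dw (replicate p True) g = (dX ^^ p) g"
  by (induction p) auto

text \<open>A majorant for each word permits termwise differentiation, so the sums
  \<open>S bs\<close> of the differentiated series form a class stable under both derivatives, to
  which \<open>sm_coinduct\<close> applies.\<close>

lemma series_sm: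
  assumes g: "\<And>n. g n \<in> sm"
    and M: "\<And>bs. \<exists>M. summable M \<and> (\<forall>n x t. (x,t) \<in> D \<longrightarrow> \<bar>dw bs (g n) x t\<bar> \<le> M n)"
    and G: "\<And>x t. (x,t) \<in> D \<Longrightarrow> G x t = (\<Sum>n. g n x t)"
  shows "G \<in> sm" and "\<And>bs x t. (x,t) \<in> D \<Longrightarrow> (\<lambda>n. dw bs (g n) x t) sums dw bs G x t"
proof -
  define S where "S bs = (\<lambda>x t. \<Sum>n. dw bs (g n) x t)" for bs
  have summ: "summable (\<lambda>n. dw bs (g n) x t)" if "(x,t) \<in> D" for bs x t
  proof -
    obtain M' where M': "summable M'" "\<forall>n x t. (x,t) \<in> D \<longrightarrow> \<bar>dw bs (g n) x t\<bar> \<le> M' n"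
      using M[of bs] by (elim exE conjE)
    have "norm (dw bs (g n) x t) \<le> M' n" for n using M'(2) that by simp
    then show ?thesis by (rule summable_comparison_test'[OF M'(1), of 0])
  qed
  have unif: "uniformly_convergent_on A (\<lambda>n x. \<Sum>i<n. dw bs (g i) (fst (f x)) (snd (f x)))"
    if "f ` A \<subseteq> D" for bs and A :: "'z set" and f :: "'z \<Rightarrow> real \<times> real"
  proof -
    obtain M' where M': "summable M'" "\<forall>n x t. (x,t) \<in> D \<longrightarrow> \<bar>dw bs (g n) x t\<bar> \<le> M' n"
      using M[of bs] by (elim exE conjE)
    have "norm (dw bs (g n) (fst (f x)) (snd (f x))) \<le> M' n" if "x \<in> A" for n x
      using M'(2) that \<open>f ` A \<subseteq> D\<close> by (simp add: image_subset_iff)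
    then show ?thesis by (rule Weierstrass_m_test'[OF _ M'(1)])
  qed
  have ball: "\<exists>e>0. \<forall>s\<in>ball x e. (s, t) \<in> D" "\<exists>e>0. \<forall>s\<in>ball t e. (x, s) \<in> D" if "(x,t) \<in> D" for x t
    using ev_x[OF that] ev_t[OF that] by (auto simp: eventually_nhds_metric dist_commute)
  have dx: "((\<lambda>s. S bs s t) has_real_derivative S (True # bs) x t) (at x)" if xt: "(x,t) \<in> D" for bs x t
  proof -
    obtain e where e: "e > 0" "\<And>s. s \<in> ball x e \<Longrightarrow> (s, t) \<in> D" using ball[OF xt] by blast
    show ?thesis unfolding S_def
    proof (rule has_field_derivative_series'(2)[of "ball x e"])
      show "((\<lambda>s. dw bs (g n) s t) has_real_derivative dw (True # bs) (g n) s t) (at s within ball x e)"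
        if "s \<in> ball x e" for n s
        using sm_dx[OF dw_sm[OF g], of s t bs n] e(2)[OF that] by (auto intro: has_field_derivative_at_within)
      show "uniformly_convergent_on (ball x e) (\<lambda>n s. \<Sum>i<n. dw (True # bs) (g i) s t)"
      proof -
        have "(\<lambda>s. (s,t)) ` ball x e \<subseteq> D" using e(2) by blast
        from unif[OF this, of "True # bs"] show ?thesis by simp
      qed
    qed (use e summ[OF xt] in auto)
  qed
  have dt: "((\<lambda>s. S bs x s) has_real_derivative S (False # bs) x t) (at t)" if xt: "(x,t) \<in> D" for bs x t
  proof -
    obtain e where e: "e > 0" "\<And>s. s \<in> ball t e \<Longrightarrow> (x, s) \<in> D" using ball[OF xt] by blast
    show ?thesis unfolding S_def
    proof (rule has_field_derivative_series'(2)[of "ball t e"])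
      show "((\<lambda>s. dw bs (g n) x s) has_real_derivative dw (False # bs) (g n) x s) (at s within ball t e)"
        if "s \<in> ball t e" for n s
        using sm_dt[OF dw_sm[OF g], of x s bs n] e(2)[OF that] by (auto intro: has_field_derivative_at_within)
      show "uniformly_convergent_on (ball t e) (\<lambda>n s. \<Sum>i<n. dw (False # bs) (g i) x s)"
      proof -
        have "(\<lambda>s. (x,s)) ` ball t e \<subseteq> D" using e(2) by blast
        from unif[OF this, of "False # bs"] show ?thesis by simp
      qed
    qed (use e summ[OF xt] in auto)
  qed
  have cont: "continuous_on D (\<lambda>(x,t). S bs x t)" for bs
  proof -
    have "uniform_limit D (\<lambda>n z. \<Sum>i<n. dw bs (g i) (fst z) (snd z)) (\<lambda>z. S bs (fst z) (snd z)) sequentially"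
      using unif[of "\<lambda>x. x" D bs] by (simp add: uniformly_convergent_uniform_limit_iff suminf_eq_lim S_def)
    moreover have "continuous_on D (\<lambda>z. \<Sum>i<n. dw bs (g i) (fst z) (snd z))" for n
      using sm_cont[OF dw_sm[OF g]] by (intro continuous_intros) (auto simp: case_prod_beta)
    ultimately show ?thesis
      by (auto intro!: uniform_limit_theorem[where F = sequentially] simp: case_prod_beta)
  qed
  have C1S: "C1 (S bs)" for bs
    unfolding C1_def using dx dt cont real_differentiable_def by blast
  have dXS: "dX (S bs) x t = S (True # bs) x t" "dT (S bs) x t = S (False # bs) x t" if "(x,t) \<in> D" for bs x t
    using dx[OF that] dt[OF that] that by (auto intro!: dX_eqI dT_eqI)
  have Ssm: "S bs \<in> sm" for bs
  proof (rule sm_coinduct[of _ "range S"])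
    fix h assume "h \<in> range S"
    then obtain bs where h: "h = S bs" by auto
    show "C1 h" using C1S h by simp
    show "\<exists>g'\<in>range S. \<forall>x t. (x, t) \<in> D \<longrightarrow> pdx h x t = g' x t"
      using dXS(1)[of _ _ bs] unfolding h by (intro bexI[of _ "S (True # bs)"]) (auto simp: dX_def)
    show "\<exists>g'\<in>range S. \<forall>x t. (x, t) \<in> D \<longrightarrow> pdt h x t = g' x t"
      using dXS(2)[of _ _ bs] unfolding h by (intro bexI[of _ "S (False # bs)"]) (auto simp: dT_def)
  qed auto
  show "G \<in> sm" by (rule sm_cong[OF _ Ssm[of "[]"]]) (auto simp: G S_def)
  have "\<forall>x t. (x,t) \<in> D \<longrightarrow> dw bs G x t = S bs x t" for bs
  proof (induction bs)
    case (Cons b bs)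
    then have "dX (dw bs G) = dX (S bs)" "dT (dw bs G) = dT (S bs)" by (auto intro!: dX_cong dT_cong)
    then show ?case using dXS by (cases b) auto
  qed (auto simp: G S_def)
  then show "\<And>bs x t. (x,t) \<in> D \<Longrightarrow> (\<lambda>n. dw bs (g n) x t) sums dw bs G x t"
    using summ by (auto simp: S_def sums_iff)
qed

text \<open>Bounds a C^k norm over \<open>D\<close> in which every derivative carries a weight
  \<open>\<mu>\<close>. The recursion copies the product rule, which gives submultiplicativity with
  constant 1; stated as a relation, it needs no suprema to exist.\<close>

fun bd :: "real \<Rightarrow> nat \<Rightarrow> (real \<Rightarrow> real \<Rightarrow> real) \<Rightarrow> real \<Rightarrow> bool" where
  "bd \<mu> 0 g B \<longleftrightarrow> 0 \<le> B \<and> (\<forall>x t. (x,t) \<in> D \<longrightarrow> \<bar>g x t\<bar> \<le> B)"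
| "bd \<mu> (Suc k) g B \<longleftrightarrow> (\<exists>B0 B1 B2. bd \<mu> k g B0 \<and> bd \<mu> k (dX g) B1 \<and> bd \<mu> k (dT g) B2 \<and> B0 + \<mu> * (B1 + B2) \<le> B)"

lemma bd_nonneg: "0 \<le> \<mu> \<Longrightarrow> bd \<mu> k g B \<Longrightarrow> 0 \<le> B"
proof (induction k arbitrary: g B)
  case (Suc k)
  then obtain B0 B1 B2 where *: "bd \<mu> k g B0" "bd \<mu> k (dX g) B1" "bd \<mu> k (dT g) B2" "B0 + \<mu> * (B1 + B2) \<le> B"
    by auto
  then have "0 \<le> B0" "0 \<le> \<mu> * (B1 + B2)" using Suc by auto
  then show ?case using * by simp
qed auto

lemma bd_mono: "bd \<mu> k g B \<Longrightarrow> B \<le> B' \<Longrightarrow> bd \<mu> k g B'"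
proof (cases k)
  case (Suc k')
  assume "bd \<mu> k g B" "B \<le> B'"
  then show ?thesis unfolding Suc bd.simps by (meson order_trans)
qed force

lemma bd_add: "g \<in> sm \<Longrightarrow> h \<in> sm \<Longrightarrow> bd \<mu> k g B \<Longrightarrow> bd \<mu> k h B' \<Longrightarrow> bd \<mu> k (g + h) (B + B')"
proof (induction k arbitrary: g h B B')
  case 0
  then show ?case by (auto intro!: order_trans[OF abs_triangle_ineq] add_mono)
next
  case (Suc k)
  obtain B0 B1 B2 where 1: "bd \<mu> k g B0" "bd \<mu> k (dX g) B1" "bd \<mu> k (dT g) B2" "B0 + \<mu> * (B1 + B2) \<le> B"
    using Suc.prems(3) by auto
  obtain C0 C1 C2 where 2: "bd \<mu> k h C0" "bd \<mu> k (dX h) C1" "bd \<mu> k (dT h) C2" "C0 + \<mu> * (C1 + C2) \<le> B'"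
    using Suc.prems(4) by auto
  have "bd \<mu> k (g + h) (B0 + C0)" "bd \<mu> k (dX (g + h)) (B1 + C1)" "bd \<mu> k (dT (g + h)) (B2 + C2)"
    using 1 2 Suc.IH Suc.prems by (simp_all only: dX_add dT_add dX_sm dT_sm)
  moreover have "(B0 + C0) + \<mu> * ((B1 + C1) + (B2 + C2)) \<le> B + B'"
    using 1(4) 2(4) by (simp add: algebra_simps)
  ultimately show ?case unfolding bd.simps by blast
qed

text \<open>The product rule reproduces the expansion of the product of the two weighted bounds
  except for its terms of order \<mu>^2, and these are nonnegative.\<close>

lemma bd_mult: "0 \<le> \<mu> \<Longrightarrow> g \<in> sm \<Longrightarrow> h \<in> sm \<Longrightarrow> bd \<mu> k g B \<Longrightarrow> bd \<mu> k h B' \<Longrightarrow> bd \<mu> k (g * h) (B * B')"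
proof (induction k arbitrary: g h B B')
  case 0
  then show ?case by (auto simp: abs_mult intro!: mult_mono)
next
  case (Suc k)
  obtain B0 B1 B2 where 1: "bd \<mu> k g B0" "bd \<mu> k (dX g) B1" "bd \<mu> k (dT g) B2" "B0 + \<mu> * (B1 + B2) \<le> B"
    using Suc.prems(4) by auto
  obtain C0 C1 C2 where 2: "bd \<mu> k h C0" "bd \<mu> k (dX h) C1" "bd \<mu> k (dT h) C2" "C0 + \<mu> * (C1 + C2) \<le> B'"
    using Suc.prems(5) by auto
  note nn = bd_nonneg[OF Suc.prems(1) 1(1)] bd_nonneg[OF Suc.prems(1) 1(2)] bd_nonneg[OF Suc.prems(1) 1(3)]
    bd_nonneg[OF Suc.prems(1) 2(1)] bd_nonneg[OF Suc.prems(1) 2(2)] bd_nonneg[OF Suc.prems(1) 2(3)]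
  have "bd \<mu> k (g * h) (B0 * C0)"
    using 1 2 Suc.IH Suc.prems by blast
  moreover have "bd \<mu> k (dX (g * h)) (B1 * C0 + B0 * C1)" "bd \<mu> k (dT (g * h)) (B2 * C0 + B0 * C2)"
    unfolding dX_mult[OF Suc.prems(2,3)] dT_mult[OF Suc.prems(2,3)]
    using 1 2 Suc.IH Suc.prems by (blast intro!: bd_add sm_mult dX_sm dT_sm)+
  moreover have "B0 * C0 + \<mu> * ((B1 * C0 + B0 * C1) + (B2 * C0 + B0 * C2)) \<le> B * B'"
  proof -
    have "B0 * C0 + \<mu> * ((B1 * C0 + B0 * C1) + (B2 * C0 + B0 * C2))
        \<le> (B0 + \<mu> * (B1 + B2)) * (C0 + \<mu> * (C1 + C2))"
      using nn Suc.prems(1) by (simp add: algebra_simps)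
    also have "\<dots> \<le> B * B'"
      using 1(4) 2(4) nn Suc.prems(1) by (intro mult_mono) (auto intro: order_trans[rotated])
    finally show ?thesis .
  qed
  ultimately show ?case unfolding bd.simps by blast
qed

lemma bd_constf: "bd \<mu> k (constf c) \<bar>c\<bar>"
proof (induction k arbitrary: c)
  case (Suc k)
  have "bd \<mu> k 0 0" using Suc[of 0] by (simp only: constf_0 abs_zero)
  moreover have "\<bar>c\<bar> + \<mu> * (0 + 0) \<le> \<bar>c\<bar>" by simp
  ultimately show ?case using Suc[of c] unfolding bd.simps dX_constf dT_constf by blast
qed simp

lemma bd_power: "0 \<le> \<mu> \<Longrightarrow> g \<in> sm \<Longrightarrow> bd \<mu> k g B \<Longrightarrow> bd \<mu> k (g ^ n) (B ^ n)"
proof (induction n)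
  case 0
  then show ?case using bd_constf[of \<mu> k 1] by (simp only: power_0 constf_1 abs_one)
next
  case (Suc n)
  then have "bd \<mu> k (g ^ n) (B ^ n)" by blast
  then show ?case unfolding power_Suc using Suc.prems by (intro bd_mult sm_power)
qed

lemma bd_Suc_D: "bd \<mu> (Suc k) g B \<Longrightarrow> 0 \<le> \<mu> \<Longrightarrow> bd \<mu> k g B"
proof -
  assume a: "bd \<mu> (Suc k) g B" "0 \<le> \<mu>"
  then obtain B0 B1 B2 where 1: "bd \<mu> k g B0" "bd \<mu> k (dX g) B1" "bd \<mu> k (dT g) B2" "B0 + \<mu> * (B1 + B2) \<le> B"
    by auto
  have "0 \<le> \<mu> * (B1 + B2)" using bd_nonneg 1 a by simp
  then show ?thesis using 1 by (intro bd_mono[OF 1(1)]) simp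
qed

lemma bd_dw:
  assumes "0 < \<mu>" "\<mu> \<le> 1" "length bs \<le> k" "bd \<mu> k g B" "(x,t) \<in> D"
  shows "\<bar>dw bs g x t\<bar> \<le> B / \<mu> ^ k"
  using assms(3,4)
proof (induction bs arbitrary: k g B rule: rev_induct)
  case Nil
  have "\<bar>g x t\<bar> \<le> B" using Nil(2)
    by (induction k) (use assms in \<open>auto dest: bd_Suc_D simp del: bd.simps(2)\<close>)
  also have "B \<le> B / \<mu> ^ k" using assms bd_nonneg[of \<mu> k g B] Nil
    by (simp add: pos_le_divide_eq mult_left_le power_le_one)
  finally show ?case by simp
next
  case (snoc b bs)
  then obtain k' where k: "k = Suc k'" by (cases k) auto
  obtain B0 B1 B2 where 1: "bd \<mu> k' g B0" "bd \<mu> k' (dX g) B1" "bd \<mu> k' (dT g) B2" "B0 + \<mu> * (B1 + B2) \<le> B"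
    using snoc.prems(2) k by auto
  have nn: "0 \<le> B0" "0 \<le> B1" "0 \<le> B2" using bd_nonneg 1 assms by (meson less_imp_le)+
  have "\<mu> * B1 \<le> B" "\<mu> * B2 \<le> B" using 1(4) nn assms(1) mult_nonneg_nonneg[of \<mu> B1] mult_nonneg_nonneg[of \<mu> B2]
    unfolding distrib_left by linarith+
  then have le: "B1 / \<mu> ^ k' \<le> B / \<mu> ^ k" "B2 / \<mu> ^ k' \<le> B / \<mu> ^ k"
    using assms(1) by (simp_all add: k field_simps)
  have "\<bar>dw bs (dX g) x t\<bar> \<le> B1 / \<mu> ^ k'" "\<bar>dw bs (dT g) x t\<bar> \<le> B2 / \<mu> ^ k'"
    using snoc.IH[of k'] 1 snoc.prems(1) k by auto
  then show ?case using le by (cases b) (auto simp: dw_append)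
qed

text \<open>For fixed \<open>k\<close> the weighted norm approaches the supremum norm as
  \<open>\<mu>\<close> tends to 0. A function that is small only in the supremum norm can thus be
  inserted into a power series with convergence of all derivatives up to order
  \<open>k\<close>.\<close>

lemma bd_small:
  assumes "\<And>bs. \<exists>B. \<forall>x t. (x,t) \<in> D \<longrightarrow> \<bar>dw bs g x t\<bar> \<le> B"
    and "\<And>x t. (x,t) \<in> D \<Longrightarrow> \<bar>g x t\<bar> \<le> B0" "0 \<le> B0" "B0 < B"
  shows "\<exists>\<mu>0>0. \<forall>\<mu>. 0 < \<mu> \<longrightarrow> \<mu> \<le> \<mu>0 \<longrightarrow> bd \<mu> k g B"
  using assms
proof (induction k arbitrary: g B0 B)
  case 0
  then have "\<forall>\<mu>. bd \<mu> 0 g B" by force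
  then show ?case by (intro exI[of _ 1]) auto
next
  case (Suc k)
  have dd: "\<exists>C\<ge>0. \<forall>x t. (x,t) \<in> D \<longrightarrow> \<bar>dw [b] g x t\<bar> \<le> C" for b
  proof -
    obtain C where "\<forall>x t. (x,t) \<in> D \<longrightarrow> \<bar>dw [b] g x t\<bar> \<le> C" using Suc.prems(1) by blast
    then have "\<forall>x t. (x,t) \<in> D \<longrightarrow> \<bar>dw [b] g x t\<bar> \<le> max C 0" by fastforce
    then show ?thesis by (intro exI[of _ "max C 0"]) auto
  qed
  obtain C1 where C1: "C1 \<ge> 0" "\<forall>x t. (x,t) \<in> D \<longrightarrow> \<bar>dX g x t\<bar> \<le> C1" using dd[of True] by auto
  obtain C2 where C2: "C2 \<ge> 0" "\<forall>x t. (x,t) \<in> D \<longrightarrow> \<bar>dT g x t\<bar> \<le> C2" using dd[of False] by auto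
  have bX: "\<exists>B. \<forall>x t. (x,t) \<in> D \<longrightarrow> \<bar>dw bs (dX g) x t\<bar> \<le> B" for bs
    using Suc.prems(1)[of "bs @ [True]"] by (simp add: dw_append)
  have bT: "\<exists>B. \<forall>x t. (x,t) \<in> D \<longrightarrow> \<bar>dw bs (dT g) x t\<bar> \<le> B" for bs
    using Suc.prems(1)[of "bs @ [False]"] by (simp add: dw_append)
  obtain m0 where m0: "m0 > 0" "\<And>\<mu>. 0 < \<mu> \<Longrightarrow> \<mu> \<le> m0 \<Longrightarrow> bd \<mu> k g ((B0 + B) / 2)"
    using Suc.IH[of g B0 "(B0+B)/2"] Suc.prems by auto
  obtain m1 where m1: "m1 > 0" "\<And>\<mu>. 0 < \<mu> \<Longrightarrow> \<mu> \<le> m1 \<Longrightarrow> bd \<mu> k (dX g) (C1 + 1)"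
    using Suc.IH[of "dX g" C1 "C1 + 1"] C1 bX by auto
  obtain m2 where m2: "m2 > 0" "\<And>\<mu>. 0 < \<mu> \<Longrightarrow> \<mu> \<le> m2 \<Longrightarrow> bd \<mu> k (dT g) (C2 + 1)"
    using Suc.IH[of "dT g" C2 "C2 + 1"] C2 bT by auto
  \<comment> \<open>The last entry lets the two derivative terms, bounded by \<open>C1 + 1\<close>
    and \<open>C2 + 1\<close>, use up at most half of the gap \<open>B - B0\<close>; the induction
    hypothesis for \<open>g\<close> uses the other half.\<close>
  define m where "m = min (min m0 m1) (min m2 ((B - B0) / 2 / (C1 + 1 + (C2 + 1))))"
  have "m > 0" using m0 m1 m2 C1 C2 Suc.prems by (auto simp: m_def)
  moreover have "bd \<mu> (Suc k) g B" if "0 < \<mu>" "\<mu> \<le> m" for \<mu>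
  proof -
    have "\<mu> * (C1 + 1 + (C2 + 1)) \<le> (B - B0) / 2 / (C1 + 1 + (C2 + 1)) * (C1 + 1 + (C2 + 1))"
      using that C1 C2 by (intro mult_right_mono) (auto simp: m_def)
    also have "\<dots> = (B - B0) / 2" using C1(1) C2(1) by (subst times_divide_eq_left, subst nonzero_mult_div_cancel_right) auto
    finally have "(B0 + B) / 2 + \<mu> * (C1 + 1 + (C2 + 1)) \<le> B" by (simp add: field_simps)
    then show ?thesis using that m0 m1 m2 unfolding bd.simps m_def by (meson min.boundedE)
  qed
  ultimately show ?case by blast
qed

text \<open>The last clause lets an estimate pass from the partial sums of a power series to its limit.\<close>

definition good_norm :: "((real \<Rightarrow> real \<Rightarrow> real) \<Rightarrow> real) \<Rightarrow> bool" where
  "good_norm \<nu> \<longleftrightarrow> (\<forall>g\<in>sm. \<forall>h\<in>sm. \<nu> (g + h) \<le> \<nu> g + \<nu> h \<and> \<nu> (g * h) \<le> \<nu> g * \<nu> h) \<and> (\<forall>g\<in>sm. 0 \<le> \<nu> g)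
     \<and> (\<forall>c. \<nu> (constf c) \<le> \<bar>c\<bar>)
     \<and> (\<exists>k C. 0 \<le> C \<and> (\<forall>g\<in>sm. \<forall>B. (\<forall>bs x t. length bs \<le> k \<longrightarrow> (x,t) \<in> D \<longrightarrow> \<bar>dw bs g x t\<bar> \<le> B) \<longrightarrow> \<nu> g \<le> C * B))"

lemma good_normD:
  assumes "good_norm \<nu>" "g \<in> sm" "h \<in> sm"
  shows "\<nu> (g + h) \<le> \<nu> g + \<nu> h" "\<nu> (g * h) \<le> \<nu> g * \<nu> h" "0 \<le> \<nu> g" "\<nu> (constf c) \<le> \<bar>c\<bar>" "\<nu> (- g) \<le> \<nu> g"
    "\<nu> (g - h) \<le> \<nu> g + \<nu> h" "\<nu> 0 = 0"
proof -
  show "\<nu> (g + h) \<le> \<nu> g + \<nu> h" "\<nu> (g * h) \<le> \<nu> g * \<nu> h" "0 \<le> \<nu> g" "\<nu> (constf c) \<le> \<bar>c\<bar>"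
    using assms unfolding good_norm_def by blast+
  have um: "\<nu> (- g) \<le> \<nu> g" if "g \<in> sm" for g
  proof -
    have "\<nu> (- g) \<le> \<nu> (constf (-1)) * \<nu> g" unfolding uminus_constf using that assms(1) by (simp add: good_norm_def)
    also have "\<dots> \<le> 1 * \<nu> g" using assms(1) that by (intro mult_right_mono) (auto simp: good_norm_def dest: spec[of _ "-1"])
    finally show ?thesis by simp
  qed
  show "\<nu> (- g) \<le> \<nu> g" by (rule um[OF assms(2)])
  show "\<nu> (g - h) \<le> \<nu> g + \<nu> h"
    using assms um[OF assms(3)] unfolding good_norm_def diff_conv_add_uminus by (smt (verit) sm_uminus)
  show "\<nu> 0 = 0" using assms(1) unfolding good_norm_def by (metis abs_zero constf_0 sm_0 order_antisym)
qed

lemma good_norm_power: "good_norm \<nu> \<Longrightarrow> g \<in> sm \<Longrightarrow> \<nu> g \<le> \<eta> \<Longrightarrow> \<nu> (g ^ n) \<le> \<eta> ^ n"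
proof (induction n)
  case 0
  have "\<nu> (constf 1) \<le> \<bar>1\<bar>" by (rule good_normD(4)[OF 0(1) sm_0 sm_0])
  then show ?case by (simp only: power_0 constf_1 abs_one)
next
  case (Suc n)
  have "\<nu> (g * g ^ n) \<le> \<nu> g * \<nu> (g ^ n)" 
    using Suc.prems by (intro good_normD(2) sm_power)
  also have "\<dots> \<le> \<eta> * \<eta> ^ n"
  proof (rule mult_mono)
    show "\<nu> (g ^ n) \<le> \<eta> ^ n" using Suc by blast
    show "0 \<le> \<eta>" "0 \<le> \<nu> (g ^ n)"
      using Suc.prems(3) good_normD(3)[OF Suc.prems(1,2,2)] good_normD(3)[OF Suc.prems(1) sm_power[OF Suc.prems(2), of n] Suc.prems(2)]
      by linarith+
  qed (rule Suc.prems(3))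
  finally show ?case by (simp only: power_Suc)
qed

lemma good_norm_sum:
  assumes "good_norm \<nu>" "\<And>i. i \<in> A \<Longrightarrow> g i \<in> sm"
  shows "\<nu> (sum g A) \<le> (\<Sum>i\<in>A. \<nu> (g i))"
  using assms(2)
proof (induction A rule: infinite_finite_induct)
  case (insert a A)
  have "\<nu> (g a + sum g A) \<le> \<nu> (g a) + \<nu> (sum g A)"
    using insert.prems by (intro good_normD(1)[OF assms(1)] sm_sum) auto
  moreover have "\<nu> (sum g A) \<le> (\<Sum>i\<in>A. \<nu> (g i))" using insert by blast
  ultimately show ?case using insert.hyps unfolding sum.insert[OF insert.hyps] by linarith
qed (use good_normD(7)[OF assms(1) sm_0 sm_0] in \<open>simp_all only: sum.infinite sum.empty order_refl not_False_eq_True\<close>)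

end

section \<open>Composition with power series\<close>

definition deg3 :: "nat \<times> nat \<times> nat \<Rightarrow> nat" where
  "deg3 = (\<lambda>(j,k,l). j + k + l)"

text \<open>The majorant of the series at half its radius: the constant through which the
  coefficients enter the norm estimates.\<close>

definition ps_mass :: "(nat \<times> nat \<times> nat \<Rightarrow> real) \<Rightarrow> real \<Rightarrow> real" where
  "ps_mass c e = (\<Sum>\<^sub>\<infinity>i. \<bar>c i\<bar> * (e / 2) ^ deg3 i)"

definition ps3 :: "(real \<Rightarrow> real \<Rightarrow> real \<Rightarrow> real) \<Rightarrow> real \<Rightarrow> real \<Rightarrow> real \<Rightarrow> (nat \<times> nat \<times> nat \<Rightarrow> real) \<Rightarrow> real \<Rightarrow> bool" where
  "ps3 h x0 t0 w0 c e \<longleftrightarrow> e > 0 \<and>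
        (\<forall>x t w. \<bar>x - x0\<bar> < e \<longrightarrow> \<bar>t - t0\<bar> < e \<longrightarrow> \<bar>w - w0\<bar> < e \<longrightarrow>
           ((\<lambda>(j,k,l). c (j,k,l) * (x - x0)^j * (t - t0)^k * (w - w0)^l) has_sum h x t w) UNIV)"

lemma ps3D:
  assumes "ps3 h x0 t0 w0 c e" "\<bar>x - x0\<bar> < e" "\<bar>t - t0\<bar> < e" "\<bar>w - w0\<bar> < e"
  shows "((\<lambda>(j,k,l). c (j,k,l) * (x - x0)^j * (t - t0)^k * (w - w0)^l) has_sum h x t w) UNIV"
  using assms unfolding ps3_def by blast

text \<open>Convergence at the one corner with all three offsets equal to \<open>e / 2\<close>
  suffices, because unconditional summability of reals is absolute.\<close>

lemma ps3_summable:
  assumes "ps3 h x0 t0 w0 c e"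
  shows "(\<lambda>i. \<bar>c i\<bar> * (e / 2) ^ deg3 i) summable_on UNIV"
proof -
  have e: "e > 0" using assms by (simp add: ps3_def)
  have "((\<lambda>(j,k,l). c (j,k,l) * (x0 + e/2 - x0)^j * (t0 + e/2 - t0)^k * (w0 + e/2 - w0)^l) has_sum
      h (x0 + e/2) (t0 + e/2) (w0 + e/2)) UNIV"
    by (rule ps3D[OF assms]) (use e in auto)
  also have "(\<lambda>(j,k,l). c (j,k,l) * (x0 + e/2 - x0)^j * (t0 + e/2 - t0)^k * (w0 + e/2 - w0)^l)
      = (\<lambda>i. c i * (e / 2) ^ deg3 i)"
    by (auto simp: deg3_def fun_eq_iff power_add)
  finally have "(\<lambda>i. norm (c i * (e / 2) ^ deg3 i)) summable_on UNIV"
    by (rule iffD1[OF summable_on_iff_abs_summable_on_real, OF has_sum_imp_summable])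
  then show ?thesis using e by (simp add: abs_mult power_abs)
qed

lemma ps3_center: assumes "ps3 h x0 t0 w0 c e" shows "h x0 t0 w0 = c (0,0,0)"
proof -
  have "((\<lambda>(j,k,l). c (j,k,l) * (x0 - x0)^j * (t0 - t0)^k * (w0 - w0)^l) has_sum h x0 t0 w0) UNIV"
    by (rule ps3D[OF assms]) (use assms in \<open>auto simp: ps3_def\<close>)
  moreover have "((\<lambda>(j,k,l). c (j,k,l) * (x0 - x0)^j * (t0 - t0)^k * (w0 - w0)^l) has_sum c (0,0,0)) UNIV"
  proof -
    have "((\<lambda>(j,k,l). c (j,k,l) * (x0 - x0)^j * (t0 - t0)^k * (w0 - w0)^l) has_sum
       (\<Sum>(j,k,l)\<in>{(0,0,0)}. c (j,k,l) * (x0 - x0)^j * (t0 - t0)^k * (w0 - w0)^l)) UNIV"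
      by (rule has_sum_finite_neutralI[of "{(0,0,0)}"]) (auto simp: power_0_left split: if_splits)
    then show ?thesis by simp
  qed
  ultimately show ?thesis by (rule has_sum_unique)
qed

text \<open>An enumeration of the multi-indices that starts with (0,0,0), so that splitting off the
  first term of the series removes exactly the constant term.\<close>

definition enum3 :: "nat \<Rightarrow> nat \<times> nat \<times> nat" where
  "enum3 n = (fst (prod_decode n), prod_decode (snd (prod_decode n)))"

lemma bij_enum3: "bij enum3"
proof (rule bijI)
  show "inj enum3"
    by (intro injI) (metis enum3_def prod.collapse prod.inject prod_decode_inverse)
  show "surj enum3"
  proof (rule surjI[of _ "\<lambda>(a,m). prod_encode (a, prod_encode m)"])
    fix y :: "nat \<times> nat \<times> nat"
    show "enum3 (case y of (a, m) \<Rightarrow> prod_encode (a, prod_encode m)) = y"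
      by (cases y) (simp add: enum3_def)
  qed
qed

lemma enum3_0: "enum3 n = (0,0,0) \<longleftrightarrow> n = 0"
proof -
  have "enum3 0 = (0,0,0)"
    by (simp add: enum3_def prod_decode_def prod_decode_aux.simps)
  then show ?thesis using bij_enum3 by (metis bij_pointE)
qed

lemma enum3_sums: "(f has_sum s) UNIV \<Longrightarrow> (\<lambda>n. f (enum3 n)) sums s" for f :: "nat \<times> nat \<times> nat \<Rightarrow> real"
  by (rule has_sum_imp_sums, rule iffD2[OF has_sum_reindex_bij_betw[OF bij_enum3]])

context plane_domain begin

definition mono3 :: "real \<Rightarrow> real \<Rightarrow> real \<Rightarrow> (real \<Rightarrow> real \<Rightarrow> real) \<Rightarrow> nat \<times> nat \<times> nat \<Rightarrow> real \<Rightarrow> real \<Rightarrow> real" where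
  "mono3 x0 t0 w0 u = (\<lambda>(j,k,l). (fx - constf x0)^j * (ft - constf t0)^k * (u - constf w0)^l)"

lemma mono3_sm: "u \<in> sm \<Longrightarrow> mono3 x0 t0 w0 u i \<in> sm"
  by (cases i) (simp add: mono3_def del: times_fun_apply)

lemma bd_cong: "(\<And>x t. (x,t) \<in> D \<Longrightarrow> g x t = h x t) \<Longrightarrow> bd \<mu> k g B \<longleftrightarrow> bd \<mu> k h B"
proof (cases k)
  case (Suc k')
  assume *: "\<And>x t. (x,t) \<in> D \<Longrightarrow> g x t = h x t"
  have "bd \<mu> k g B = bd \<mu> k h B" if "\<And>x t. (x,t) \<in> D \<Longrightarrow> g x t = h x t" for g h k B
    using that
  proof (induction k arbitrary: g h B)
    case (Suc k)
    have "bd \<mu> k g B \<longleftrightarrow> bd \<mu> k h B" for B using Suc by blast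
    moreover have "dX g = dX h" "dT g = dT h" using Suc.prems by (blast intro: dX_cong dT_cong)+
    ultimately show ?case unfolding bd.simps by metis
  qed auto
  then show ?thesis using * by blast
qed auto

lemma bdd_fx:
  assumes "\<And>x t. (x,t) \<in> D \<Longrightarrow> \<bar>(fx - constf x0) x t\<bar> \<le> B" "0 \<le> B"
  shows "\<exists>B. \<forall>x t. (x,t) \<in> D \<longrightarrow> \<bar>dw bs (fx - constf x0) x t\<bar> \<le> B"
proof -
  have 1: "bd 1 k (dX (fx - constf x0)) 1" for k
    using bd_constf[of 1 k 1] by (subst bd_cong[of _ "constf 1"]) (auto simp: dX_fx)
  have 2: "bd 1 k (dT (fx - constf x0)) 0" for k
    using bd_constf[of 1 k 0] by (subst bd_cong[of _ "constf 0"]) auto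
  have "\<exists>B. bd 1 k (fx - constf x0) B" for k
  proof (induction k)
    case 0
    then show ?case unfolding bd.simps using assms by blast
  next
    case (Suc k)
    then show ?case unfolding bd.simps using 1 2 by blast
  qed
  from this[of "length bs"] show ?thesis using bd_dw[of 1 bs "length bs"] by fastforce
qed

lemma bdd_ft:
  assumes "\<And>x t. (x,t) \<in> D \<Longrightarrow> \<bar>(ft - constf t0) x t\<bar> \<le> B" "0 \<le> B"
  shows "\<exists>B. \<forall>x t. (x,t) \<in> D \<longrightarrow> \<bar>dw bs (ft - constf t0) x t\<bar> \<le> B"
proof -
  have 1: "bd 1 k (dT (ft - constf t0)) 1" for k
    using bd_constf[of 1 k 1] by (subst bd_cong[of _ "constf 1"]) (auto simp: dT_ft)
  have 2: "bd 1 k (dX (ft - constf t0)) 0" for k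
    using bd_constf[of 1 k 0] by (subst bd_cong[of _ "constf 0"]) auto
  have "\<exists>B. bd 1 k (ft - constf t0) B" for k
  proof (induction k)
    case 0
    then show ?case unfolding bd.simps using assms by blast
  next
    case (Suc k)
    then show ?case unfolding bd.simps using 1 2 by blast
  qed
  from this[of "length bs"] show ?thesis using bd_dw[of 1 bs "length bs"] by fastforce
qed

text \<open>The series of \<open>h\<close> is inserted term by term; each term is a product in
  \<open>sm\<close>. For the norm estimate the constant term cancels, and a monomial of degree d > 0
  has norm at most \<eta>^d \<le> \<eta> (e/2)^(d-1), which sums to
  \<open>2 / e * ps_mass c e * \<eta>\<close>. A good norm need not be compatible with infinite sums
  as such, so the tail is handled by its C^k clause.\<close>

lemma ps3_compose:
  assumes ps: "ps3 h x0 t0 w0 c e"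
    and u: "u \<in> sm" "\<And>bs. \<exists>B. \<forall>x t. (x,t) \<in> D \<longrightarrow> \<bar>dw bs u x t\<bar> \<le> B"
    and near: "\<And>x t. (x,t) \<in> D \<Longrightarrow> \<bar>x - x0\<bar> \<le> e/4 \<and> \<bar>t - t0\<bar> \<le> e/4 \<and> \<bar>u x t - w0\<bar> \<le> e/4"
  shows "(\<lambda>x t. h x t (u x t)) \<in> sm"
    and "\<And>\<nu> \<eta>. good_norm \<nu> \<Longrightarrow> \<nu> (fx - constf x0) \<le> \<eta> \<Longrightarrow> \<nu> (ft - constf t0) \<le> \<eta> \<Longrightarrow> \<nu> (u - constf w0) \<le> \<eta> \<Longrightarrow>
       \<eta> \<le> e/2 \<Longrightarrow> \<nu> ((\<lambda>x t. h x t (u x t)) - constf (h x0 t0 w0)) \<le> 2 / e * ps_mass c e * \<eta>"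
proof -
  define H where "H = (\<lambda>x t. h x t (u x t))"
  define X where "X = fx - constf x0"
  define T where "T = ft - constf t0"
  define V where "V = u - constf w0"
  have sms: "X \<in> sm" "T \<in> sm" "V \<in> sm" unfolding X_def T_def V_def using u by (intro sm_minus sm_basic; assumption?)+
  have e: "e > 0" using ps by (simp add: ps3_def)
  define g where "g n = constf (c (enum3 n)) * mono3 x0 t0 w0 u (enum3 n)" for n
  define m where "m n = \<bar>c (enum3 n)\<bar> * (e/2) ^ deg3 (enum3 n)" for n
  have gsm: "g n \<in> sm" for n unfolding g_def by (intro sm_mult sm_basic mono3_sm u)
  have msums: "m sums ps_mass c e"
    unfolding m_def using enum3_sums[OF has_sum_infsum[OF ps3_summable[OF ps]]] by (simp add: ps_mass_def)
  have e4: "0 \<le> e/4" "e/4 < e/2" using e by auto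
  have n: "(x,t) \<in> D \<Longrightarrow> \<bar>X x t\<bar> \<le> e/4" "(x,t) \<in> D \<Longrightarrow> \<bar>T x t\<bar> \<le> e/4" "(x,t) \<in> D \<Longrightarrow> \<bar>V x t\<bar> \<le> e/4" for x t
    using near by (auto simp: X_def T_def V_def)
  have bdd: "\<exists>B. \<forall>x t. (x,t) \<in> D \<longrightarrow> \<bar>dw bs X x t\<bar> \<le> B" "\<exists>B. \<forall>x t. (x,t) \<in> D \<longrightarrow> \<bar>dw bs T x t\<bar> \<le> B"
    "\<exists>B. \<forall>x t. (x,t) \<in> D \<longrightarrow> \<bar>dw bs V x t\<bar> \<le> B" for bs
  proof -
    note bdd = bdd_fx[OF n(1)[unfolded X_def] e4(1)] bdd_ft[OF n(2)[unfolded T_def] e4(1)]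
    show "\<exists>B. \<forall>x t. (x,t) \<in> D \<longrightarrow> \<bar>dw bs X x t\<bar> \<le> B" "\<exists>B. \<forall>x t. (x,t) \<in> D \<longrightarrow> \<bar>dw bs T x t\<bar> \<le> B"
      using bdd[of bs] unfolding X_def T_def by blast+
    obtain B where B: "\<forall>x t. (x,t) \<in> D \<longrightarrow> \<bar>dw bs u x t\<bar> \<le> B" using u(2) by blast
    have "\<bar>dw bs V x t\<bar> \<le> B + \<bar>w0\<bar>" if "(x,t) \<in> D" for x t
    proof -
      have "\<bar>dw bs (constf w0) x t\<bar> \<le> \<bar>w0\<bar>"
        using bd_dw[of 1 bs "length bs", OF _ _ _ bd_constf that] by simp
      moreover have "dw bs V x t = dw bs u x t - dw bs (constf w0) x t"
        unfolding V_def by (simp add: dw_minus[OF u(1) sm_basic(1)])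
      ultimately show ?thesis using B that by (smt (verit))
    qed
    then show "\<exists>B. \<forall>x t. (x,t) \<in> D \<longrightarrow> \<bar>dw bs V x t\<bar> \<le> B" by blast
  qed
  \<comment> \<open>The three arguments are at most \<open>e / 4\<close> in the supremum norm; the
    room up to \<open>e / 2\<close> pays for their derivatives once the weight is small. The weight
    depends on \<open>k\<close>, which is harmless since only summability is at stake.\<close>
  have mu: "\<exists>\<mu>. 0 < \<mu> \<and> \<mu> \<le> 1 \<and> bd \<mu> k X (e/2) \<and> bd \<mu> k T (e/2) \<and> bd \<mu> k V (e/2)" for k
  proof -
    obtain m1 where "m1 > 0" "\<forall>\<mu>. 0 < \<mu> \<longrightarrow> \<mu> \<le> m1 \<longrightarrow> bd \<mu> k X (e/2)"
      using bd_small[OF bdd(1) n(1) e4] by blast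
    moreover obtain m2 where "m2 > 0" "\<forall>\<mu>. 0 < \<mu> \<longrightarrow> \<mu> \<le> m2 \<longrightarrow> bd \<mu> k T (e/2)"
      using bd_small[OF bdd(2) n(2) e4] by blast
    moreover obtain m3 where "m3 > 0" "\<forall>\<mu>. 0 < \<mu> \<longrightarrow> \<mu> \<le> m3 \<longrightarrow> bd \<mu> k V (e/2)"
      using bd_small[OF bdd(3) n(3) e4] by blast
    ultimately show ?thesis by (intro exI[of _ "min 1 (min m1 (min m2 m3))"]) auto
  qed
  have bdg: "bd \<mu> k (g n) (m n)" if "0 < \<mu>" "bd \<mu> k X (e/2)" "bd \<mu> k T (e/2)" "bd \<mu> k V (e/2)" for \<mu> k n
  proof -
    obtain j a b where i: "enum3 n = (j,a,b)" by (cases "enum3 n") auto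
    have "bd \<mu> k (constf (c (j,a,b)) * (X ^ j * T ^ a * V ^ b)) (\<bar>c (j,a,b)\<bar> * ((e/2)^j * (e/2)^a * (e/2)^b))"
      by (intro bd_mult bd_power bd_constf sm_mult sm_power sm_basic sms that(2-4) less_imp_le[OF that(1)])
    then show ?thesis
      by (simp add: g_def m_def i mono3_def deg3_def power_add X_def T_def V_def)
  qed
  have dwg: "\<exists>K. 0 \<le> K \<and> (\<forall>n bs x t. length bs \<le> k \<longrightarrow> (x,t) \<in> D \<longrightarrow> \<bar>dw bs (g n) x t\<bar> \<le> K * m n)" for k
  proof -
    obtain \<mu> where mu': "0 < \<mu>" "\<mu> \<le> 1" "bd \<mu> k X (e/2)" "bd \<mu> k T (e/2)" "bd \<mu> k V (e/2)" using mu by blast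
    have "\<bar>dw bs (g n) x t\<bar> \<le> (1 / \<mu> ^ k) * m n" if "length bs \<le> k" "(x,t) \<in> D" for bs n x t
      using bd_dw[OF mu'(1,2) that(1) bdg[OF mu'(1,3,4,5)] that(2)] by simp
    then show ?thesis using mu'(1) by (intro exI[of _ "1 / \<mu> ^ k"]) auto
  qed
  have Msum: "\<exists>M. summable M \<and> (\<forall>n x t. (x,t) \<in> D \<longrightarrow> \<bar>dw bs (g n) x t\<bar> \<le> M n)" for bs
  proof -
    obtain K where "\<forall>n bs' x t. length bs' \<le> length bs \<longrightarrow> (x,t) \<in> D \<longrightarrow> \<bar>dw bs' (g n) x t\<bar> \<le> K * m n" using dwg by blast
    then show ?thesis using msums by (intro exI[of _ "\<lambda>n. K * m n"]) (auto intro: summable_mult sums_summable)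
  qed
  have H: "H x t = (\<Sum>n. g n x t)" if "(x,t) \<in> D" for x t
  proof -
    have "((\<lambda>(j,k,l). c (j,k,l) * (x - x0)^j * (t - t0)^k * (u x t - w0)^l) has_sum h x t (u x t)) UNIV"
      by (rule ps3D[OF ps]) (use near[OF that] e in linarith)+
    from enum3_sums[OF this] have "(\<lambda>n. g n x t) sums H x t"
      by (simp add: g_def mono3_def H_def case_prod_beta mult_ac)
    then show ?thesis by (simp add: sums_iff)
  qed
  note S = series_sm[OF gsm Msum H]
  show "(\<lambda>x t. h x t (u x t)) \<in> sm" using S(1) unfolding H_def by blast
  have g0: "g 0 = constf (h x0 t0 w0)"
    using enum3_0[of 0] by (simp add: g_def mono3_def ps3_center[OF ps])
  show "\<nu> ((\<lambda>x t. h x t (u x t)) - constf (h x0 t0 w0)) \<le> 2 / e * ps_mass c e * \<eta>"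
    if good: "good_norm \<nu>" and a: "\<nu> (fx - constf x0) \<le> \<eta>" "\<nu> (ft - constf t0) \<le> \<eta>" "\<nu> (u - constf w0) \<le> \<eta>" "\<eta> \<le> e/2" for \<nu> \<eta>
  proof -
    have eta: "0 \<le> \<eta>" using a(1) good_normD(3)[OF good sms(1) sms(1)] by (simp add: X_def)
    obtain k C where C: "0 \<le> C" "\<And>g B. g \<in> sm \<Longrightarrow> (\<And>bs x t. length bs \<le> k \<Longrightarrow> (x,t) \<in> D \<Longrightarrow> \<bar>dw bs g x t\<bar> \<le> B) \<Longrightarrow> \<nu> g \<le> C * B"
      using good unfolding good_norm_def by metis
    obtain K where K: "0 \<le> K" "\<And>n bs x t. length bs \<le> k \<Longrightarrow> (x,t) \<in> D \<Longrightarrow> \<bar>dw bs (g n) x t\<bar> \<le> K * m n"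
      using dwg[of k] by metis
    have nug: "\<nu> (g (Suc n)) \<le> m (Suc n) * (2 / e * \<eta>)" for n
    proof -
      obtain j a' b where i: "enum3 (Suc n) = (j,a',b)" by (cases "enum3 (Suc n)") auto
      have d: "j + a' + b \<noteq> 0" using enum3_0[of "Suc n"] i by auto
      have p: "\<nu> (X ^ j) \<le> \<eta> ^ j" "\<nu> (T ^ a') \<le> \<eta> ^ a'" "\<nu> (V ^ b) \<le> \<eta> ^ b"
        by (intro good_norm_power[OF good] sms; use a in \<open>simp add: X_def T_def V_def\<close>)+
      note nn = good_normD(3)[OF good _ sm_0]
      have "\<nu> (constf (c (j,a',b)) * (X ^ j * T ^ a' * V ^ b)) \<le> \<nu> (constf (c (j,a',b))) * \<nu> (X ^ j * T ^ a' * V ^ b)"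
        by (intro good_normD(2)[OF good] sm_mult sm_power sm_basic sms)
      also have "\<dots> \<le> \<nu> (constf (c (j,a',b))) * (\<nu> (X ^ j) * \<nu> (T ^ a') * \<nu> (V ^ b))"
      proof (rule mult_left_mono)
        have "\<nu> (X ^ j * T ^ a' * V ^ b) \<le> \<nu> (X ^ j * T ^ a') * \<nu> (V ^ b)"
          by (intro good_normD(2)[OF good] sm_mult sm_power sms)
        also have "\<dots> \<le> \<nu> (X ^ j) * \<nu> (T ^ a') * \<nu> (V ^ b)"
          by (intro mult_right_mono good_normD(2)[OF good] nn sm_mult sm_power sms)
        finally show "\<nu> (X ^ j * T ^ a' * V ^ b) \<le> \<nu> (X ^ j) * \<nu> (T ^ a') * \<nu> (V ^ b)" .
      qed (intro nn sm_basic)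
      also have "\<nu> (constf (c (j,a',b))) * (\<nu> (X ^ j) * \<nu> (T ^ a') * \<nu> (V ^ b)) \<le> \<bar>c (j,a',b)\<bar> * (\<eta> ^ j * \<eta> ^ a' * \<eta> ^ b)"
        by (intro mult_mono p good_normD(4)[OF good sm_0 sm_0] mult_nonneg_nonneg nn sm_power sms zero_le_power eta) auto
      \<comment> \<open>One factor \<open>\<eta>\<close> is kept, as the degree is positive; the
        others are enlarged to \<open>e / 2\<close> to reach the convergent majorant.\<close>
      also have "\<dots> = \<bar>c (j,a',b)\<bar> * (\<eta> * \<eta> ^ (j + a' + b - 1))"
        unfolding power_add[symmetric] power_Suc[symmetric] using d by simp
      also have "\<dots> \<le> \<bar>c (j,a',b)\<bar> * (\<eta> * (e/2) ^ (j + a' + b - 1))"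
        by (intro mult_left_mono power_mono a eta) auto
      also have "\<dots> = m (Suc n) * (2 / e * \<eta>)"
      proof -
        have "(e/2) ^ (j + a' + b) = (e/2) * (e/2) ^ (j + a' + b - 1)"
          unfolding power_Suc[symmetric] using d by simp
        then show ?thesis using e by (simp only: m_def i deg3_def prod.case) (simp add: field_simps)
      qed
      finally show ?thesis
        by (simp only: g_def i mono3_def X_def T_def V_def prod.case)
    qed
    \<comment> \<open>The remainder tends to 0 in C^k, hence in the norm, so the bound for the
      partial sums survives the limit.\<close>
    define R where "R N = H - sum g {..<N}" for N
    have Hsm: "H \<in> sm" by (rule S(1))
    have Rsm: "R N \<in> sm" for N unfolding R_def by (intro sm_minus Hsm sm_sum gsm)
    have msm: "summable m" and mtot: "suminf m = ps_mass c e" using msums by (auto simp: sums_iff)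
    have mnn: "0 \<le> m n" for n using e by (simp add: m_def)
    have nuR: "\<nu> (R N) \<le> C * (K * (\<Sum>n. m (n + N)))" for N
    proof (rule C(2)[OF Rsm])
      fix bs :: "bool list" and x t assume bs: "length bs \<le> k" "(x,t) \<in> D"
      have "(\<lambda>n. dw bs (g n) x t) sums dw bs H x t" by (rule S(2)[OF _ bs(2)])
      then have "(\<lambda>n. dw bs (g (n + N)) x t) sums (dw bs H x t - (\<Sum>n<N. dw bs (g n) x t))"
        by (rule sums_split_initial_segment)
      moreover have "dw bs (R N) x t = dw bs H x t - (\<Sum>n<N. dw bs (g n) x t)"
        unfolding R_def by (simp add: dw_minus[OF Hsm sm_sum[OF gsm]] dw_sum[OF gsm])
      ultimately have s: "(\<lambda>n. dw bs (g (n + N)) x t) sums dw bs (R N) x t" by simp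
      have sK: "summable (\<lambda>n. K * m (n + N))"
        using msm by (intro summable_mult) (simp add: summable_iff_shift)
      have "\<bar>suminf (\<lambda>n. dw bs (g (n + N)) x t)\<bar> \<le> (\<Sum>n. K * m (n + N))"
        unfolding real_norm_def[symmetric] by (rule norm_suminf_le[OF _ sK]) (use K(2)[OF bs] in simp)
      then show "\<bar>dw bs (R N) x t\<bar> \<le> K * (\<Sum>n. m (n + N))"
        using s msm by (simp add: sums_iff suminf_mult summable_iff_shift)
    qed
    have main: "\<nu> (H - constf (h x0 t0 w0)) \<le> ps_mass c e * (2 / e * \<eta>) + C * (K * (\<Sum>n. m (n + Suc N)))" for N
    proof -
      have "H - constf (h x0 t0 w0) = (\<Sum>n<N. g (Suc n)) + R (Suc N)"
        unfolding R_def sum.lessThan_Suc_shift g0 by (simp add: algebra_simps)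
      moreover have "\<nu> ((\<Sum>n<N. g (Suc n)) + R (Suc N)) \<le> \<nu> (\<Sum>n<N. g (Suc n)) + \<nu> (R (Suc N))"
        by (intro good_normD(1)[OF good] sm_sum gsm Rsm)
      moreover have "\<nu> (\<Sum>n<N. g (Suc n)) \<le> (\<Sum>n<N. \<nu> (g (Suc n)))"
        by (intro good_norm_sum[OF good] gsm)
      moreover have "(\<Sum>n<N. \<nu> (g (Suc n))) \<le> (\<Sum>n<N. m (Suc n) * (2 / e * \<eta>))"
        by (intro sum_mono nug)
      moreover have "(\<Sum>n<N. m (Suc n) * (2 / e * \<eta>)) \<le> ps_mass c e * (2 / e * \<eta>)"
      proof -
        have "(\<Sum>n<N. m (Suc n)) \<le> (\<Sum>n<Suc N. m n)" unfolding sum.lessThan_Suc_shift using mnn by simp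
        also have "\<dots> \<le> ps_mass c e" unfolding mtot[symmetric] by (intro sum_le_suminf msm mnn) auto
        finally show ?thesis unfolding sum_distrib_right[symmetric] using e eta by (intro mult_right_mono) auto
      qed
      ultimately show ?thesis using nuR[of "Suc N"] by simp
    qed
    have "(\<lambda>N. \<Sum>n. m (n + N)) \<longlonglongrightarrow> 0"
      using suminf_exist_split2[OF msm] by simp
    then have "(\<lambda>N. ps_mass c e * (2 / e * \<eta>) + C * (K * (\<Sum>n. m (n + Suc N)))) \<longlonglongrightarrow> ps_mass c e * (2 / e * \<eta>) + C * (K * 0)"
      by (intro tendsto_intros LIMSEQ_Suc)
    from LIMSEQ_le_const[OF this] have "\<nu> (H - constf (h x0 t0 w0)) \<le> ps_mass c e * (2 / e * \<eta>)"
      using main by auto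
    then show ?thesis by (simp add: H_def mult_ac)
  qed
qed

end

section \<open>Mixed Lebesgue norms\<close>

definition nS :: "real \<Rightarrow> real \<Rightarrow> (real \<Rightarrow> real) \<Rightarrow> real" where
  "nS a b f = (SUP x\<in>{a..b}. \<bar>f x\<bar>)"
definition n2 :: "real \<Rightarrow> real \<Rightarrow> (real \<Rightarrow> real) \<Rightarrow> real" where
  "n2 a b f = sqrt (integral {a..b} (\<lambda>x. (f x)\<^sup>2))"
definition n1 :: "real \<Rightarrow> real \<Rightarrow> (real \<Rightarrow> real) \<Rightarrow> real" where
  "n1 a b f = integral {a..b} (\<lambda>x. \<bar>f x\<bar>)"

lemma cont_int [intro]: "continuous_on {a..b} f \<Longrightarrow> f integrable_on {a..b}" for f :: "real \<Rightarrow> real"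
  by (rule integrable_continuous_interval)

lemma nS_ge: assumes "continuous_on {a..b} f" "x \<in> {a..b}" shows "\<bar>f x\<bar> \<le> nS a b f"
proof -
  have "compact ((\<lambda>x. \<bar>f x\<bar>) ` {a..b})"
    by (intro compact_continuous_image continuous_intros assms(1) compact_Icc)
  then have "bdd_above ((\<lambda>x. \<bar>f x\<bar>) ` {a..b})" by (intro bounded_imp_bdd_above compact_imp_bounded)
  then show ?thesis unfolding nS_def by (intro cSUP_upper assms)
qed

lemma nS_le: "a \<le> b \<Longrightarrow> (\<And>x. x \<in> {a..b} \<Longrightarrow> \<bar>f x\<bar> \<le> B) \<Longrightarrow> nS a b f \<le> B"
  unfolding nS_def by (rule cSUP_least) auto

lemma nS_nonneg: "a \<le> b \<Longrightarrow> continuous_on {a..b} f \<Longrightarrow> 0 \<le> nS a b f"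
  using nS_ge[of a b f a] by fastforce

lemma n2_nonneg: "0 \<le> n2 a b f"
  unfolding n2_def
  by (cases "(\<lambda>x. (f x)\<^sup>2) integrable_on {a..b}") (auto intro!: integral_nonneg simp: not_integrable_integral)

lemma n2_sq: "continuous_on {a..b} f \<Longrightarrow> (n2 a b f)\<^sup>2 = integral {a..b} (\<lambda>x. (f x)\<^sup>2)"
  unfolding n2_def by (intro real_sqrt_pow2 integral_nonneg cont_int continuous_intros) auto

lemma n2_mono:
  assumes "continuous_on {a..b} f" "continuous_on {a..b} g" "\<And>x. x \<in> {a..b} \<Longrightarrow> \<bar>f x\<bar> \<le> g x"
  shows "n2 a b f \<le> n2 a b g"
  unfolding n2_def
proof (intro real_sqrt_le_mono integral_le cont_int continuous_intros assms)
  fix x assume "x \<in> {a..b}"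
  then show "(f x)\<^sup>2 \<le> (g x)\<^sup>2" using assms(3) abs_le_square_iff by (metis abs_ge_self order_trans)
qed

lemma cauchy_schwarz_int:
  assumes f: "continuous_on {a..b} f" and g: "continuous_on {a..b} g"
  shows "\<bar>integral {a..b} (\<lambda>x. f x * g x)\<bar> \<le> n2 a b f * n2 a b g"
proof -
  define A where "A = integral {a..b} (\<lambda>x. (f x)\<^sup>2)"
  define B where "B = integral {a..b} (\<lambda>x. f x * g x)"
  define C where "C = integral {a..b} (\<lambda>x. (g x)\<^sup>2)"
  have nn: "0 \<le> A" "0 \<le> C" unfolding A_def C_def
    by (intro integral_nonneg cont_int continuous_intros f g; simp)+
  have q: "0 \<le> A - 2 * l * B + l\<^sup>2 * C" for l
  proof -
    have i1: "((\<lambda>x. (f x)\<^sup>2) has_integral A) {a..b}" "((\<lambda>x. f x * g x) has_integral B) {a..b}"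
      "((\<lambda>x. (g x)\<^sup>2) has_integral C) {a..b}"
      unfolding A_def B_def C_def by (intro integrable_integral cont_int continuous_intros f g)+
    have "((\<lambda>x. (f x)\<^sup>2 - (2 * l) * (f x * g x) + l\<^sup>2 * (g x)\<^sup>2) has_integral (A - (2 * l) * B + l\<^sup>2 * C)) {a..b}"
      by (intro has_integral_add has_integral_diff has_integral_mult_right i1)
    moreover have "0 \<le> (f x)\<^sup>2 - (2 * l) * (f x * g x) + l\<^sup>2 * (g x)\<^sup>2" for x
      using zero_le_power2[of "f x - l * g x"] by (simp add: power2_eq_square algebra_simps)
    ultimately show ?thesis using has_integral_nonneg by blast
  qed
  have "B\<^sup>2 \<le> A * C"
  proof (cases "C = 0")
    case True
    have "B = 0"
    proof (rule ccontr)
      assume "B \<noteq> 0"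
      \<comment> \<open>With \<open>C = 0\<close> this parameter makes the quadratic expression
        equal to -1.\<close>
      then show False using q[of "(A + 1) / (2 * B)"] True by simp
    qed
    then show ?thesis using True by simp
  next
    case False
    then have "0 \<le> (A - 2 * (B / C) * B + (B / C)\<^sup>2 * C) * C" using q[of "B / C"] nn by (intro mult_nonneg_nonneg) auto
    also have "\<dots> = A * C - B\<^sup>2" using False by (simp add: field_simps power2_eq_square)
    finally show ?thesis by simp
  qed
  then have "sqrt (B\<^sup>2) \<le> sqrt (A * C)" by (rule real_sqrt_le_mono)
  then show ?thesis by (simp add: n2_def A_def B_def C_def real_sqrt_mult)
qed

lemma n2_triangle:
  assumes f: "continuous_on {a..b} f" and g: "continuous_on {a..b} g"
  shows "n2 a b (\<lambda>x. f x + g x) \<le> n2 a b f + n2 a b g"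
proof (rule power2_le_imp_le)
  have i1: "((\<lambda>x. (f x)\<^sup>2) has_integral (n2 a b f)\<^sup>2) {a..b}" "((\<lambda>x. (g x)\<^sup>2) has_integral (n2 a b g)\<^sup>2) {a..b}"
    "((\<lambda>x. f x * g x) has_integral integral {a..b} (\<lambda>x. f x * g x)) {a..b}"
    unfolding n2_sq[OF f] n2_sq[OF g] by (intro integrable_integral cont_int continuous_intros f g)+
  have "((\<lambda>x. (f x)\<^sup>2 + 2 * (f x * g x) + (g x)\<^sup>2) has_integral
      ((n2 a b f)\<^sup>2 + 2 * integral {a..b} (\<lambda>x. f x * g x) + (n2 a b g)\<^sup>2)) {a..b}"
    by (intro has_integral_add has_integral_mult_right i1)
  moreover have "(\<lambda>x. (f x)\<^sup>2 + 2 * (f x * g x) + (g x)\<^sup>2) = (\<lambda>x. (f x + g x)\<^sup>2)"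
    by (simp add: power2_eq_square algebra_simps)
  ultimately have "(n2 a b (\<lambda>x. f x + g x))\<^sup>2 = (n2 a b f)\<^sup>2 + 2 * integral {a..b} (\<lambda>x. f x * g x) + (n2 a b g)\<^sup>2"
    using f g by (subst n2_sq) (auto intro: continuous_intros simp: integral_unique)
  also have "\<dots> \<le> (n2 a b f + n2 a b g)\<^sup>2"
    using cauchy_schwarz_int[OF f g] by (simp add: power2_eq_square algebra_simps)
  finally show "(n2 a b (\<lambda>x. f x + g x))\<^sup>2 \<le> (n2 a b f + n2 a b g)\<^sup>2" .
qed (simp add: n2_nonneg)

lemma n2_const: "a \<le> b \<Longrightarrow> 0 \<le> B \<Longrightarrow> n2 a b (\<lambda>x. B) = sqrt (b - a) * B"
  by (simp add: n2_def real_sqrt_mult)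

lemma n2_scale: "n2 a b (\<lambda>x. K * f x) = \<bar>K\<bar> * n2 a b f"
  by (simp add: n2_def power_mult_distrib real_sqrt_mult)

lemma n2_bound:
  assumes "a \<le> b" "continuous_on {a..b} f" "\<And>x. x \<in> {a..b} \<Longrightarrow> \<bar>f x\<bar> \<le> B"
  shows "n2 a b f \<le> sqrt (b - a) * B"
proof -
  have "0 \<le> B" using assms(3)[of a] assms(1) by force
  then show ?thesis using n2_mono[OF assms(2) continuous_on_const assms(3)] n2_const[OF assms(1)] by simp
qed

lemma n2_mult:
  assumes "a \<le> b" "continuous_on {a..b} f" "continuous_on {a..b} g"
  shows "n2 a b (\<lambda>x. f x * g x) \<le> nS a b f * n2 a b g"
proof -
  have "n2 a b (\<lambda>x. f x * g x) \<le> n2 a b (\<lambda>x. nS a b f * \<bar>g x\<bar>)"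
    by (intro n2_mono continuous_intros assms) (auto simp: abs_mult intro!: mult_right_mono nS_ge assms)
  also have "\<dots> = nS a b f * n2 a b g"
    using nS_nonneg[OF assms(1,2)] by (simp add: n2_scale) (simp add: n2_def)
  finally show ?thesis .
qed

lemma n2_cong: "(\<And>x. x \<in> {a..b} \<Longrightarrow> f x = g x) \<Longrightarrow> n2 a b f = n2 a b g"
  unfolding n2_def by (intro arg_cong[of _ _ sqrt] integral_cong) simp

text \<open>Covers the supremum, the L2 and the L1 norm in one variable at once.\<close>

definition xnorm :: "real \<Rightarrow> real \<Rightarrow> ((real \<Rightarrow> real) \<Rightarrow> real) \<Rightarrow> bool" where
  "xnorm a b \<alpha> \<longleftrightarrow>
     (\<forall>f g. continuous_on {a..b} f \<longrightarrow> continuous_on {a..b} g \<longrightarrow> \<alpha> (\<lambda>x. f x + g x) \<le> \<alpha> f + \<alpha> g)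
   \<and> (\<forall>f. continuous_on {a..b} f \<longrightarrow> 0 \<le> \<alpha> f)
   \<and> (\<exists>C\<ge>0. \<forall>f B. continuous_on {a..b} f \<longrightarrow> (\<forall>x\<in>{a..b}. \<bar>f x\<bar> \<le> B) \<longrightarrow> \<alpha> f \<le> C * B)"

lemma xnormD:
  assumes "xnorm a b \<alpha>"
  shows "continuous_on {a..b} f \<Longrightarrow> continuous_on {a..b} g \<Longrightarrow> \<alpha> (\<lambda>x. f x + g x) \<le> \<alpha> f + \<alpha> g"
    "continuous_on {a..b} f \<Longrightarrow> 0 \<le> \<alpha> f"
  using assms unfolding xnorm_def by (elim conjE; blast)+

lemma xnormC:
  assumes "xnorm a b \<alpha>"
  obtains C where "C \<ge> 0"
    "\<And>f B. continuous_on {a..b} f \<Longrightarrow> (\<And>x. x\<in>{a..b} \<Longrightarrow> \<bar>f x\<bar> \<le> B) \<Longrightarrow> \<alpha> f \<le> C * B"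
  using assms unfolding xnorm_def by (elim conjE exE) blast

lemma xnorm_nS: assumes "a \<le> b" shows "xnorm a b (nS a b)"
  unfolding xnorm_def
proof (intro conjI allI impI exI[of _ 1])
  fix f g :: "real \<Rightarrow> real" assume fg: "continuous_on {a..b} f" "continuous_on {a..b} g"
  show "nS a b (\<lambda>x. f x + g x) \<le> nS a b f + nS a b g"
  proof (rule nS_le[OF assms])
    fix x assume "x \<in> {a..b}"
    then show "\<bar>f x + g x\<bar> \<le> nS a b f + nS a b g" using nS_ge[OF fg(1)] nS_ge[OF fg(2)] by (smt (verit))
  qed
qed (auto intro: nS_nonneg[OF assms] nS_le[OF assms])

lemma xnorm_n2: assumes "a \<le> b" shows "xnorm a b (n2 a b)"
  unfolding xnorm_def
  by (intro conjI allI impI exI[of _ "sqrt (b - a)"]) (use assms in \<open>auto intro: n2_triangle n2_nonneg n2_bound\<close>)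

lemma xnorm_n1: assumes "a \<le> b" shows "xnorm a b (n1 a b)"
  unfolding xnorm_def
proof (intro conjI allI impI exI[of _ "b - a"])
  fix f g :: "real \<Rightarrow> real" assume fg: "continuous_on {a..b} f" "continuous_on {a..b} g"
  have "n1 a b (\<lambda>x. f x + g x) \<le> integral {a..b} (\<lambda>x. \<bar>f x\<bar> + \<bar>g x\<bar>)"
    unfolding n1_def by (intro integral_le cont_int continuous_intros fg) auto
  also have "\<dots> = n1 a b f + n1 a b g"
    unfolding n1_def by (intro integral_add cont_int continuous_intros fg)
  finally show "n1 a b (\<lambda>x. f x + g x) \<le> n1 a b f + n1 a b g" .
next
  fix f :: "real \<Rightarrow> real" and B assume f: "continuous_on {a..b} f" "\<forall>x\<in>{a..b}. \<bar>f x\<bar> \<le> B"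
  have "n1 a b f \<le> integral {a..b} (\<lambda>x. B)"
    unfolding n1_def by (intro integral_le cont_int continuous_intros f) (use f in auto)
  then show "n1 a b f \<le> (b - a) * B" using assms by simp
next
  fix f :: "real \<Rightarrow> real" assume f: "continuous_on {a..b} f"
  show "0 \<le> n1 a b f" unfolding n1_def by (intro integral_nonneg cont_int continuous_intros f) auto
qed (use assms in auto)

lemma n1_mult: "continuous_on {a..b} f \<Longrightarrow> continuous_on {a..b} g \<Longrightarrow> n1 a b (\<lambda>x. f x * g x) \<le> n2 a b f * n2 a b g"
  using cauchy_schwarz_int[of a b "\<lambda>x. \<bar>f x\<bar>" "\<lambda>x. \<bar>g x\<bar>"]
  by (simp add: n1_def n2_def abs_mult continuous_on_rabs)

lemma n1_mult':
  assumes "a \<le> b" "continuous_on {a..b} f" "continuous_on {a..b} g"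
  shows "n1 a b (\<lambda>x. f x * g x) \<le> nS a b f * n1 a b g"
proof -
  have "n1 a b (\<lambda>x. f x * g x) \<le> integral {a..b} (\<lambda>x. nS a b f * \<bar>g x\<bar>)"
    unfolding n1_def by (intro integral_le cont_int continuous_intros assms)
      (auto simp: abs_mult intro!: mult_right_mono nS_ge assms)
  then show ?thesis by (simp add: n1_def)
qed

lemma nS_mult:
  assumes "a \<le> b" "continuous_on {a..b} f" "continuous_on {a..b} g"
  shows "nS a b (\<lambda>x. f x * g x) \<le> nS a b f * nS a b g"
  by (intro nS_le assms(1)) (auto simp: abs_mult intro!: mult_mono nS_ge nS_nonneg assms)

text \<open>Uniform continuity on the compact rectangle makes neighbouring slices uniformly close;
  the supremum clause of \<open>xnorm\<close> turns this into closeness of their norms.\<close>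

lemma xnorm_cont:
  fixes c d :: real
  assumes \<alpha>: "xnorm a b \<alpha>" and G: "continuous_on ({a..b} \<times> {c..d}) (\<lambda>(x,t). G x t)"
  shows "continuous_on {c..d} (\<lambda>t. \<alpha> (\<lambda>x. G x t))"
proof -
  obtain C where C: "C \<ge> 0"
    "\<And>f B. continuous_on {a..b} f \<Longrightarrow> (\<And>x. x\<in>{a..b} \<Longrightarrow> \<bar>f x\<bar> \<le> B) \<Longrightarrow> \<alpha> f \<le> C * B"
    using xnormC[OF \<alpha>] by metis
  have slice: "continuous_on {a..b} (\<lambda>x. G x t)" if "t \<in> {c..d}" for t
    by (rule continuous_on_compose2[OF G, of _ "\<lambda>x. (x,t)", simplified]) (use that in \<open>auto intro!: continuous_intros\<close>)
  have uc: "uniformly_continuous_on ({a..b} \<times> {c..d}) (\<lambda>(x,t). G x t)"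
    by (intro compact_uniformly_continuous G compact_Times compact_Icc)
  have le: "\<alpha> (\<lambda>x. G x t) \<le> \<alpha> (\<lambda>x. G x t') + C * B"
    if "t \<in> {c..d}" "t' \<in> {c..d}" "\<And>x. x \<in> {a..b} \<Longrightarrow> \<bar>G x t - G x t'\<bar> \<le> B" for t t' B
  proof -
    have "\<alpha> (\<lambda>x. G x t' + (G x t - G x t')) \<le> \<alpha> (\<lambda>x. G x t') + \<alpha> (\<lambda>x. G x t - G x t')"
      by (rule xnormD[OF \<alpha>]) (intro continuous_intros slice that)+
    moreover have "\<alpha> (\<lambda>x. G x t - G x t') \<le> C * B"
      by (rule C) (use that in \<open>auto intro!: continuous_intros slice\<close>)
    ultimately show ?thesis by simp
  qed
  show ?thesis unfolding continuous_on_iff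
  proof (intro ballI allI impI)
    fix t and e :: real assume t: "t \<in> {c..d}" and e: "e > 0"
    define e' where "e' = e / (2 * (C + 1))"
    have e': "e' > 0" "C * e' < e" using e C(1) by (auto simp: e'_def field_simps intro!: add_nonneg_pos)
    obtain r where r: "r > 0" "\<And>z z'. z \<in> {a..b} \<times> {c..d} \<Longrightarrow> z' \<in> {a..b} \<times> {c..d} \<Longrightarrow> dist z' z < r \<Longrightarrow>
        dist ((\<lambda>(x,t). G x t) z') ((\<lambda>(x,t). G x t) z) < e'"
      using uc e'(1) unfolding uniformly_continuous_on_def by metis
    have "dist (\<alpha> (\<lambda>x. G x t')) (\<alpha> (\<lambda>x. G x t)) < e" if t': "t' \<in> {c..d}" "dist t' t < r" for t'
    proof -
      have *: "\<bar>G x t - G x t'\<bar> \<le> e'" "\<bar>G x t' - G x t\<bar> \<le> e'" if "x \<in> {a..b}" for x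
      proof -
        have "dist (x,t') (x,t) < r" using t' by (simp add: dist_Pair_Pair)
        then have "dist (G x t') (G x t) < e'" using r(2)[of "(x,t)" "(x,t')"] t t' that by simp
        then show "\<bar>G x t - G x t'\<bar> \<le> e'" "\<bar>G x t' - G x t\<bar> \<le> e'" by (auto simp: dist_real_def)
      qed
      show ?thesis using le[OF t t'(1) *(1)] le[OF t'(1) t *(2)] e'(2) by (auto simp: dist_real_def)
    qed
    then show "\<exists>r>0. \<forall>t'\<in>{c..d}. dist t' t < r \<longrightarrow> dist (\<alpha> (\<lambda>x. G x t')) (\<alpha> (\<lambda>x. G x t)) < e"
      using r(1) by blast
  qed
qed

section \<open>Mixed norms on a rectangle\<close>

locale box = plane_domain +
  fixes a b c d :: real
  assumes ab: "a < b" and cd: "c < d" and QD: "{a..b} \<times> {c..d} \<subseteq> D"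
begin

lemma ab_le: "a \<le> b" and cd_le: "c \<le> d"
  using ab cd by auto

lemma QD': "x \<in> {a..b} \<Longrightarrow> t \<in> {c..d} \<Longrightarrow> (x,t) \<in> D"
  using QD by auto

lemma contQ: "g \<in> sm \<Longrightarrow> continuous_on ({a..b} \<times> {c..d}) (\<lambda>(x,t). g x t)"
  by (rule continuous_on_subset[OF sm_cont QD])

lemma cont_x: assumes "g \<in> sm" "t \<in> {c..d}" shows "continuous_on {a..b} (\<lambda>x. g x t)"
  by (rule continuous_on_compose2[OF contQ[OF assms(1)], of _ "\<lambda>x. (x,t)", simplified])
    (use assms(2) in \<open>auto intro!: continuous_intros\<close>)

lemma cont_t: assumes "g \<in> sm" "x \<in> {a..b}" shows "continuous_on {c..d} (\<lambda>t. g x t)"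
  by (rule continuous_on_compose2[OF contQ[OF assms(1)], of _ "\<lambda>t. (x,t)", simplified])
    (use assms(2) in \<open>auto intro!: continuous_intros\<close>)

lemma cont_xnorm: "xnorm a b \<alpha> \<Longrightarrow> g \<in> sm \<Longrightarrow> continuous_on {c..d} (\<lambda>t. \<alpha> (\<lambda>x. g x t))"
  by (rule xnorm_cont[OF _ contQ])

lemma bddQ: assumes "g \<in> sm" obtains B where "0 \<le> B" "\<And>x t. x \<in> {a..b} \<Longrightarrow> t \<in> {c..d} \<Longrightarrow> \<bar>g x t\<bar> \<le> B"
proof -
  have "compact ((\<lambda>(x,t). g x t) ` ({a..b} \<times> {c..d}))"
    by (intro compact_continuous_image contQ assms compact_Times compact_Icc)
  then obtain B where B: "\<forall>y\<in>(\<lambda>(x,t). g x t) ` ({a..b} \<times> {c..d}). norm y \<le> B"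
    using compact_imp_bounded bounded_iff by metis
  show ?thesis
  proof (rule that[of "max B 0"])
    fix x t assume "x \<in> {a..b}" "t \<in> {c..d}"
    then have "g x t \<in> (\<lambda>(x,t). g x t) ` ({a..b} \<times> {c..d})" by force
    then show "\<bar>g x t\<bar> \<le> max B 0" using B by (auto simp: le_max_iff_disj)
  qed simp
qed

text \<open>The L2 term controls the oscillation in t, so that products may lose integrability in x only.\<close>

definition mx :: "((real \<Rightarrow> real) \<Rightarrow> real) \<Rightarrow> (real \<Rightarrow> real \<Rightarrow> real) \<Rightarrow> real" where
  "mx \<alpha> g = nS c d (\<lambda>t. \<alpha> (\<lambda>x. g x t)) + n2 c d (\<lambda>t. \<alpha> (\<lambda>x. dT g x t))"

lemma mx_nonneg: assumes "xnorm a b \<alpha>" "g \<in> sm" shows "0 \<le> mx \<alpha> g"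
  unfolding mx_def using n2_nonneg nS_nonneg[OF cd_le cont_xnorm[OF assms]] by (intro add_nonneg_nonneg)

lemma mx_add:
  assumes \<alpha>: "xnorm a b \<alpha>" and g: "g \<in> sm" and h: "h \<in> sm"
  shows "mx \<alpha> (g + h) \<le> mx \<alpha> g + mx \<alpha> h"
proof -
  have tri: "\<alpha> (\<lambda>x. g x t + h x t) \<le> \<alpha> (\<lambda>x. g x t) + \<alpha> (\<lambda>x. h x t)" "0 \<le> \<alpha> (\<lambda>x. g x t + h x t)"
    if "t \<in> {c..d}" "g \<in> sm" "h \<in> sm" for t g h
    using xnormD(1)[OF \<alpha> cont_x[OF that(2,1)] cont_x[OF that(3,1)]]
      xnormD(2)[OF \<alpha> continuous_on_add[OF cont_x[OF that(2,1)] cont_x[OF that(3,1)]]] by blast+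
  have cc: "continuous_on {c..d} (\<lambda>t. \<alpha> (\<lambda>x. g x t + h x t))" if "g \<in> sm" "h \<in> sm" for g h
    using cont_xnorm[OF \<alpha> sm_add[OF that]] by simp
  have "nS c d (\<lambda>t. \<alpha> (\<lambda>x. g x t + h x t)) \<le> nS c d (\<lambda>t. \<alpha> (\<lambda>x. g x t)) + nS c d (\<lambda>t. \<alpha> (\<lambda>x. h x t))"
  proof (rule nS_le[OF cd_le])
    fix t assume t: "t \<in> {c..d}"
    show "\<bar>\<alpha> (\<lambda>x. g x t + h x t)\<bar> \<le> nS c d (\<lambda>t. \<alpha> (\<lambda>x. g x t)) + nS c d (\<lambda>t. \<alpha> (\<lambda>x. h x t))"
      using tri[OF t g h] nS_ge[OF cont_xnorm[OF \<alpha> g] t] nS_ge[OF cont_xnorm[OF \<alpha> h] t] by linarith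
  qed
  moreover have "n2 c d (\<lambda>t. \<alpha> (\<lambda>x. dT g x t + dT h x t)) \<le> n2 c d (\<lambda>t. \<alpha> (\<lambda>x. dT g x t) + \<alpha> (\<lambda>x. dT h x t))"
    using tri[of _ "dT g" "dT h"] g h
    by (intro n2_mono cc continuous_on_add[OF cont_xnorm[OF \<alpha>] cont_xnorm[OF \<alpha>]]) auto
  moreover have "n2 c d (\<lambda>t. \<alpha> (\<lambda>x. dT g x t) + \<alpha> (\<lambda>x. dT h x t)) \<le> n2 c d (\<lambda>t. \<alpha> (\<lambda>x. dT g x t)) + n2 c d (\<lambda>t. \<alpha> (\<lambda>x. dT h x t))"
    by (rule n2_triangle[OF cont_xnorm[OF \<alpha> dT_sm[OF g]] cont_xnorm[OF \<alpha> dT_sm[OF h]]])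
  ultimately show ?thesis by (simp add: mx_def dT_add[OF g h])
qed

text \<open>Any inequality of Hoelder type in x lifts to the mixed norms: in
  \<open>dT (g * h)\<close> the undifferentiated factor is taken in the supremum over t and the
  differentiated one in L2 over t. The product of the two L2 parts on the right is slack.\<close>

lemma mx_mult:
  assumes \<alpha>: "xnorm a b \<alpha>" and \<beta>: "xnorm a b \<beta>" and \<gamma>: "xnorm a b \<gamma>"
    and le: "\<And>f g. continuous_on {a..b} f \<Longrightarrow> continuous_on {a..b} g \<Longrightarrow> \<alpha> (\<lambda>x. f x * g x) \<le> \<beta> f * \<gamma> g"
    and g: "g \<in> sm" and h: "h \<in> sm"
  shows "mx \<alpha> (g * h) \<le> mx \<beta> g * mx \<gamma> h"
proof -
  note nn = xnormD(2)[OF \<alpha>] xnormD(2)[OF \<beta>] xnormD(2)[OF \<gamma>]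
  define G where "G t = \<beta> (\<lambda>x. g x t)" for t
  define G' where "G' t = \<beta> (\<lambda>x. dT g x t)" for t
  define H where "H t = \<gamma> (\<lambda>x. h x t)" for t
  define H' where "H' t = \<gamma> (\<lambda>x. dT h x t)" for t
  have cG: "continuous_on {c..d} G" "continuous_on {c..d} G'" "continuous_on {c..d} H" "continuous_on {c..d} H'"
    unfolding G_def G'_def H_def H'_def
    using cont_xnorm[OF \<beta> g] cont_xnorm[OF \<beta> dT_sm[OF g]] cont_xnorm[OF \<gamma> h] cont_xnorm[OF \<gamma> dT_sm[OF h]] by blast+
  have pos: "0 \<le> G t" "0 \<le> G' t" "0 \<le> H t" "0 \<le> H' t" if "t \<in> {c..d}" for t
    unfolding G_def G'_def H_def H'_def
    using nn(2)[OF cont_x[OF g that]] nn(2)[OF cont_x[OF dT_sm[OF g] that]]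
      nn(3)[OF cont_x[OF h that]] nn(3)[OF cont_x[OF dT_sm[OF h] that]] by blast+
  have prod: "\<alpha> (\<lambda>x. g x t * h x t) \<le> \<beta> (\<lambda>x. g x t) * \<gamma> (\<lambda>x. h x t)" "0 \<le> \<alpha> (\<lambda>x. g x t * h x t)"
    if "t \<in> {c..d}" "g \<in> sm" "h \<in> sm" for g h t
    using le[OF cont_x[OF that(2,1)] cont_x[OF that(3,1)]]
      nn(1)[OF continuous_on_mult[OF cont_x[OF that(2,1)] cont_x[OF that(3,1)]]] by blast+
  have "nS c d (\<lambda>t. \<alpha> (\<lambda>x. g x t * h x t)) \<le> nS c d G * nS c d H"
  proof (rule nS_le[OF cd_le])
    fix t assume t: "t \<in> {c..d}"
    have "\<alpha> (\<lambda>x. g x t * h x t) \<le> G t * H t" using prod(1)[OF t g h] by (simp add: G_def H_def)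
    also have "\<dots> \<le> nS c d G * nS c d H"
      using nS_ge[OF cG(1) t] nS_ge[OF cG(3) t] pos[OF t] nS_nonneg[OF cd_le cG(1)] by (intro mult_mono) auto
    finally show "\<bar>\<alpha> (\<lambda>x. g x t * h x t)\<bar> \<le> nS c d G * nS c d H" using prod(2)[OF t g h] by simp
  qed
  moreover have "n2 c d (\<lambda>t. \<alpha> (\<lambda>x. dT g x t * h x t + g x t * dT h x t)) \<le> nS c d H * n2 c d G' + nS c d G * n2 c d H'"
  proof -
    have "n2 c d (\<lambda>t. \<alpha> (\<lambda>x. dT g x t * h x t + g x t * dT h x t)) \<le> n2 c d (\<lambda>t. H t * G' t + G t * H' t)"
    proof (rule n2_mono)
      show "continuous_on {c..d} (\<lambda>t. \<alpha> (\<lambda>x. dT g x t * h x t + g x t * dT h x t))"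
        using cont_xnorm[OF \<alpha>, of "dT g * h + g * dT h"] g h by simp
      show "continuous_on {c..d} (\<lambda>t. H t * G' t + G t * H' t)" by (intro continuous_intros cG)
      fix t assume t: "t \<in> {c..d}"
      have "\<alpha> (\<lambda>x. dT g x t * h x t + g x t * dT h x t) \<le> \<alpha> (\<lambda>x. dT g x t * h x t) + \<alpha> (\<lambda>x. g x t * dT h x t)"
        "0 \<le> \<alpha> (\<lambda>x. dT g x t * h x t + g x t * dT h x t)"
      proof -
        have c1: "continuous_on {a..b} (\<lambda>x. dT g x t * h x t)" "continuous_on {a..b} (\<lambda>x. g x t * dT h x t)"
          by (intro continuous_on_mult cont_x t g h dT_sm)+
        show "\<alpha> (\<lambda>x. dT g x t * h x t + g x t * dT h x t) \<le> \<alpha> (\<lambda>x. dT g x t * h x t) + \<alpha> (\<lambda>x. g x t * dT h x t)"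
          by (rule xnormD(1)[OF \<alpha> c1])
        show "0 \<le> \<alpha> (\<lambda>x. dT g x t * h x t + g x t * dT h x t)"
          by (rule xnormD(2)[OF \<alpha> continuous_on_add[OF c1]])
      qed
      then show "\<bar>\<alpha> (\<lambda>x. dT g x t * h x t + g x t * dT h x t)\<bar> \<le> H t * G' t + G t * H' t"
        using prod(1)[OF t dT_sm[OF g] h] prod(1)[OF t g dT_sm[OF h]]
        by (simp add: G_def G'_def H_def H'_def mult.commute)
    qed
    also have "\<dots> \<le> n2 c d (\<lambda>t. H t * G' t) + n2 c d (\<lambda>t. G t * H' t)"
      by (intro n2_triangle continuous_intros cG)
    also have "\<dots> \<le> nS c d H * n2 c d G' + nS c d G * n2 c d H'"
      by (intro add_mono n2_mult cd_le cG)
    finally show ?thesis .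
  qed
  moreover have "nS c d G * nS c d H + (nS c d H * n2 c d G' + nS c d G * n2 c d H') \<le> mx \<beta> g * mx \<gamma> h"
    using n2_nonneg[of c d G'] n2_nonneg[of c d H']
    by (simp add: mx_def G_def[abs_def, symmetric] G'_def[abs_def, symmetric] H_def[abs_def, symmetric]
      H'_def[abs_def, symmetric] algebra_simps)
  ultimately show ?thesis by (simp add: mx_def dT_mult[OF g h])
qed

lemma mx_bound:
  assumes \<alpha>: "xnorm a b \<alpha>"
  obtains C where "0 \<le> C" "\<And>g B. g \<in> sm \<Longrightarrow> (\<And>x t. x \<in> {a..b} \<Longrightarrow> t \<in> {c..d} \<Longrightarrow> \<bar>g x t\<bar> \<le> B \<and> \<bar>dT g x t\<bar> \<le> B) \<Longrightarrow> mx \<alpha> g \<le> C * B"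
proof -
  obtain C where C: "C \<ge> 0"
    "\<And>f B. continuous_on {a..b} f \<Longrightarrow> (\<And>x. x\<in>{a..b} \<Longrightarrow> \<bar>f x\<bar> \<le> B) \<Longrightarrow> \<alpha> f \<le> C * B"
    using xnormC[OF \<alpha>] by metis
  show ?thesis
  proof (rule that[of "C + sqrt (d - c) * C"])
    fix g B assume g: "g \<in> sm" and B: "\<And>x t. x \<in> {a..b} \<Longrightarrow> t \<in> {c..d} \<Longrightarrow> \<bar>g x t\<bar> \<le> B \<and> \<bar>dT g x t\<bar> \<le> B"
    have "\<alpha> (\<lambda>x. g x t) \<le> C * B" "\<alpha> (\<lambda>x. dT g x t) \<le> C * B" "0 \<le> \<alpha> (\<lambda>x. g x t)" "0 \<le> \<alpha> (\<lambda>x. dT g x t)" if "t \<in> {c..d}" for t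
      using C(2)[OF cont_x[OF g that]] C(2)[OF cont_x[OF dT_sm[OF g] that]] B that
        xnormD(2)[OF \<alpha> cont_x[OF g that]] xnormD(2)[OF \<alpha> cont_x[OF dT_sm[OF g] that]] by blast+
    then have *: "\<bar>\<alpha> (\<lambda>x. g x t)\<bar> \<le> C * B" "\<bar>\<alpha> (\<lambda>x. dT g x t)\<bar> \<le> C * B" if "t \<in> {c..d}" for t
      using that by simp_all
    have "nS c d (\<lambda>t. \<alpha> (\<lambda>x. g x t)) \<le> C * B" "n2 c d (\<lambda>t. \<alpha> (\<lambda>x. dT g x t)) \<le> sqrt (d - c) * (C * B)"
      by (rule nS_le[OF cd_le *(1)], assumption, rule n2_bound[OF cd_le cont_xnorm[OF \<alpha> dT_sm[OF g]] *(2)])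
    then show "mx \<alpha> g \<le> (C + sqrt (d - c) * C) * B" by (simp add: mx_def algebra_simps)
  qed (use C cd in auto)
qed

lemma mx_constf: "mx (nS a b) (constf k) \<le> \<bar>k\<bar>"
proof -
  have *: "nS a b (\<lambda>x. l) = \<bar>l\<bar>" for l
    using ab_le by (simp add: nS_def)
  have "nS c d (\<lambda>t. \<bar>k\<bar>) \<le> \<bar>k\<bar>" by (rule nS_le[OF cd_le]) simp
  then show ?thesis unfolding mx_def by (simp add: * n2_def)
qed

end

section \<open>Cutoff derivatives in t and their generating sums\<close>

locale wbox = box +
  fixes m \<rho> :: "real \<Rightarrow> real \<Rightarrow> real"
  assumes m_sm [simp]: "m \<in> sm" and dT_m [simp]: "dT m = 0" and rho_sm [simp]: "\<rho> \<in> sm"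
begin

definition Y :: "(real \<Rightarrow> real \<Rightarrow> real) \<Rightarrow> real \<Rightarrow> real \<Rightarrow> real" where
  "Y g = m * dT g"

definition W :: "nat \<Rightarrow> (real \<Rightarrow> real \<Rightarrow> real) \<Rightarrow> real \<Rightarrow> real \<Rightarrow> real" where
  "W p g = constf (1 / fact p) * \<rho> ^ p * (dT ^^ p) g"

lemma Y_sm [simp, intro]: "g \<in> sm \<Longrightarrow> Y g \<in> sm"
  unfolding Y_def by (intro sm_mult m_sm dT_sm)

lemma W_sm [simp, intro]: "g \<in> sm \<Longrightarrow> W p g \<in> sm"
  unfolding W_def by (intro sm_mult sm_power sm_basic rho_sm dTn_sm)

lemma W_0 [simp]: "W 0 g = g"
  by (simp add: W_def)

lemma dTn_add: "g \<in> sm \<Longrightarrow> h \<in> sm \<Longrightarrow> (dT ^^ p) (g + h) = (dT ^^ p) g + (dT ^^ p) h"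
  using dw_add[of g h "replicate p False"] by (simp only: dw_replicate)

lemma dTn_minus: "g \<in> sm \<Longrightarrow> h \<in> sm \<Longrightarrow> (dT ^^ p) (g - h) = (dT ^^ p) g - (dT ^^ p) h"
  using dw_minus[of g h "replicate p False"] by (simp only: dw_replicate)

lemma W_add: "g \<in> sm \<Longrightarrow> h \<in> sm \<Longrightarrow> W p (g + h) = W p g + W p h"
  by (simp only: W_def dTn_add distrib_left)

lemma W_minus: "g \<in> sm \<Longrightarrow> h \<in> sm \<Longrightarrow> W p (g - h) = W p g - W p h"
  by (simp only: W_def dTn_minus right_diff_distrib)

lemma dTn_const_mult: "k \<in> sm \<Longrightarrow> dT k = 0 \<Longrightarrow> g \<in> sm \<Longrightarrow> (dT ^^ p) (k * g) = k * (dT ^^ p) g"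
proof (induction p)
  case (Suc p)
  then have "(dT ^^ p) (k * g) = k * (dT ^^ p) g" by blast
  then show ?case using Suc.prems by (simp only: funpow.simps o_apply dT_mult dTn_sm mult_zero_left add_0_left)
qed (simp only: funpow.simps id_apply)

lemma W_const_mult: "k \<in> sm \<Longrightarrow> dT k = 0 \<Longrightarrow> g \<in> sm \<Longrightarrow> W p (k * g) = k * W p g"
  unfolding W_def by (simp only: dTn_const_mult mult.left_commute[of k])

text \<open>Dividing by p! removes the binomial coefficients from the Leibniz rule, and the powers
  of \<open>\<rho>\<close> split as \<rho>^i \<rho>^(p-i). The induction compares the two sides
  after multiplication by p + 1.\<close>

lemma W_mult:
  assumes g: "g \<in> sm" and h: "h \<in> sm"
  shows "W p (g * h) = (\<Sum>i\<le>p. W i g * W (p - i) h)"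
proof -
  define E where "E p g = constf (1 / fact p) * (dT ^^ p) g" for p g
  have Esm: "E p g \<in> sm" if "g \<in> sm" for p g unfolding E_def using that by (intro sm_mult sm_basic dTn_sm)
  have ET: "dT (E p g) = constf (real (Suc p)) * E (Suc p) g" if "g \<in> sm" for p g
  proof -
    have "constf (real (Suc p)) * E (Suc p) g = constf (real (Suc p) * (1 / fact (Suc p))) * (dT ^^ Suc p) g"
      by (simp only: E_def constf_mult mult.assoc)
    also have "real (Suc p) * (1 / fact (Suc p)) = 1 / fact p" by (simp add: fact_Suc del: of_nat_Suc)
    also have "constf (1 / fact p) * (dT ^^ Suc p) g = dT (E p g)"
      unfolding E_def using that by (simp only: dT_mult sm_basic dTn_sm dT_constf mult_zero_left add_0_left funpow.simps o_apply)
    finally show ?thesis by (rule sym)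
  qed
  have EE: "E p (g * h) x t = (\<Sum>i\<le>p. E i g x t * E (p - i) h x t)" for x t p
  proof (induction p arbitrary: x t)
    case (Suc p)
    have eq: "E p (g * h) = (\<Sum>i\<le>p. E i g * E (p - i) h)" by (intro ext, rule trans[OF Suc]) simp
    have "dT (E p (g * h)) = (\<Sum>i\<le>p. dT (E i g) * E (p - i) h + E i g * dT (E (p - i) h))"
      unfolding eq using Esm[OF g] Esm[OF h] by (simp only: dT_sum sm_mult dT_mult)
    then have "real (Suc p) * E (Suc p) (g * h) x t = (\<Sum>i\<le>p. real (Suc i) * (E (Suc i) g x t * E (p - i) h x t)) + (\<Sum>i\<le>p. real (Suc (p - i)) * (E i g x t * E (Suc (p - i)) h x t))"
      by (simp add: ET g h fun_eq_iff sum.distrib algebra_simps)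
    \<comment> \<open>Both sums are extended to the range up to \<open>Suc p\<close>; the added
      terms have coefficient 0. The coefficients then add up to \<open>Suc p\<close>.\<close>
    also have "(\<Sum>i\<le>p. real (Suc i) * (E (Suc i) g x t * E (p - i) h x t)) = (\<Sum>i\<le>Suc p. real i * (E i g x t * E (Suc p - i) h x t))"
      by (subst sum.atMost_Suc_shift) simp
    also have "(\<Sum>i\<le>p. real (Suc (p - i)) * (E i g x t * E (Suc (p - i)) h x t)) = (\<Sum>i\<le>Suc p. real (Suc p - i) * (E i g x t * E (Suc p - i) h x t))"
      by (simp add: Suc_diff_le add_diff_eq)
    also have "(\<Sum>i\<le>Suc p. real i * (E i g x t * E (Suc p - i) h x t)) + (\<Sum>i\<le>Suc p. real (Suc p - i) * (E i g x t * E (Suc p - i) h x t))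
        = (\<Sum>i\<le>Suc p. real (Suc p) * (E i g x t * E (Suc p - i) h x t))"
      unfolding sum.distrib[symmetric] by (intro sum.cong refl) (simp add: algebra_simps of_nat_diff)
    also have "\<dots> = real (Suc p) * (\<Sum>i\<le>Suc p. E i g x t * E (Suc p - i) h x t)"
      by (simp only: sum_distrib_left)
    finally show ?case by (simp del: of_nat_Suc sum.atMost_Suc)
  qed (simp add: E_def)
  have WE: "W p g = \<rho> ^ p * E p g" for p g by (simp only: W_def E_def mult_ac)
  show ?thesis
  proof (intro ext)
    fix x t
    have "W p (g * h) x t = (\<Sum>i\<le>p. \<rho> x t ^ p * (E i g x t * E (p - i) h x t))"
      by (simp add: WE EE sum_distrib_left)
    also have "\<dots> = (\<Sum>i\<le>p. (\<rho> x t ^ i * E i g x t) * (\<rho> x t ^ (p - i) * E (p - i) h x t))"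
    proof (intro sum.cong refl)
      fix i assume "i \<in> {..p}"
      then have "\<rho> x t ^ p = \<rho> x t ^ i * \<rho> x t ^ (p - i)" by (simp add: power_add[symmetric])
      then show "\<rho> x t ^ p * (E i g x t * E (p - i) h x t) = (\<rho> x t ^ i * E i g x t) * (\<rho> x t ^ (p - i) * E (p - i) h x t)" by simp
    qed
    finally show "W p (g * h) x t = (\<Sum>i\<le>p. W i g * W (p - i) h) x t" by (simp add: WE)
  qed
qed

end

text \<open>The truncated Cauchy product runs over the triangle i + j \<le> N, the product of
  truncated sums over the whole square, and the extra terms are nonnegative. Hence truncation does
  not spoil submultiplicativity.\<close>

lemma trunc_cauchy:
  fixes A B :: "nat \<Rightarrow> real"
  assumes "\<And>i. 0 \<le> A i" "\<And>i. 0 \<le> B i" "0 \<le> s"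
  shows "(\<Sum>p\<le>N. s ^ p * (\<Sum>i\<le>p. A i * B (p - i))) \<le> (\<Sum>p\<le>N. s ^ p * A p) * (\<Sum>p\<le>N. s ^ p * B p)"
proof -
  have "(\<Sum>p\<le>N. s ^ p * (\<Sum>i\<le>p. A i * B (p - i))) = (\<Sum>p\<le>N. \<Sum>i\<le>p. (s ^ i * A i) * (s ^ (p - i) * B (p - i)))"
    unfolding sum_distrib_left
  proof (intro sum.cong refl)
    fix p i :: nat assume "i \<in> {..p}"
    then have "s ^ p = s ^ i * s ^ (p - i)" by (simp add: power_add[symmetric])
    then show "s ^ p * (A i * B (p - i)) = (s ^ i * A i) * (s ^ (p - i) * B (p - i))" by simp
  qed
  also have "\<dots> = (\<Sum>(i,j)\<in>{(i,j). i + j \<le> N}. (s ^ i * A i) * (s ^ j * B j))"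
    by (rule sum.triangle_reindex_eq[symmetric])
  also have "\<dots> \<le> (\<Sum>(i,j)\<in>{..N} \<times> {..N}. (s ^ i * A i) * (s ^ j * B j))"
    by (intro sum_mono2) (use assms in auto)
  also have "\<dots> = (\<Sum>p\<le>N. s ^ p * A p) * (\<Sum>p\<le>N. s ^ p * B p)"
    by (simp add: sum.cartesian_product[symmetric] sum_product)
  finally show ?thesis .
qed

context box begin

abbreviation "mS \<equiv> mx (nS a b)"
abbreviation "m2 \<equiv> mx (n2 a b)"
abbreviation "m1 \<equiv> mx (n1 a b)"

lemmas xn = xnorm_nS[OF ab_le] xnorm_n2[OF ab_le] xnorm_n1[OF ab_le]

lemma mS_mult: "g \<in> sm \<Longrightarrow> h \<in> sm \<Longrightarrow> mS (g * h) \<le> mS g * mS h"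
  by (rule mx_mult[OF xn(1,1,1) nS_mult[OF ab_le]])

lemma m2_mult: "g \<in> sm \<Longrightarrow> h \<in> sm \<Longrightarrow> m2 (g * h) \<le> mS g * m2 h"
  by (rule mx_mult[OF xn(2,1,2) n2_mult[OF ab_le]])

lemma m1_mult: "g \<in> sm \<Longrightarrow> h \<in> sm \<Longrightarrow> m1 (g * h) \<le> mS g * m1 h"
  by (rule mx_mult[OF xn(3,1,3) n1_mult'[OF ab_le]])

lemma m1_mult2: "g \<in> sm \<Longrightarrow> h \<in> sm \<Longrightarrow> m1 (g * h) \<le> m2 g * m2 h"
  by (rule mx_mult[OF xn(3,2,2) n1_mult])

lemma mx_0: assumes "xnorm a b \<alpha>" shows "mx \<alpha> 0 = 0"
proof -
  obtain C where "0 \<le> C" "\<And>g B. g \<in> sm \<Longrightarrow> (\<And>x t. x \<in> {a..b} \<Longrightarrow> t \<in> {c..d} \<Longrightarrow> \<bar>g x t\<bar> \<le> B \<and> \<bar>dT g x t\<bar> \<le> B) \<Longrightarrow> mx \<alpha> g \<le> C * B"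
    using mx_bound[OF assms] by metis
  from this(2)[of 0 0] have "mx \<alpha> 0 \<le> 0" by simp
  then show ?thesis using mx_nonneg[OF assms sm_0] by simp
qed

lemma mx_sum:
  assumes "xnorm a b \<alpha>" "\<And>i. i \<in> A \<Longrightarrow> g i \<in> sm"
  shows "mx \<alpha> (sum g A) \<le> (\<Sum>i\<in>A. mx \<alpha> (g i))"
  using assms(2)
proof (induction A rule: infinite_finite_induct)
  case (insert x A)
  have "mx \<alpha> (g x + sum g A) \<le> mx \<alpha> (g x) + mx \<alpha> (sum g A)"
    using insert.prems by (intro mx_add[OF assms(1)] sm_sum) auto
  moreover have "mx \<alpha> (sum g A) \<le> (\<Sum>i\<in>A. mx \<alpha> (g i))" using insert by blast
  ultimately show ?case using insert.hyps unfolding sum.insert[OF insert.hyps] by linarith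
qed (simp_all only: sum.infinite sum.empty order_refl not_False_eq_True mx_0[OF assms(1)])

end

context wbox begin

definition MX :: "real \<Rightarrow> ((real \<Rightarrow> real) \<Rightarrow> real) \<Rightarrow> nat \<Rightarrow> (real \<Rightarrow> real \<Rightarrow> real) \<Rightarrow> real" where
  "MX s \<alpha> N g = (\<Sum>p\<le>N. s ^ p * mx \<alpha> (W p g))"

abbreviation KS :: "real \<Rightarrow> nat \<Rightarrow> (real \<Rightarrow> real \<Rightarrow> real) \<Rightarrow> real" where "KS s \<equiv> MX s (nS a b)"
abbreviation K2 :: "real \<Rightarrow> nat \<Rightarrow> (real \<Rightarrow> real \<Rightarrow> real) \<Rightarrow> real" where "K2 s \<equiv> MX s (n2 a b)"
abbreviation K1 :: "real \<Rightarrow> nat \<Rightarrow> (real \<Rightarrow> real \<Rightarrow> real) \<Rightarrow> real" where "K1 s \<equiv> MX s (n1 a b)"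

lemma MX_nonneg: "xnorm a b \<alpha> \<Longrightarrow> g \<in> sm \<Longrightarrow> 0 \<le> s \<Longrightarrow> 0 \<le> MX s \<alpha> N g"
  unfolding MX_def by (intro sum_nonneg mult_nonneg_nonneg zero_le_power mx_nonneg W_sm)

lemma MX_add:
  assumes "xnorm a b \<alpha>" "g \<in> sm" "h \<in> sm" "0 \<le> s"
  shows "MX s \<alpha> N (g + h) \<le> MX s \<alpha> N g + MX s \<alpha> N h"
  unfolding MX_def sum.distrib[symmetric] distrib_left[symmetric] W_add[OF assms(2,3)]
  using mx_add[OF assms(1) W_sm[OF assms(2)] W_sm[OF assms(3)]] assms(4)
  by (intro sum_mono mult_left_mono) auto

lemma MX_mult_gen:
  assumes "xnorm a b \<alpha>" "xnorm a b \<beta>" "xnorm a b \<gamma>" and sm: "g \<in> sm" "h \<in> sm" and s: "0 \<le> s"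
    and le: "\<And>g h. g \<in> sm \<Longrightarrow> h \<in> sm \<Longrightarrow> mx \<alpha> (g * h) \<le> mx \<beta> g * mx \<gamma> h"
  shows "MX s \<alpha> N (g * h) \<le> MX s \<beta> N g * MX s \<gamma> N h"
proof -
  have "mx \<alpha> (W p (g * h)) \<le> (\<Sum>i\<le>p. mx \<beta> (W i g) * mx \<gamma> (W (p - i) h))" for p
  proof -
    have "mx \<alpha> (W p (g * h)) \<le> (\<Sum>i\<le>p. mx \<alpha> (W i g * W (p - i) h))"
      unfolding W_mult[OF sm] by (intro mx_sum assms(1) sm_mult W_sm sm)
    also have "\<dots> \<le> (\<Sum>i\<le>p. mx \<beta> (W i g) * mx \<gamma> (W (p - i) h))"
      by (intro sum_mono le W_sm sm)
    finally show ?thesis .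
  qed
  then have "MX s \<alpha> N (g * h) \<le> (\<Sum>p\<le>N. s ^ p * (\<Sum>i\<le>p. mx \<beta> (W i g) * mx \<gamma> (W (p - i) h)))"
    unfolding MX_def using s by (intro sum_mono mult_left_mono) auto
  also have "\<dots> \<le> MX s \<beta> N g * MX s \<gamma> N h"
    unfolding MX_def by (intro trunc_cauchy mx_nonneg assms(2,3) W_sm sm s)
  finally show ?thesis .
qed

lemma KS_mult: "g \<in> sm \<Longrightarrow> h \<in> sm \<Longrightarrow> 0 \<le> s \<Longrightarrow> KS s N (g * h) \<le> KS s N g * KS s N h"
  by (rule MX_mult_gen[OF xn(1,1,1) _ _ _ mS_mult])
lemma K2_mult: "g \<in> sm \<Longrightarrow> h \<in> sm \<Longrightarrow> 0 \<le> s \<Longrightarrow> K2 s N (g * h) \<le> KS s N g * K2 s N h"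
  by (rule MX_mult_gen[OF xn(2,1,2) _ _ _ m2_mult])
lemma K1_mult: "g \<in> sm \<Longrightarrow> h \<in> sm \<Longrightarrow> 0 \<le> s \<Longrightarrow> K1 s N (g * h) \<le> KS s N g * K1 s N h"
  by (rule MX_mult_gen[OF xn(3,1,3) _ _ _ m1_mult])
lemma K1_mult2: "g \<in> sm \<Longrightarrow> h \<in> sm \<Longrightarrow> 0 \<le> s \<Longrightarrow> K1 s N (g * h) \<le> K2 s N g * K2 s N h"
  by (rule MX_mult_gen[OF xn(3,2,2) _ _ _ m1_mult2])

text \<open>Analogue of the intersection of L^infinity with H^1, which is an algebra:
  \<open>Y\<close> is a derivation, and in \<open>Y (g * h)\<close> the undifferentiated factor is
  measured by \<open>KS\<close>, the other by \<open>K2\<close>. It supplies the bounds needed for a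
  coefficient H that enters the equation both as H and as Y H.\<close>

definition nrm :: "real \<Rightarrow> nat \<Rightarrow> (real \<Rightarrow> real \<Rightarrow> real) \<Rightarrow> real" where
  "nrm s N g = KS s N g + K2 s N (Y g)"

lemma dTn_0: "(dT ^^ p) 0 = 0"
  using dw_0[of "replicate p False"] by (simp only: dw_replicate)

lemma dTn_constf: "p \<noteq> 0 \<Longrightarrow> (dT ^^ p) (constf k) = 0"
  by (cases p) (simp_all add: funpow_swap1 dTn_0 del: funpow.simps(2) add: funpow_Suc_right)

lemma W_constf: "p \<noteq> 0 \<Longrightarrow> W p (constf k) = 0"
  by (simp add: W_def dTn_constf)

lemma W_zero: "W p 0 = 0"
  by (simp add: W_def dTn_0)

lemma Y_add: "g \<in> sm \<Longrightarrow> h \<in> sm \<Longrightarrow> Y (g + h) = Y g + Y h"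
  by (simp only: Y_def dT_add distrib_left)

lemma Y_mult: "g \<in> sm \<Longrightarrow> h \<in> sm \<Longrightarrow> Y (g * h) = h * Y g + g * Y h"
  by (simp only: Y_def dT_mult distrib_left mult_ac)

lemma Y_constf: "Y (constf k) = 0"
  by (simp add: Y_def)

lemma MX_constf: "MX s \<alpha> N (constf k) = mx \<alpha> (constf k)" if "xnorm a b \<alpha>"
proof -
  have "MX s \<alpha> N (constf k) = (\<Sum>p\<in>{0}. s ^ p * mx \<alpha> (W p (constf k)))"
    unfolding MX_def by (rule sum.mono_neutral_right) (auto simp: W_constf mx_0[OF that])
  then show ?thesis by simp
qed

lemma MX_zero: "xnorm a b \<alpha> \<Longrightarrow> MX s \<alpha> N 0 = 0"
  by (simp only: MX_def W_zero mx_0 mult_zero_right sum.neutral_const)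

lemma good_norm_nrm:
  assumes s: "0 \<le> s"
  shows "good_norm (nrm s N)"
  unfolding good_norm_def
proof (intro conjI ballI allI)
  fix g h assume gh: "g \<in> sm" "h \<in> sm"
  show "nrm s N (g + h) \<le> nrm s N g + nrm s N h"
    using MX_add[OF xn(1) gh s, of N] MX_add[OF xn(2) Y_sm[OF gh(1)] Y_sm[OF gh(2)] s, of N]
    unfolding nrm_def Y_add[OF gh] by linarith
  have "K2 s N (Y (g * h)) \<le> KS s N h * K2 s N (Y g) + KS s N g * K2 s N (Y h)"
    using MX_add[OF xn(2) sm_mult[OF gh(2) Y_sm[OF gh(1)]] sm_mult[OF gh(1) Y_sm[OF gh(2)]] s, of N]
      K2_mult[OF gh(2) Y_sm[OF gh(1)] s, of N] K2_mult[OF gh(1) Y_sm[OF gh(2)] s, of N]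
    unfolding Y_mult[OF gh] by linarith
  moreover have "0 \<le> K2 s N (Y g) * K2 s N (Y h)"
    by (intro mult_nonneg_nonneg MX_nonneg xn Y_sm gh s)
  ultimately show "nrm s N (g * h) \<le> nrm s N g * nrm s N h"
    using KS_mult[OF gh s, of N] unfolding nrm_def by (simp add: algebra_simps)
next
  fix g assume "g \<in> sm"
  then show "0 \<le> nrm s N g" unfolding nrm_def by (intro add_nonneg_nonneg MX_nonneg xn Y_sm s)
next
  fix k show "nrm s N (constf k) \<le> \<bar>k\<bar>"
    unfolding nrm_def Y_constf MX_zero[OF xn(2)] MX_constf[OF xn(1)] using mx_constf[of k] by simp
next
  obtain C1 where C1: "0 \<le> C1" "\<And>g B. g \<in> sm \<Longrightarrow> (\<And>x t. x \<in> {a..b} \<Longrightarrow> t \<in> {c..d} \<Longrightarrow> \<bar>g x t\<bar> \<le> B \<and> \<bar>dT g x t\<bar> \<le> B) \<Longrightarrow> mS g \<le> C1 * B"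
    using mx_bound[OF xn(1)] by metis
  obtain C2 where C2: "0 \<le> C2" "\<And>g B. g \<in> sm \<Longrightarrow> (\<And>x t. x \<in> {a..b} \<Longrightarrow> t \<in> {c..d} \<Longrightarrow> \<bar>g x t\<bar> \<le> B \<and> \<bar>dT g x t\<bar> \<le> B) \<Longrightarrow> m2 g \<le> C2 * B"
    using mx_bound[OF xn(2)] by metis
  define \<kappa> where "\<kappa> p = constf (1 / fact p) * \<rho> ^ p" for p :: nat
  have ksm: "\<kappa> p \<in> sm" for p unfolding \<kappa>_def by (intro sm_mult sm_basic sm_power rho_sm)
  define C where "C = (\<Sum>p\<le>N. s ^ p * (mS (\<kappa> p) * C1)) + (\<Sum>p\<le>N. s ^ p * (mS m * (mS (\<kappa> p) * C2)))"
  have nn: "0 \<le> mS g" if "g \<in> sm" for g by (rule mx_nonneg[OF xn(1) that])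
  \<comment> \<open>\<open>N + 2\<close> derivatives are counted: up to \<open>N\<close> from
    \<open>W\<close>, one from \<open>Y\<close>, and one from the \<open>dT\<close> inside
    \<open>mx\<close>.\<close>
  have "nrm s N g \<le> C * B" if g: "g \<in> sm" and B: "\<forall>bs x t. length bs \<le> N + 2 \<longrightarrow> (x,t) \<in> D \<longrightarrow> \<bar>dw bs g x t\<bar> \<le> B" for g B
  proof -
    have TB: "\<bar>(dT ^^ p) g x t\<bar> \<le> B" if "p \<le> N + 2" "(x,t) \<in> D" for p x t
      using B[rule_format, of "replicate p False" x t] that by (simp add: dw_replicate)
    have 1: "mS (W p g) \<le> mS (\<kappa> p) * C1 * B" if "p \<le> N" for p
    proof -
      have "mS (W p g) \<le> mS (\<kappa> p) * mS ((dT ^^ p) g)"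
        unfolding W_def \<kappa>_def[symmetric] by (intro mS_mult ksm dTn_sm g)
      also have "mS ((dT ^^ p) g) \<le> C1 * B"
        using TB[of p] TB[of "Suc p"] that QD' by (intro C1(2) dTn_sm g) auto
      finally show ?thesis using nn[OF ksm] by (simp add: mult_left_mono mult.assoc)
    qed
    have 2: "m2 (W p (Y g)) \<le> mS m * (mS (\<kappa> p) * C2) * B" if "p \<le> N" for p
    proof -
      have "m2 (W p (Y g)) \<le> mS m * m2 (W p (dT g))"
        unfolding Y_def W_const_mult[OF m_sm dT_m dT_sm[OF g]] by (intro m2_mult m_sm W_sm dT_sm g)
      also have "m2 (W p (dT g)) \<le> mS (\<kappa> p) * m2 ((dT ^^ p) (dT g))"
        unfolding W_def \<kappa>_def[symmetric] by (intro m2_mult ksm dTn_sm dT_sm g)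
      also have "m2 ((dT ^^ p) (dT g)) \<le> C2 * B"
      proof (intro C2(2) dTn_sm dT_sm g)
        fix x t assume "x \<in> {a..b}" "t \<in> {c..d}"
        then show "\<bar>(dT ^^ p) (dT g) x t\<bar> \<le> B \<and> \<bar>dT ((dT ^^ p) (dT g)) x t\<bar> \<le> B"
          using TB[of "Suc p"] TB[of "Suc (Suc p)"] that QD' by (simp add: funpow_swap1)
      qed
      finally show ?thesis using nn[OF ksm] nn[OF m_sm] by (simp add: mult_left_mono mult.assoc)
    qed
    have "KS s N g \<le> (\<Sum>p\<le>N. s ^ p * (mS (\<kappa> p) * C1 * B))"
      unfolding MX_def using 1 s by (intro sum_mono mult_left_mono) auto
    moreover have "K2 s N (Y g) \<le> (\<Sum>p\<le>N. s ^ p * (mS m * (mS (\<kappa> p) * C2) * B))"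
      unfolding MX_def using 2 s by (intro sum_mono mult_left_mono) auto
    ultimately show ?thesis
      by (simp add: nrm_def C_def sum_distrib_right distrib_right mult.assoc)
  qed
  moreover have "0 \<le> C" unfolding C_def
    by (intro add_nonneg_nonneg sum_nonneg mult_nonneg_nonneg zero_le_power s nn ksm m_sm C1 C2)
  ultimately show "\<exists>k C. 0 \<le> C \<and> (\<forall>g\<in>sm. \<forall>B. (\<forall>bs x t. length bs \<le> k \<longrightarrow> (x, t) \<in> D \<longrightarrow> \<bar>dw bs g x t\<bar> \<le> B) \<longrightarrow> nrm s N g \<le> C * B)"
    by blast
qed

end

section \<open>The energy estimate\<close>

lemma int_abs_le:
  fixes f :: "real \<Rightarrow> real"
  assumes "continuous_on {a..b} f" shows "\<bar>integral {a..b} f\<bar> \<le> integral {a..b} (\<lambda>x. \<bar>f x\<bar>)"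
  unfolding real_norm_def[symmetric]
  by (rule integral_norm_bound_integral) (auto intro!: cont_int continuous_intros assms)

context box begin

definition II :: "(real \<Rightarrow> real \<Rightarrow> real) \<Rightarrow> real" where
  "II f = integral {c..d} (\<lambda>t. integral {a..b} (\<lambda>x. f x t))"

lemma contI: "g \<in> sm \<Longrightarrow> continuous_on {c..d} (\<lambda>t. integral {a..b} (\<lambda>x. g x t))"
proof -
  assume "g \<in> sm"
  then have "continuous_on ({c..d} \<times> cbox a b) (\<lambda>(t,x). g x t)"
    using continuous_on_swap_args[OF contQ[of g]] by simp
  from integral_continuous_on_param[OF this] show ?thesis by simp
qed

lemma II_add: assumes "f \<in> sm" "g \<in> sm" shows "II (f + g) = II f + II g"
proof -
  have "integral {a..b} (\<lambda>x. f x t + g x t) = integral {a..b} (\<lambda>x. f x t) + integral {a..b} (\<lambda>x. g x t)" if "t \<in> {c..d}" for t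
    by (intro integral_add cont_int cont_x assms that)
  then have "II (f + g) = integral {c..d} (\<lambda>t. integral {a..b} (\<lambda>x. f x t) + integral {a..b} (\<lambda>x. g x t))"
    unfolding II_def by (intro integral_cong) simp
  also have "\<dots> = II f + II g" unfolding II_def by (intro integral_add cont_int contI assms)
  finally show ?thesis .
qed

lemma II_swap: assumes "g \<in> sm" shows "II g = integral {a..b} (\<lambda>x. integral {c..d} (\<lambda>t. g x t))"
  using integral_swap_continuous[of a c b d g] contQ[OF assms] by (simp add: II_def cbox_Pair_eq)

lemma II_dX:
  assumes g: "g \<in> sm" and bd: "\<And>t. t \<in> {c..d} \<Longrightarrow> g a t = 0 \<and> g b t = 0"
  shows "II (dX g) = 0"
proof -
  have "integral {a..b} (\<lambda>x. dX g x t) = 0" if t: "t \<in> {c..d}" for t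
  proof -
    have "((\<lambda>x. dX g x t) has_integral (g b t - g a t)) {a..b}"
    proof (rule fundamental_theorem_of_calculus[OF ab_le])
      fix x assume "x \<in> {a..b}"
      then show "((\<lambda>x. g x t) has_vector_derivative dX g x t) (at x within {a..b})"
        unfolding has_real_derivative_iff_has_vector_derivative[symmetric]
        by (intro has_field_derivative_at_within[OF sm_dx[OF g]] QD' t)
    qed
    then show ?thesis using bd[OF t] by (simp add: integral_unique)
  qed
  then have "II (dX g) = integral {c..d} (\<lambda>t. 0)" unfolding II_def by (intro integral_cong)
  then show ?thesis by simp
qed

lemma II_dT:
  assumes g: "g \<in> sm" and bd: "\<And>x. x \<in> {a..b} \<Longrightarrow> g x c = 0 \<and> g x d = 0"
  shows "II (dT g) = 0"
proof -
  have "integral {c..d} (\<lambda>t. dT g x t) = 0" if x: "x \<in> {a..b}" for x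
  proof -
    have "((\<lambda>t. dT g x t) has_integral (g x d - g x c)) {c..d}"
    proof (rule fundamental_theorem_of_calculus[OF cd_le])
      fix t assume "t \<in> {c..d}"
      then show "((\<lambda>t. g x t) has_vector_derivative dT g x t) (at t within {c..d})"
        unfolding has_real_derivative_iff_has_vector_derivative[symmetric]
        by (intro has_field_derivative_at_within[OF sm_dt[OF g]] QD' x)
    qed
    then show ?thesis using bd[OF x] by (simp add: integral_unique)
  qed
  then have "integral {a..b} (\<lambda>x. integral {c..d} (\<lambda>t. dT g x t)) = integral {a..b} (\<lambda>x. 0)" by (intro integral_cong)
  then show ?thesis using II_swap[OF dT_sm[OF g]] by simp
qed

definition mt :: "((real \<Rightarrow> real) \<Rightarrow> real) \<Rightarrow> (real \<Rightarrow> real \<Rightarrow> real) \<Rightarrow> real" where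
  "mt \<alpha> g = n2 c d (\<lambda>t. \<alpha> (\<lambda>x. g x t))"

lemma mt_nonneg: "0 \<le> mt \<alpha> g"
  by (simp add: mt_def n2_nonneg)

lemma mt_le_mx: "xnorm a b \<alpha> \<Longrightarrow> g \<in> sm \<Longrightarrow> mt \<alpha> (dT g) \<le> mx \<alpha> g"
  using nS_nonneg[OF cd_le cont_xnorm] unfolding mt_def mx_def by fastforce

lemma mt_sq: "g \<in> sm \<Longrightarrow> (mt (n2 a b) g)\<^sup>2 = II (g * g)"
  unfolding mt_def II_def n2_sq[OF cont_xnorm[OF xn(2)]]
proof (intro integral_cong)
  fix t assume g: "g \<in> sm" and t: "t \<in> {c..d}"
  show "(n2 a b (\<lambda>x. g x t))\<^sup>2 = integral {a..b} (\<lambda>x. (g * g) x t)"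
    unfolding n2_sq[OF cont_x[OF g t]] by (simp add: power2_eq_square)
qed

lemma II_le:
  assumes g: "g \<in> sm" and M: "continuous_on {c..d} M" and le: "\<And>t. t \<in> {c..d} \<Longrightarrow> \<bar>integral {a..b} (\<lambda>x. g x t)\<bar> \<le> M t"
  shows "\<bar>II g\<bar> \<le> integral {c..d} M"
  unfolding II_def real_norm_def[symmetric]
  by (rule integral_norm_bound_integral) (use le in \<open>auto intro!: cont_int contI g M\<close>)

lemma II_CS:
  assumes f: "f \<in> sm" and g: "g \<in> sm"
  shows "\<bar>II (f * g)\<bar> \<le> mt (n2 a b) f * mt (n2 a b) g"
proof -
  note cn = cont_xnorm[OF xn(2) f] cont_xnorm[OF xn(2) g]
  have "\<bar>II (f * g)\<bar> \<le> integral {c..d} (\<lambda>t. n2 a b (\<lambda>x. f x t) * n2 a b (\<lambda>x. g x t))"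
    by (rule II_le[OF sm_mult[OF f g] continuous_on_mult[OF cn]]) (simp add: cauchy_schwarz_int cont_x f g)
  also have "\<dots> \<le> mt (n2 a b) f * mt (n2 a b) g"
    using cauchy_schwarz_int[OF cn] by (simp add: mt_def)
  finally show ?thesis .
qed

text \<open>Pairs L1 in x with the supremum in x, both in L2 over t. Needed because the product Y H
  * Y u is controlled only in L1 in x.\<close>

lemma II_1S:
  assumes f: "f \<in> sm" and g: "g \<in> sm"
  shows "\<bar>II (f * g)\<bar> \<le> mt (n1 a b) f * mt (nS a b) g"
proof -
  note cn = cont_xnorm[OF xn(3) f] cont_xnorm[OF xn(1) g]
  have "\<bar>II (f * g)\<bar> \<le> integral {c..d} (\<lambda>t. n1 a b (\<lambda>x. f x t) * nS a b (\<lambda>x. g x t))"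
  proof (rule II_le[OF sm_mult[OF f g] continuous_on_mult[OF cn]])
    fix t assume t: "t \<in> {c..d}"
    have "\<bar>integral {a..b} (\<lambda>x. g x t * f x t)\<bar> \<le> integral {a..b} (\<lambda>x. \<bar>g x t * f x t\<bar>)"
      by (rule int_abs_le[OF continuous_on_mult[OF cont_x[OF g t] cont_x[OF f t]]])
    also have "\<dots> = n1 a b (\<lambda>x. g x t * f x t)" by (simp add: n1_def)
    also have "\<dots> \<le> nS a b (\<lambda>x. g x t) * n1 a b (\<lambda>x. f x t)"
      by (rule n1_mult'[OF ab_le cont_x[OF g t] cont_x[OF f t]])
    finally show "\<bar>integral {a..b} (\<lambda>x. (f * g) x t)\<bar> \<le> n1 a b (\<lambda>x. f x t) * nS a b (\<lambda>x. g x t)"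
      by (simp add: mult.commute)
  qed
  also have "\<dots> \<le> mt (n1 a b) f * mt (nS a b) g"
    using cauchy_schwarz_int[OF cn] by (simp add: mt_def)
  finally show ?thesis .
qed

text \<open>Integration from the left edge and Cauchy-Schwarz in x. The factor
  \<open>sqrt (b - a)\<close> is what makes the right side of the equation a small contribution on a
  thin rectangle.\<close>

lemma poincare_x:
  assumes v: "v \<in> sm" and bd: "\<And>t. t \<in> {c..d} \<Longrightarrow> v a t = 0"
  shows "mt (nS a b) v \<le> sqrt (b - a) * mt (n2 a b) (dX v)"
proof -
  have "nS a b (\<lambda>x. v x t) \<le> sqrt (b - a) * n2 a b (\<lambda>x. dX v x t)" if t: "t \<in> {c..d}" for t
  proof (rule nS_le[OF ab_le])
    fix x assume x: "x \<in> {a..b}"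
    note cd' = cont_x[OF dX_sm[OF v] t]
    have sub: "{a..x} \<subseteq> {a..b}" using x by auto
    have "((\<lambda>y. dX v y t) has_integral (v x t - v a t)) {a..x}"
    proof (rule fundamental_theorem_of_calculus)
      fix y assume "y \<in> {a..x}"
      then show "((\<lambda>x. v x t) has_vector_derivative dX v y t) (at y within {a..x})"
        unfolding has_real_derivative_iff_has_vector_derivative[symmetric]
        using x by (intro has_field_derivative_at_within[OF sm_dx[OF v]] QD' t) auto
    qed (use x in auto)
    then have "v x t = integral {a..x} (\<lambda>y. dX v y t)" using bd[OF t] by (simp add: integral_unique)
    then have "\<bar>v x t\<bar> \<le> integral {a..x} (\<lambda>y. \<bar>dX v y t\<bar>)"
      using int_abs_le[OF continuous_on_subset[OF cd' sub]] by simp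
    also have "\<dots> \<le> integral {a..b} (\<lambda>y. \<bar>dX v y t\<bar>)"
      by (intro integral_subset_le sub cont_int continuous_intros cd' continuous_on_subset[OF cd' sub]) auto
    also have "\<dots> = integral {a..b} (\<lambda>y. 1 * \<bar>dX v y t\<bar>)" by simp
    also have "\<dots> \<le> n2 a b (\<lambda>y. 1) * n2 a b (\<lambda>y. \<bar>dX v y t\<bar>)"
      using cauchy_schwarz_int[OF continuous_on_const continuous_on_rabs[OF cd'], of 1] by linarith
    also have "\<dots> = sqrt (b - a) * n2 a b (\<lambda>x. dX v x t)" using n2_const[OF ab_le, of 1] by (simp add: n2_def)
    finally show "\<bar>v x t\<bar> \<le> sqrt (b - a) * n2 a b (\<lambda>x. dX v x t)" .
  qed
  moreover have "0 \<le> nS a b (\<lambda>x. v x t)" if "t \<in> {c..d}" for t by (rule nS_nonneg[OF ab_le cont_x[OF v that]])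
  ultimately have "mt (nS a b) v \<le> n2 c d (\<lambda>t. sqrt (b - a) * n2 a b (\<lambda>x. dX v x t))"
    unfolding mt_def
    by (intro n2_mono cont_xnorm[OF xn(1) v] continuous_on_mult[OF continuous_on_const cont_xnorm[OF xn(2) dX_sm[OF v]]]) auto
  also have "\<dots> = sqrt (b - a) * mt (n2 a b) (dX v)" using ab by (simp add: n2_scale mt_def)
  finally show ?thesis .
qed

lemma ftc_t:
  assumes w: "w \<in> sm" and x: "x \<in> {a..b}" and t: "t \<in> {c..d}" and w0: "w x c = 0"
  shows "\<bar>w x t\<bar> \<le> integral {c..d} (\<lambda>s. \<bar>dT w x s\<bar>)"
proof -
  note cd' = cont_t[OF dT_sm[OF w] x]
  have sub: "{c..t} \<subseteq> {c..d}" using t by auto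
  have "((\<lambda>s. dT w x s) has_integral (w x t - w x c)) {c..t}"
  proof (rule fundamental_theorem_of_calculus)
    fix s assume "s \<in> {c..t}"
    then show "((\<lambda>t. w x t) has_vector_derivative dT w x s) (at s within {c..t})"
      unfolding has_real_derivative_iff_has_vector_derivative[symmetric]
      using t by (intro has_field_derivative_at_within[OF sm_dt[OF w]] QD' x) auto
  qed (use t in auto)
  then have "w x t = integral {c..t} (\<lambda>s. dT w x s)" using w0 by (simp add: integral_unique)
  then have "\<bar>w x t\<bar> \<le> integral {c..t} (\<lambda>s. \<bar>dT w x s\<bar>)"
    using int_abs_le[OF continuous_on_subset[OF cd' sub]] by simp
  also have "\<dots> \<le> integral {c..d} (\<lambda>s. \<bar>dT w x s\<bar>)"
    by (intro integral_subset_le sub cont_int continuous_intros cd' continuous_on_subset[OF cd' sub]) auto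
  finally show ?thesis .
qed

text \<open>One-dimensional Sobolev inequality in t: as \<open>w\<close> vanishes on the lower edge,
  its supremum over t is bounded by an integral of \<open>dT w\<close>.\<close>

lemma mS_le:
  assumes w: "w \<in> sm" and w0: "\<And>x. x \<in> {a..b} \<Longrightarrow> w x c = 0"
  shows "mS w \<le> (1 + sqrt (d - c)) * mt (nS a b) (dT w)"
proof -
  note cS = cont_xnorm[OF xn(1) dT_sm[OF w]]
  have "nS a b (\<lambda>x. w x t) \<le> sqrt (d - c) * mt (nS a b) (dT w)" if t: "t \<in> {c..d}" for t
  proof (rule nS_le[OF ab_le])
    fix x assume x: "x \<in> {a..b}"
    have "\<bar>w x t\<bar> \<le> integral {c..d} (\<lambda>s. \<bar>dT w x s\<bar>)" by (rule ftc_t[OF w x t w0[OF x]])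
    also have "\<dots> \<le> integral {c..d} (\<lambda>s. 1 * nS a b (\<lambda>x. dT w x s))"
      using nS_ge[OF cont_x[OF dT_sm[OF w]] x]
      by (intro integral_le cont_int continuous_on_rabs cont_t dT_sm w x continuous_on_mult[OF continuous_on_const cS]) auto
    also have "\<dots> \<le> n2 c d (\<lambda>s. 1) * mt (nS a b) (dT w)"
      using cauchy_schwarz_int[OF continuous_on_const cS, of 1] unfolding mt_def by linarith
    finally show "\<bar>w x t\<bar> \<le> sqrt (d - c) * mt (nS a b) (dT w)" using n2_const[OF cd_le, of 1] by simp
  qed
  moreover have "0 \<le> nS a b (\<lambda>x. w x t)" if "t \<in> {c..d}" for t by (rule nS_nonneg[OF ab_le cont_x[OF w that]])
  ultimately have "nS c d (\<lambda>t. nS a b (\<lambda>x. w x t)) \<le> sqrt (d - c) * mt (nS a b) (dT w)"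
    by (intro nS_le cd_le) auto
  then show ?thesis unfolding mx_def mt_def by (simp add: algebra_simps)
qed

text \<open>The same inequality with L2 in x. Here Cauchy-Schwarz in t is applied for each x and the
  square is integrated over x afterwards, so the order of integration has to be exchanged.\<close>

lemma m2_le:
  assumes w: "w \<in> sm" and w0: "\<And>x. x \<in> {a..b} \<Longrightarrow> w x c = 0"
  shows "m2 w \<le> (1 + sqrt (d - c)) * mt (n2 a b) (dT w)"
proof -
  have "n2 a b (\<lambda>x. w x t) \<le> sqrt (d - c) * mt (n2 a b) (dT w)" if t: "t \<in> {c..d}" for t
  proof (rule power2_le_imp_le)
    have "(w x t)\<^sup>2 \<le> (d - c) * integral {c..d} (\<lambda>s. (dT w * dT w) x s)" if x: "x \<in> {a..b}" for x
    proof -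
      note cT = cont_t[OF dT_sm[OF w] x]
      have "\<bar>w x t\<bar> \<le> integral {c..d} (\<lambda>s. 1 * \<bar>dT w x s\<bar>)" using ftc_t[OF w x t w0[OF x]] by simp
      also have "\<dots> \<le> n2 c d (\<lambda>s. 1) * n2 c d (\<lambda>s. \<bar>dT w x s\<bar>)"
        using cauchy_schwarz_int[OF continuous_on_const continuous_on_rabs[OF cT], of 1] by linarith
      finally have "\<bar>w x t\<bar> \<le> sqrt (d - c) * n2 c d (\<lambda>s. dT w x s)"
        using n2_const[OF cd_le, of 1] by (simp add: n2_def)
      then have "\<bar>w x t\<bar>\<^sup>2 \<le> (sqrt (d - c) * n2 c d (\<lambda>s. dT w x s))\<^sup>2" by (intro power_mono) auto
      then have "(w x t)\<^sup>2 \<le> (d - c) * (n2 c d (\<lambda>s. dT w x s))\<^sup>2" using cd by (simp add: power_mult_distrib)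
      then show ?thesis unfolding n2_sq[OF cT] by (simp add: power2_eq_square)
    qed
    moreover have "continuous_on {a..b} (\<lambda>x. integral {c..d} (\<lambda>s. (dT w * dT w) x s))"
    proof -
      have "continuous_on ({a..b} \<times> cbox c d) (\<lambda>(x,s). (dT w * dT w) x s)"
        using contQ[OF sm_mult[OF dT_sm[OF w] dT_sm[OF w]]] by simp
      from integral_continuous_on_param[OF this] show ?thesis by simp
    qed
    ultimately have "integral {a..b} (\<lambda>x. (w x t)\<^sup>2) \<le> integral {a..b} (\<lambda>x. (d - c) * integral {c..d} (\<lambda>s. (dT w * dT w) x s))"
      by (intro integral_le cont_int continuous_on_mult[OF continuous_on_const] continuous_on_power cont_x[OF w t])
    also have "\<dots> = (d - c) * II (dT w * dT w)" using II_swap[of "dT w * dT w"] w by simp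
    also have "\<dots> = (sqrt (d - c) * mt (n2 a b) (dT w))\<^sup>2"
      using cd mt_sq[OF dT_sm[OF w]] by (simp add: power_mult_distrib)
    finally show "(n2 a b (\<lambda>x. w x t))\<^sup>2 \<le> (sqrt (d - c) * mt (n2 a b) (dT w))\<^sup>2"
      unfolding n2_sq[OF cont_x[OF w t]] .
  qed (use cd in \<open>simp add: mt_nonneg\<close>)
  then have "nS c d (\<lambda>t. n2 a b (\<lambda>x. w x t)) \<le> sqrt (d - c) * mt (n2 a b) (dT w)"
    by (intro nS_le cd_le) (auto simp: n2_nonneg)
  then show ?thesis unfolding mx_def mt_def by (simp add: algebra_simps)
qed

end

section \<open>The energy inequality and the commutator terms\<close>

context wbox begin

lemma dT_Y: "g \<in> sm \<Longrightarrow> dT (Y g) = Y (dT g)"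
  unfolding Y_def by (simp only: dT_mult m_sm dT_sm dT_m mult_zero_left add_0_left)

text \<open>T is applied to the equation, which is then tested with v = T w. Integration by parts in
  x uses v = 0 on the vertical edges, in t it uses v = 0 on the horizontal ones and T m = 0; this
  leaves |X v|^2 + k |Y v|^2 plus errors. Those contain T R1, T R2 and T C, which the L2 parts of
  \<open>m2\<close> and \<open>m1\<close> bound, so no derivative beyond the mixed norms appears.
  The pairing with T C goes through \<open>II_1S\<close> and \<open>poincare_x\<close>.\<close>

lemma energy:
  assumes sm: "w \<in> sm" "R1 \<in> sm" "R2 \<in> sm" "C \<in> sm" and k: "1 \<le> k"
    and eq: "dX (dX w + R1) + Y (constf k * Y w + R2) = C"
    and bx: "\<And>t. t \<in> {c..d} \<Longrightarrow> dT w a t = 0 \<and> dT w b t = 0"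
    and bt: "\<And>x. x \<in> {a..b} \<Longrightarrow> dT w x c = 0 \<and> dT w x d = 0"
  shows "mt (n2 a b) (dX (dT w)) + mt (n2 a b) (Y (dT w)) \<le> 2 * (m2 R1 + m2 R2 + sqrt (b - a) * m1 C)"
proof -
  define v where "v = dT w"
  have v: "v \<in> sm" unfolding v_def using sm by blast
  define A where "A = dX w + R1"
  define B where "B = constf k * Y w + R2"
  have AB: "A \<in> sm" "B \<in> sm" unfolding A_def B_def by (intro sm_add sm_mult sm_basic dX_sm Y_sm sm)+
  define D1 where "D1 = mt (n2 a b) (dX v)"
  define D2 where "D2 = mt (n2 a b) (Y v)"
  have nn: "0 \<le> D1" "0 \<le> D2" by (simp_all add: D1_def D2_def mt_nonneg)
  have dTA: "dT A = dX v + dT R1" unfolding A_def v_def using sm by (simp only: dT_add dX_sm dX_dT)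
  have dTB: "dT B = constf k * Y v + dT R2" unfolding B_def v_def using sm
    by (simp only: dT_add dT_mult sm_mult sm_basic Y_sm dT_Y dT_constf mult_zero_left add_0_left)
  have "dT (dX A + Y B) = dT C" unfolding A_def B_def eq ..
  then have eqT: "dX (dT A) + Y (dT B) = dT C" using AB by (simp only: dT_add dX_sm Y_sm dT_Y dX_dT)
  have p1: "II (dX (dT A) * v) + II (dT A * dX v) = 0"
  proof -
    have "II (dX (dT A * v)) = 0" by (rule II_dX) (use AB v bx in \<open>auto simp: v_def\<close>)
    then show ?thesis using II_add[of "dX (dT A) * v" "dT A * dX v"] AB v by simp
  qed
  have p2: "II (Y (dT B) * v) + II (dT B * Y v) = 0"
  proof -
    have "II (dT (m * dT B * v)) = 0" by (rule II_dT) (use AB v bt in \<open>auto simp: v_def\<close>)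
    moreover have "dT (m * dT B * v) = Y (dT B) * v + dT B * Y v"
    proof -
      have "dT (m * dT B * v) = (m * dT (dT B)) * v + m * dT B * dT v"
        using AB v by (simp only: dT_mult sm_mult m_sm dT_sm dT_m mult_zero_left add_0_left)
      then show ?thesis unfolding Y_def by (simp only: mult_ac)
    qed
    ultimately show ?thesis using II_add[of "Y (dT B) * v" "dT B * Y v"] AB v by simp
  qed
  have "II (dT C * v) = II (dX (dT A) * v) + II (Y (dT B) * v)"
    unfolding eqT[symmetric] distrib_right using AB v by (intro II_add sm_mult dX_sm dT_sm Y_sm)
  then have main: "II (dT A * dX v) + II (dT B * Y v) = - II (dT C * v)" using p1 p2 by linarith
  have e1: "II (dT A * dX v) = D1\<^sup>2 + II (dT R1 * dX v)"
    unfolding dTA distrib_right D1_def mt_sq[OF dX_sm[OF v]] using sm v by (intro II_add sm_mult dX_sm dT_sm)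
  have e2: "II (dT B * Y v) = k * D2\<^sup>2 + II (dT R2 * Y v)"
  proof -
    have "II (dT B * Y v) = II (constf k * (Y v * Y v)) + II (dT R2 * Y v)"
      unfolding dTB distrib_right mult.assoc using sm v by (intro II_add sm_mult sm_basic Y_sm dT_sm)
    moreover have "II (constf k * (Y v * Y v)) = k * II (Y v * Y v)"
      by (simp add: II_def)
    ultimately show ?thesis unfolding D2_def mt_sq[OF Y_sm[OF v]] by simp
  qed
  have b1: "\<bar>II (dT R1 * dX v)\<bar> \<le> m2 R1 * D1"
    using II_CS[OF dT_sm[OF sm(2)] dX_sm[OF v]] mt_le_mx[OF xn(2) sm(2)] nn(1) unfolding D1_def
    by (meson mult_right_mono order_trans)
  have b2: "\<bar>II (dT R2 * Y v)\<bar> \<le> m2 R2 * D2"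
    using II_CS[OF dT_sm[OF sm(3)] Y_sm[OF v]] mt_le_mx[OF xn(2) sm(3)] nn(2) unfolding D2_def
    by (meson mult_right_mono order_trans)
  have b3: "\<bar>II (dT C * v)\<bar> \<le> m1 C * (sqrt (b - a) * D1)"
  proof -
    have "\<bar>II (dT C * v)\<bar> \<le> mt (n1 a b) (dT C) * mt (nS a b) v" by (rule II_1S[OF dT_sm[OF sm(4)] v])
    also have "\<dots> \<le> m1 C * (sqrt (b - a) * D1)"
      using poincare_x[OF v] bx mt_le_mx[OF xn(3) sm(4)] mx_nonneg[OF xn(3) sm(4)]
      unfolding D1_def v_def by (intro mult_mono mt_nonneg) auto
    finally show ?thesis .
  qed
  define K where "K = m2 R1 + m2 R2 + sqrt (b - a) * m1 C"
  have pos: "0 \<le> m2 R1" "0 \<le> m2 R2" "0 \<le> sqrt (b - a) * m1 C"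
    using ab by (auto intro!: mult_nonneg_nonneg mx_nonneg xn sm)
  have "D1\<^sup>2 + D2\<^sup>2 \<le> D1\<^sup>2 + k * D2\<^sup>2" using mult_right_mono[OF k, of "D2\<^sup>2"] by simp
  also have "\<dots> \<le> m2 R1 * D1 + m2 R2 * D2 + m1 C * (sqrt (b - a) * D1)"
    using main e1 e2 b1 b2 b3 by linarith
  also have "\<dots> \<le> K * (D1 + D2)"
    using mult_nonneg_nonneg[OF pos(1) nn(2)] mult_nonneg_nonneg[OF pos(2) nn(1)] mult_nonneg_nonneg[OF pos(3) nn(2)]
    by (simp add: K_def algebra_simps)
  finally have "2 * (D1\<^sup>2 + D2\<^sup>2) \<le> 2 * K * (D1 + D2)" by simp
  \<comment> \<open>Together with the previous line this yields a bound for the sum D1 + D2 itself;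
    the factor 2 in the conclusion arises here.\<close>
  moreover have "(D1 + D2)\<^sup>2 \<le> 2 * (D1\<^sup>2 + D2\<^sup>2)" using zero_le_power2[of "D1 - D2"]
    by (simp add: power2_eq_square algebra_simps)
  ultimately have "(D1 + D2) * (D1 + D2) \<le> 2 * K * (D1 + D2)" by (simp add: power2_eq_square)
  then have "D1 + D2 \<le> 2 * K" using nn pos
    by (cases "D1 + D2 = 0") (auto simp: K_def)
  then show ?thesis by (simp add: D1_def D2_def K_def v_def)
qed

end

text \<open>\<open>dX_rho\<close> is the algebraic condition on the cutoff. The first derivatives of
  \<rho> must vanish on edges as well because of the lowest index: T (W 1 u) contains (T \<rho>) (T
  u), and X (W 1 u) contains (X \<rho>) (T u), where no power of \<rho> is left to vanish.\<close>

locale pde_box = wbox +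
  fixes \<beta> u H F G :: "real \<Rightarrow> real \<Rightarrow> real"
  assumes beta_sm: "\<beta> \<in> sm" and u_sm: "u \<in> sm" and H_sm: "H \<in> sm" and F_sm: "F \<in> sm"
    and dX_rho: "dX \<rho> = m * \<beta>"
    and rho_x: "\<And>t. t \<in> {c..d} \<Longrightarrow> \<rho> a t = 0 \<and> \<rho> b t = 0 \<and> dT \<rho> a t = 0 \<and> dT \<rho> b t = 0"
    and rho_t: "\<And>x. x \<in> {a..b} \<Longrightarrow> \<rho> x c = 0 \<and> \<rho> x d = 0 \<and> dT \<rho> x c = 0 \<and> dT \<rho> x d = 0 \<and> dX \<rho> x c = 0"
    and G_def: "G = H * Y H * Y u - F"
    and pde: "dX (dX u) + Y ((1 + H * H) * Y u) = G"
begin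

text \<open>W (q - 1) without the junk value of truncated subtraction at q = 0.\<close>

definition V :: "nat \<Rightarrow> (real \<Rightarrow> real \<Rightarrow> real) \<Rightarrow> real \<Rightarrow> real \<Rightarrow> real" where
  "V q g = (case q of 0 \<Rightarrow> 0 | Suc r \<Rightarrow> W r g)"

lemma G_sm: "G \<in> sm"
  unfolding G_def by (intro sm_minus sm_mult Y_sm H_sm u_sm F_sm)

lemma constf_fact: "constf (1 / fact (Suc r)) * constf (real (Suc r)) = constf (1 / fact r)"
proof -
  have "1 / fact (Suc r) * real (Suc r) = 1 / fact r" by (simp add: fact_Suc del: of_nat_Suc)
  then show ?thesis by (simp only: constf_mult[symmetric])
qed

text \<open>X commutes with T, so the commutator arises only from \<rho>^q. Its factor X \<rho> = m
  \<beta> combines with one T to a Y, and q / q! = 1 / (q-1)! restores the normalisation at the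
  lower index.\<close>

lemma dX_W: assumes g: "g \<in> sm" shows "dX (W q g) = W q (dX g) + \<beta> * V q (Y g)"
proof (cases q)
  case (Suc r)
  have "dX (W q g) = constf (1 / fact (Suc r)) * (constf (real (Suc r)) * \<rho> ^ r * (m * \<beta>)) * (dT ^^ Suc r) g + W q (dX g)"
    unfolding W_def Suc using g
    by (simp only: dX_mult sm_mult sm_basic sm_power rho_sm dTn_sm dX_constf dX_power dX_dTn diff_Suc_1 dX_rho mult_zero_left add_0_left)
  also have "constf (1 / fact (Suc r)) * (constf (real (Suc r)) * \<rho> ^ r * (m * \<beta>)) * (dT ^^ Suc r) g
      = \<beta> * (m * ((constf (1 / fact (Suc r)) * constf (real (Suc r))) * \<rho> ^ r * (dT ^^ r) (dT g)))"
    unfolding funpow_Suc_right o_apply by (simp only: mult_ac)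
  also have "\<dots> = \<beta> * V q (Y g)"
  proof -
    have "V q (Y g) = m * W r (dT g)"
      by (simp only: V_def Suc nat.case Y_def W_const_mult[OF m_sm dT_m dT_sm[OF g]])
    then show ?thesis by (simp only: constf_fact W_def)
  qed
  finally show ?thesis by (simp only: add.commute)
qed (simp add: V_def)

lemma dT_W: assumes g: "g \<in> sm" shows "dT (W q g) = W q (dT g) + dT \<rho> * V q (dT g)"
proof (cases q)
  case (Suc r)
  have "dT (W q g) = constf (1 / fact (Suc r)) * (constf (real (Suc r)) * \<rho> ^ r * dT \<rho>) * (dT ^^ Suc r) g
      + constf (1 / fact (Suc r)) * \<rho> ^ Suc r * dT ((dT ^^ Suc r) g)"
    unfolding W_def Suc using g
    by (simp only: dT_mult sm_mult sm_basic sm_power rho_sm dTn_sm dT_constf dT_power diff_Suc_1 mult_zero_left add_0_left)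
  also have "dT ((dT ^^ Suc r) g) = (dT ^^ Suc r) (dT g)" by (simp only: funpow_swap1)
  also have "constf (1 / fact (Suc r)) * (constf (real (Suc r)) * \<rho> ^ r * dT \<rho>) * (dT ^^ Suc r) g
      = dT \<rho> * ((constf (1 / fact (Suc r)) * constf (real (Suc r))) * \<rho> ^ r * (dT ^^ r) (dT g))"
    unfolding funpow_Suc_right o_apply by (simp only: mult_ac)
  also have "\<dots> = dT \<rho> * V q (dT g)" unfolding constf_fact V_def Suc nat.case W_def ..
  also have "constf (1 / fact (Suc r)) * \<rho> ^ Suc r * (dT ^^ Suc r) (dT g) = W q (dT g)" unfolding Suc W_def ..
  finally show ?thesis by (simp only: add.commute)
qed (simp add: V_def)

lemma V_m: "g \<in> sm \<Longrightarrow> V q (m * g) = m * V q g"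
  by (cases q) (simp_all only: V_def nat.case W_const_mult[OF m_sm dT_m] mult_zero_right)

lemma Y_W: assumes g: "g \<in> sm" shows "Y (W q g) = W q (Y g) + dT \<rho> * V q (Y g)"
proof -
  have "Y (W q g) = m * W q (dT g) + dT \<rho> * (m * V q (dT g))"
    unfolding Y_def dT_W[OF g] by (simp only: distrib_left mult_ac)
  then show ?thesis unfolding Y_def using g by (simp only: W_const_mult[OF m_sm dT_m] V_m dT_sm)
qed

lemma dX_dT_rho: "dX (dT \<rho>) = Y \<beta>"
  unfolding dX_dT[OF rho_sm] dX_rho Y_def using beta_sm by (simp only: dT_mult m_sm dT_m mult_zero_left add_0_left)

text \<open>Moving W past X and Y naively would leave terms such as \<beta> W q (Y g1), which are of
  second order in \<open>u\<close> when g1 = X u. Putting the corrections inside the divergence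
  removes them: the terms with \<beta> W q (Y g1), with (T \<rho>) \<beta> V q (Y g1) and with (Y
  \<beta>) W q g1 cancel exactly, the last by X (T \<rho>) = Y \<beta>.\<close>

lemma identity:
  assumes g: "g1 \<in> sm" "g2 \<in> sm"
  shows "dX (W (Suc q) g1 + dT \<rho> * W q g1) + Y (W (Suc q) g2 - \<beta> * W q g1)
       = W (Suc q) (dX g1 + Y g2) + dT \<rho> * W q (dX g1 + Y g2)"
proof -
  have "dX (W (Suc q) g1 + dT \<rho> * W q g1)
     = W (Suc q) (dX g1) + \<beta> * W q (Y g1) + (Y \<beta> * W q g1 + dT \<rho> * (W q (dX g1) + \<beta> * V q (Y g1)))"
    using g by (simp only: dX_add dX_mult dX_W W_sm dT_sm rho_sm sm_mult dX_dT_rho) (simp only: V_def nat.case)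
  moreover have "Y (W (Suc q) g2 - \<beta> * W q g1)
     = (W (Suc q) (Y g2) + dT \<rho> * W q (Y g2)) - (Y \<beta> * W q g1 + \<beta> * (W q (Y g1) + dT \<rho> * V q (Y g1)))"
  proof -
    have "Y (W (Suc q) g2 - \<beta> * W q g1) = Y (W (Suc q) g2) - Y (\<beta> * W q g1)"
      unfolding Y_def using g beta_sm by (simp only: dT_minus W_sm sm_mult right_diff_distrib)
    also have "Y (\<beta> * W q g1) = Y \<beta> * W q g1 + \<beta> * Y (W q g1)"
      using Y_mult[OF beta_sm W_sm[OF g(1)]] by (simp only: mult.commute)
    finally show ?thesis using g by (simp only: Y_W) (simp only: V_def nat.case)
  qed
  ultimately show ?thesis using g
    by (simp only: W_add dX_sm Y_sm) (simp add: algebra_simps)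
qed

lemma MX_split: "MX s \<alpha> N g = mx \<alpha> g + (\<Sum>q<N. s ^ Suc q * mx \<alpha> (W (Suc q) g))"
  unfolding MX_def sum.atMost_shift by simp

text \<open>This is where commutators become small: index \<open>q\<close> is summed against the
  power \<open>Suc q\<close>, which gains a factor \<open>s\<close>.\<close>

lemma MX_shift:
  assumes "xnorm a b \<alpha>" "g \<in> sm" "0 \<le> s"
  shows "(\<Sum>q<N. s ^ Suc q * mx \<alpha> (W q g)) \<le> s * MX s \<alpha> N g"
proof -
  have "(\<Sum>q<N. s ^ Suc q * mx \<alpha> (W q g)) = s * (\<Sum>q<N. s ^ q * mx \<alpha> (W q g))"
    by (simp add: sum_distrib_left mult.assoc)
  also have "\<dots> \<le> s * MX s \<alpha> N g"
    unfolding MX_def using assms by (intro mult_left_mono sum_mono2) (auto intro!: mult_nonneg_nonneg mx_nonneg[OF assms(1)])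
  finally show ?thesis .
qed

lemma m2_diff:
  assumes g: "g \<in> sm" and h: "h \<in> sm"
  shows "m2 (g - h) \<le> m2 g + m2 h"
proof -
  have e: "g - h = g + constf (-1) * h" by (simp add: fun_eq_iff)
  have "m2 (constf (-1) * h) \<le> mS (constf (-1)) * m2 h"
    by (intro m2_mult sm_basic h)
  moreover have "mS (constf (-1)) \<le> 1" using mx_constf[of "-1"] by simp
  ultimately have "m2 (constf (-1) * h) \<le> m2 h"
    using mult_right_mono[OF _ mx_nonneg[OF xn(2) h]] by fastforce
  moreover have "m2 (g + constf (-1) * h) \<le> m2 g + m2 (constf (-1) * h)"
    by (intro mx_add[OF xn(2) g] sm_mult sm_basic h)
  ultimately show ?thesis unfolding e by linarith
qed

text \<open>The energies start at index 1, since W 0 u = u satisfies no boundary conditions; the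
  index 0 part of each norm is made small directly by the choice of the square.\<close>

definition ee :: "nat \<Rightarrow> real" where
  "ee q = mt (n2 a b) (dX (dT (W (Suc q) u))) + mt (n2 a b) (Y (dT (W (Suc q) u)))"

definition yy :: "real \<Rightarrow> nat \<Rightarrow> real" where
  "yy s N = (\<Sum>q<N. s ^ Suc q * ee q)"

lemma ee_nonneg: "0 \<le> ee q"
  by (simp add: ee_def mt_nonneg)

lemma W_bdry:
  shows W_bx: "t \<in> {c..d} \<Longrightarrow> dT (W (Suc q) u) a t = 0 \<and> dT (W (Suc q) u) b t = 0"
    and W_bt: "x \<in> {a..b} \<Longrightarrow> dT (W (Suc q) u) x c = 0 \<and> dT (W (Suc q) u) x d = 0"
    and W_b0: "x \<in> {a..b} \<Longrightarrow> W (Suc q) u x c = 0 \<and> dX (W (Suc q) u) x c = 0"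
proof -
  have W0: "W (Suc q) g x t = 0" if "\<rho> x t = 0" for g x t using that by (simp add: W_def)
  show "t \<in> {c..d} \<Longrightarrow> dT (W (Suc q) u) a t = 0 \<and> dT (W (Suc q) u) b t = 0"
    unfolding dT_W[OF u_sm] using rho_x by (simp add: W0)
  show "x \<in> {a..b} \<Longrightarrow> dT (W (Suc q) u) x c = 0 \<and> dT (W (Suc q) u) x d = 0"
    unfolding dT_W[OF u_sm] using rho_t by (simp add: W0)
  assume x: "x \<in> {a..b}"
  have "\<beta> x c * V (Suc q) (Y u) x c = 0"
  proof -
    \<comment> \<open>Only the product of \<open>m\<close> and \<open>\<beta>\<close>, that is X
      \<rho>, is known to vanish on the lower edge; the missing factor \<open>m\<close> is found in
      Y u.\<close>
    have "m x c * \<beta> x c = 0" using rho_t[OF x] dX_rho by (metis times_fun_apply)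
    moreover have "V (Suc q) (Y u) = m * W q (dT u)" by (simp add: V_def Y_def W_const_mult u_sm)
    ultimately show ?thesis by auto
  qed
  then show "W (Suc q) u x c = 0 \<and> dX (W (Suc q) u) x c = 0"
    unfolding dX_W[OF u_sm] using rho_t[OF x] by (simp add: W0)
qed

text \<open>The coefficient 1 + H^2 is split into the constant \<open>k\<close>, to which
  \<open>energy\<close> applies, and the remainder H^2 - c0^2, whose contribution is the only
  top-index term among the errors in \<open>R1\<close> and \<open>R2\<close>. All others carry the
  index \<open>q\<close> instead of \<open>Suc q\<close>.\<close>

lemma ee_bound:
  assumes k: "k = 1 + c0\<^sup>2" and \<kappa>: "mS (dT \<rho>) \<le> \<kappa>" "mS \<beta> \<le> \<kappa>"
  shows "ee q \<le> 2 * (2 * \<kappa> * m2 (W q (dX u)) + (1 + k) * \<kappa> * m2 (W q (Y u)) + m2 (W (Suc q) ((H * H - constf (c0\<^sup>2)) * Y u))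
     + sqrt (b - a) * (m1 (W (Suc q) G) + \<kappa> * m1 (W q G)))"
proof -
  define w where "w = W (Suc q) u"
  define E where "E = H * H - constf (c0\<^sup>2)"
  \<comment> \<open>\<open>R1\<close> and \<open>R2\<close> collect the corrections of
    \<open>identity\<close> and the commutators of \<open>W (Suc q)\<close> with X and Y, so that
    \<open>w\<close> itself appears inside the divergence.\<close>
  define R1 where "R1 = dT \<rho> * W q (dX u) - \<beta> * W q (Y u)"
  define R2 where "R2 = W (Suc q) (E * Y u) - constf k * (dT \<rho> * W q (Y u)) - \<beta> * W q (dX u)"
  define C where "C = W (Suc q) G + dT \<rho> * W q G"
  have Esm: "E \<in> sm" unfolding E_def by (intro sm_minus sm_mult sm_basic H_sm)
  have sms: "w \<in> sm" "R1 \<in> sm" "R2 \<in> sm" "C \<in> sm" unfolding w_def R1_def R2_def C_def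
    by (intro sm_minus sm_add sm_mult sm_basic W_sm dX_sm dT_sm Y_sm u_sm rho_sm beta_sm Esm G_sm)+
  have g2: "(1 + H * H) * Y u = constf k * Y u + E * Y u"
    unfolding E_def k constf_add constf_1 by (simp only: algebra_simps add_diff_cancel)
  have sm2: "(1 + H * H) * Y u \<in> sm" by (intro sm_mult sm_add sm_1 H_sm Y_sm u_sm)
  have a1: "dX w + R1 = W (Suc q) (dX u) + dT \<rho> * W q (dX u)"
    unfolding w_def R1_def dX_W[OF u_sm] V_def nat.case by (simp add: algebra_simps)
  have a2: "constf k * Y w + R2 = W (Suc q) ((1 + H * H) * Y u) - \<beta> * W q (dX u)"
  proof -
    have "W (Suc q) ((1 + H * H) * Y u) = constf k * W (Suc q) (Y u) + W (Suc q) (E * Y u)"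
      unfolding g2 using Esm u_sm by (simp only: W_add W_const_mult sm_mult sm_basic Y_sm dT_constf)
    moreover have "constf k * Y w = constf k * W (Suc q) (Y u) + constf k * (dT \<rho> * W q (Y u))"
      unfolding w_def Y_W[OF u_sm] V_def nat.case by (simp only: distrib_left)
    ultimately show ?thesis unfolding R2_def by (simp add: algebra_simps)
  qed
  have eq: "dX (dX w + R1) + Y (constf k * Y w + R2) = C"
    unfolding a1 a2 identity[OF dX_sm[OF u_sm] sm2] pde C_def ..
  have "ee q \<le> 2 * (m2 R1 + m2 R2 + sqrt (b - a) * m1 C)"
    unfolding ee_def w_def[symmetric]
    by (rule energy[OF sms _ eq]) (use W_bx W_bt k in \<open>auto simp: w_def\<close>)
  moreover have "m2 R1 \<le> \<kappa> * m2 (W q (dX u)) + \<kappa> * m2 (W q (Y u))"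
  proof -
    have "m2 R1 \<le> m2 (dT \<rho> * W q (dX u)) + m2 (\<beta> * W q (Y u))"
      unfolding R1_def by (intro m2_diff sm_mult dT_sm rho_sm W_sm dX_sm Y_sm u_sm beta_sm)
    moreover have "m2 (dT \<rho> * W q (dX u)) \<le> mS (dT \<rho>) * m2 (W q (dX u))" "m2 (\<beta> * W q (Y u)) \<le> mS \<beta> * m2 (W q (Y u))"
      by (intro m2_mult dT_sm rho_sm W_sm dX_sm Y_sm u_sm beta_sm)+
    ultimately show ?thesis
      using mult_right_mono[OF \<kappa>(1), of "m2 (W q (dX u))"] mult_right_mono[OF \<kappa>(2), of "m2 (W q (Y u))"]
        mx_nonneg[OF xn(2) W_sm[OF dX_sm[OF u_sm]], of q] mx_nonneg[OF xn(2) W_sm[OF Y_sm[OF u_sm]], of q] by linarith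
  qed
  moreover have "m2 R2 \<le> m2 (W (Suc q) (E * Y u)) + k * \<kappa> * m2 (W q (Y u)) + \<kappa> * m2 (W q (dX u))"
  proof -
    have "m2 R2 \<le> m2 (W (Suc q) (E * Y u) - constf k * (dT \<rho> * W q (Y u))) + m2 (\<beta> * W q (dX u))"
      unfolding R2_def by (intro m2_diff sm_minus sm_mult sm_basic dT_sm rho_sm W_sm dX_sm Y_sm u_sm beta_sm Esm)
    moreover have "m2 (W (Suc q) (E * Y u) - constf k * (dT \<rho> * W q (Y u))) \<le> m2 (W (Suc q) (E * Y u)) + m2 (constf k * (dT \<rho> * W q (Y u)))"
      by (intro m2_diff sm_mult sm_basic dT_sm rho_sm W_sm dX_sm Y_sm u_sm beta_sm Esm)
    moreover have "m2 (\<beta> * W q (dX u)) \<le> mS \<beta> * m2 (W q (dX u))"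
      by (intro m2_mult W_sm dX_sm u_sm beta_sm)
    moreover have "mS \<beta> * m2 (W q (dX u)) \<le> \<kappa> * m2 (W q (dX u))"
      by (intro mult_right_mono \<kappa> mx_nonneg xn W_sm dX_sm u_sm)
    moreover have "m2 (constf k * (dT \<rho> * W q (Y u))) \<le> k * (\<kappa> * m2 (W q (Y u)))"
    proof -
      have "m2 (constf k * (dT \<rho> * W q (Y u))) \<le> mS (constf k) * m2 (dT \<rho> * W q (Y u))"
        by (intro m2_mult sm_basic sm_mult dT_sm rho_sm W_sm Y_sm u_sm)
      also have "\<dots> \<le> k * (\<kappa> * m2 (W q (Y u)))"
      proof (rule mult_mono)
        show "mS (constf k) \<le> k" using mx_constf[of k] k by simp
        have "m2 (dT \<rho> * W q (Y u)) \<le> mS (dT \<rho>) * m2 (W q (Y u))" by (intro m2_mult dT_sm rho_sm W_sm Y_sm u_sm)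
        also have "\<dots> \<le> \<kappa> * m2 (W q (Y u))" by (intro mult_right_mono \<kappa> mx_nonneg xn W_sm Y_sm u_sm)
        finally show "m2 (dT \<rho> * W q (Y u)) \<le> \<kappa> * m2 (W q (Y u))" .
      qed (use k in \<open>auto intro!: mx_nonneg xn sm_mult dT_sm rho_sm W_sm Y_sm u_sm\<close>)
      finally show ?thesis .
    qed
    ultimately show ?thesis by (simp add: mult.assoc)
  qed
  moreover have "sqrt (b - a) * m1 C \<le> sqrt (b - a) * (m1 (W (Suc q) G) + \<kappa> * m1 (W q G))"
  proof (rule mult_left_mono)
    have "m1 C \<le> m1 (W (Suc q) G) + m1 (dT \<rho> * W q G)"
      unfolding C_def by (intro mx_add xn sm_mult dT_sm rho_sm W_sm G_sm)
    moreover have "m1 (dT \<rho> * W q G) \<le> mS (dT \<rho>) * m1 (W q G)" by (intro m1_mult dT_sm rho_sm W_sm G_sm)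
    moreover have "\<dots> \<le> \<kappa> * m1 (W q G)" by (intro mult_right_mono \<kappa> mx_nonneg xn W_sm G_sm)
    ultimately show "m1 C \<le> m1 (W (Suc q) G) + \<kappa> * m1 (W q G)" by linarith
  qed (use ab in simp)
  ultimately show ?thesis unfolding E_def by (simp add: algebra_simps)
qed

lemma yy_bound:
  assumes k: "k = 1 + c0\<^sup>2" and \<kappa>: "mS (dT \<rho>) \<le> \<kappa>" "mS \<beta> \<le> \<kappa>" and s: "0 \<le> s"
  shows "yy s N \<le> 2 * (2 * (s * \<kappa>) * K2 s N (dX u) + (1 + k) * (s * \<kappa>) * K2 s N (Y u)
     + KS s N (H * H - constf (c0\<^sup>2)) * K2 s N (Y u) + sqrt (b - a) * (1 + s * \<kappa>) * K1 s N G)"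
proof -
  define E where "E = H * H - constf (c0\<^sup>2)"
  have Esm: "E \<in> sm" unfolding E_def by (intro sm_minus sm_mult sm_basic H_sm)
  have k0: "0 \<le> \<kappa>" using \<kappa>(2) mx_nonneg[OF xn(1) beta_sm] by linarith
  have kk: "0 \<le> 1 + k" using k by simp
  have "yy s N \<le> (\<Sum>q<N. s ^ Suc q * (2 * (2 * \<kappa> * m2 (W q (dX u)) + (1 + k) * \<kappa> * m2 (W q (Y u)) + m2 (W (Suc q) (E * Y u))
     + sqrt (b - a) * (m1 (W (Suc q) G) + \<kappa> * m1 (W q G)))))"
    unfolding yy_def E_def using s by (intro sum_mono mult_left_mono ee_bound[OF k \<kappa>]) auto
  also have "\<dots> = 2 * (2 * \<kappa> * (\<Sum>q<N. s ^ Suc q * m2 (W q (dX u))) + (1 + k) * \<kappa> * (\<Sum>q<N. s ^ Suc q * m2 (W q (Y u)))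
     + (\<Sum>q<N. s ^ Suc q * m2 (W (Suc q) (E * Y u)))
     + sqrt (b - a) * ((\<Sum>q<N. s ^ Suc q * m1 (W (Suc q) G)) + \<kappa> * (\<Sum>q<N. s ^ Suc q * m1 (W q G))))"
    by (simp add: sum_distrib_left sum.distrib algebra_simps)
  also have "\<dots> \<le> 2 * (2 * \<kappa> * (s * K2 s N (dX u)) + (1 + k) * \<kappa> * (s * K2 s N (Y u))
     + KS s N E * K2 s N (Y u) + sqrt (b - a) * (K1 s N G + \<kappa> * (s * K1 s N G)))"
  proof -
    have 1: "2 * \<kappa> * (\<Sum>q<N. s ^ Suc q * m2 (W q (dX u))) \<le> 2 * \<kappa> * (s * K2 s N (dX u))"
      using k0 by (intro mult_left_mono MX_shift xn dX_sm u_sm s) simp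
    have 2: "(1 + k) * \<kappa> * (\<Sum>q<N. s ^ Suc q * m2 (W q (Y u))) \<le> (1 + k) * \<kappa> * (s * K2 s N (Y u))"
      by (intro mult_left_mono MX_shift xn Y_sm u_sm s mult_nonneg_nonneg k0 kk)
    have 3: "(\<Sum>q<N. s ^ Suc q * m2 (W (Suc q) (E * Y u))) \<le> KS s N E * K2 s N (Y u)"
      using MX_split[of s "n2 a b" N "E * Y u"] K2_mult[OF Esm Y_sm[OF u_sm] s, of N]
        mx_nonneg[OF xn(2) sm_mult[OF Esm Y_sm[OF u_sm]]] by linarith
    have 4: "(\<Sum>q<N. s ^ Suc q * m1 (W (Suc q) G)) \<le> K1 s N G"
      using MX_split[of s "n1 a b" N G] mx_nonneg[OF xn(3) G_sm] by linarith
    have 5: "\<kappa> * (\<Sum>q<N. s ^ Suc q * m1 (W q G)) \<le> \<kappa> * (s * K1 s N G)"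
      by (intro mult_left_mono MX_shift xn G_sm s k0)
    have 6: "sqrt (b - a) * ((\<Sum>q<N. s ^ Suc q * m1 (W (Suc q) G)) + \<kappa> * (\<Sum>q<N. s ^ Suc q * m1 (W q G)))
        \<le> sqrt (b - a) * (K1 s N G + \<kappa> * (s * K1 s N G))"
      using add_mono[OF 4 5] ab by (intro mult_left_mono) auto
    show ?thesis by (intro mult_left_mono add_mono 1 2 3 6) simp
  qed
  finally show ?thesis unfolding E_def by (simp add: algebra_simps)
qed

text \<open>Returns from energies to mixed norms by the Sobolev inequality in t, using zero values
  on the lower edge, and for the supremum norm also by \<open>poincare_x\<close>. The factor 2
  bounds \<open>1 + sqrt (d - c)\<close>.\<close>

lemma m2_W_le:
  assumes cd1: "d - c \<le> 1"
  shows "m2 (dX (W (Suc q) u)) \<le> 2 * ee q" "m2 (Y (W (Suc q) u)) \<le> 2 * ee q"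
    "mS (W (Suc q) u) \<le> 2 * sqrt (b - a) * ee q"
proof -
  have sq: "1 + sqrt (d - c) \<le> 2" "0 \<le> 1 + sqrt (d - c)" using cd1 cd by (auto simp: add_nonneg_nonneg)
  define w where "w = W (Suc q) u"
  have w: "w \<in> sm" unfolding w_def using u_sm by blast
  have D: "mt (n2 a b) (dX (dT w)) \<le> ee q" "mt (n2 a b) (Y (dT w)) \<le> ee q"
    unfolding ee_def w_def[symmetric] using mt_nonneg by simp_all
  have "m2 (dX w) \<le> (1 + sqrt (d - c)) * mt (n2 a b) (dT (dX w))"
    by (rule m2_le) (use w W_b0 in \<open>auto simp: w_def\<close>)
  also have "\<dots> \<le> 2 * ee q" using sq D(1) unfolding dX_dT[OF w, symmetric] by (intro mult_mono mt_nonneg) auto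
  finally show "m2 (dX (W (Suc q) u)) \<le> 2 * ee q" unfolding w_def .
  have "m2 (Y w) \<le> (1 + sqrt (d - c)) * mt (n2 a b) (dT (Y w))"
    by (rule m2_le) (use w W_bt in \<open>auto simp: w_def Y_def\<close>)
  also have "\<dots> \<le> 2 * ee q" using sq D(2) unfolding dT_Y[OF w] by (intro mult_mono mt_nonneg) auto
  finally show "m2 (Y (W (Suc q) u)) \<le> 2 * ee q" unfolding w_def .
  have "mS w \<le> (1 + sqrt (d - c)) * mt (nS a b) (dT w)"
    by (rule mS_le) (use w W_b0 in \<open>auto simp: w_def\<close>)
  also have "\<dots> \<le> 2 * (sqrt (b - a) * ee q)"
  proof (intro mult_mono mt_nonneg sq)
    have "mt (nS a b) (dT w) \<le> sqrt (b - a) * mt (n2 a b) (dX (dT w))"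
      by (rule poincare_x) (use w W_bx in \<open>auto simp: w_def\<close>)
    also have "\<dots> \<le> sqrt (b - a) * ee q" using D(1) ab by (intro mult_left_mono) auto
    finally show "mt (nS a b) (dT w) \<le> sqrt (b - a) * ee q" .
  qed simp
  finally show "mS (W (Suc q) u) \<le> 2 * sqrt (b - a) * ee q" unfolding w_def by simp
qed

lemma yy_sum:
  assumes "0 \<le> s" "\<And>q. X q \<le> K * ee q"
  shows "(\<Sum>q<N. s ^ Suc q * X q) \<le> K * yy s N"
proof -
  have "(\<Sum>q<N. s ^ Suc q * X q) \<le> (\<Sum>q<N. s ^ Suc q * (K * ee q))"
    using assms by (intro sum_mono mult_left_mono) auto
  then show ?thesis by (simp add: yy_def sum_distrib_left mult_ac)
qed

text \<open>Commuting W back past X or Y costs \<kappa> W q (Y u), which sums to at most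
  \<open>\<epsilon> * K2 s N (Y u)\<close> and is absorbed because
  \<open>\<epsilon> \<le> 1/2\<close>. The constants 3 and 6 come from the third bound, \<epsilon> +
  2 yy for \<open>KS\<close> plus 2 \<epsilon> + 4 yy for \<open>K2\<close>; the other two are
  weakened to match, so that one number bounds all three.\<close>

lemma K_bounds:
  assumes cd1: "d - c \<le> 1" and ba1: "b - a \<le> 1" and \<kappa>: "mS (dT \<rho>) \<le> \<kappa>" "mS \<beta> \<le> \<kappa>" and s: "0 \<le> s"
    and e: "s * \<kappa> \<le> \<epsilon>" "\<epsilon> \<le> 1/2" "m2 (dX u) \<le> \<epsilon>" "m2 (Y u) \<le> \<epsilon>" "mS (u - constf w0) \<le> \<epsilon>"
  shows "K2 s N (dX u) \<le> 3 * \<epsilon> + 6 * yy s N" "K2 s N (Y u) \<le> 3 * \<epsilon> + 6 * yy s N"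
    "nrm s N (u - constf w0) \<le> 3 * \<epsilon> + 6 * yy s N"
proof -
  note m2W = m2_W_le[OF cd1]
  have k0: "0 \<le> \<kappa>" using \<kappa>(2) mx_nonneg[OF xn(1) beta_sm] by linarith
  have nn: "0 \<le> K2 s N (Y u)" by (intro MX_nonneg xn Y_sm u_sm s)
  have y0: "0 \<le> yy s N" unfolding yy_def by (intro sum_nonneg mult_nonneg_nonneg zero_le_power s ee_nonneg)
  have e0: "0 \<le> \<epsilon>" using e(3) mx_nonneg[OF xn(2) dX_sm[OF u_sm]] by linarith
  have shift: "(\<Sum>q<N. s ^ Suc q * (\<kappa> * m2 (W q (Y u)))) \<le> \<epsilon> * K2 s N (Y u)"
  proof -
    have "(\<Sum>q<N. s ^ Suc q * (\<kappa> * m2 (W q (Y u)))) = \<kappa> * (\<Sum>q<N. s ^ Suc q * m2 (W q (Y u)))"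
      by (simp add: sum_distrib_left mult_ac)
    also have "\<dots> \<le> \<kappa> * (s * K2 s N (Y u))" by (intro mult_left_mono MX_shift xn Y_sm u_sm s k0)
    also have "\<dots> \<le> \<epsilon> * K2 s N (Y u)" using mult_right_mono[OF e(1) nn] by (simp add: mult_ac)
    finally show ?thesis .
  qed
  have gen: "K2 s N g \<le> m2 g + (2 * yy s N + \<epsilon> * K2 s N (Y u))"
    if g: "g \<in> sm" and le: "\<And>q. m2 (W (Suc q) g) \<le> m2 (Z q) + \<kappa> * m2 (W q (Y u))" and Z: "\<And>q. m2 (Z q) \<le> 2 * ee q" for g Z
  proof -
    have "(\<Sum>q<N. s ^ Suc q * m2 (W (Suc q) g)) \<le> (\<Sum>q<N. s ^ Suc q * (m2 (Z q) + \<kappa> * m2 (W q (Y u))))"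
      using s le by (intro sum_mono mult_left_mono) auto
    also have "\<dots> = (\<Sum>q<N. s ^ Suc q * m2 (Z q)) + (\<Sum>q<N. s ^ Suc q * (\<kappa> * m2 (W q (Y u))))"
      by (simp add: sum.distrib distrib_left)
    finally show ?thesis using yy_sum[OF s, of "\<lambda>q. m2 (Z q)" 2, OF Z] shift unfolding MX_split by (smt (verit))
  qed
  have 2: "K2 s N (Y u) \<le> m2 (Y u) + (2 * yy s N + \<epsilon> * K2 s N (Y u))"
  proof (rule gen[of _ "\<lambda>q. Y (W (Suc q) u)"])
    fix q
    have e: "W (Suc q) (Y u) = Y (W (Suc q) u) - dT \<rho> * W q (Y u)"
      unfolding Y_W[OF u_sm] V_def nat.case by (simp only: add_diff_cancel)
    have "m2 (W (Suc q) (Y u)) \<le> m2 (Y (W (Suc q) u)) + m2 (dT \<rho> * W q (Y u))"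
      unfolding e by (intro m2_diff sm_mult dT_sm Y_sm W_sm rho_sm u_sm)
    moreover have "m2 (dT \<rho> * W q (Y u)) \<le> mS (dT \<rho>) * m2 (W q (Y u))" by (intro m2_mult dT_sm Y_sm W_sm rho_sm u_sm)
    moreover have "\<dots> \<le> \<kappa> * m2 (W q (Y u))" by (intro mult_right_mono \<kappa> mx_nonneg xn W_sm Y_sm u_sm)
    ultimately show "m2 (W (Suc q) (Y u)) \<le> m2 (Y (W (Suc q) u)) + \<kappa> * m2 (W q (Y u))" by linarith
  qed (use m2W u_sm in auto)
  have 1: "K2 s N (dX u) \<le> m2 (dX u) + (2 * yy s N + \<epsilon> * K2 s N (Y u))"
  proof (rule gen[of _ "\<lambda>q. dX (W (Suc q) u)"])
    fix q
    have e: "W (Suc q) (dX u) = dX (W (Suc q) u) - \<beta> * W q (Y u)"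
      unfolding dX_W[OF u_sm] V_def nat.case by (simp only: add_diff_cancel)
    have "m2 (W (Suc q) (dX u)) \<le> m2 (dX (W (Suc q) u)) + m2 (\<beta> * W q (Y u))"
      unfolding e by (intro m2_diff sm_mult dX_sm Y_sm W_sm beta_sm u_sm)
    moreover have "m2 (\<beta> * W q (Y u)) \<le> mS \<beta> * m2 (W q (Y u))" by (intro m2_mult beta_sm Y_sm W_sm u_sm)
    moreover have "\<dots> \<le> \<kappa> * m2 (W q (Y u))" by (intro mult_right_mono \<kappa> mx_nonneg xn W_sm Y_sm u_sm)
    ultimately show "m2 (W (Suc q) (dX u)) \<le> m2 (dX (W (Suc q) u)) + \<kappa> * m2 (W q (Y u))" by linarith
  qed (use m2W u_sm in auto)
  have eK: "\<epsilon> * K2 s N (Y u) \<le> K2 s N (Y u) / 2" using mult_right_mono[OF e(2) nn] by simp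
  have K: "K2 s N (Y u) \<le> 2 * \<epsilon> + 4 * yy s N" using 2 eK e(4) by linarith
  then show "K2 s N (Y u) \<le> 3 * \<epsilon> + 6 * yy s N" using y0 e0 by linarith
  show "K2 s N (dX u) \<le> 3 * \<epsilon> + 6 * yy s N" using 1 eK K e(3) y0 e0 by linarith
  have "KS s N (u - constf w0) = mS (u - constf w0) + (\<Sum>q<N. s ^ Suc q * mS (W (Suc q) u))"
    unfolding MX_split by (simp only: W_minus u_sm sm_basic W_constf nat.distinct not_False_eq_True diff_zero)
  also have "(\<Sum>q<N. s ^ Suc q * mS (W (Suc q) u)) \<le> 2 * yy s N"
  proof (rule yy_sum[OF s])
    fix q
    have "mS (W (Suc q) u) \<le> 2 * (sqrt (b - a) * ee q)" using m2W(3)[of q] by (simp only: mult.assoc)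
    also have "sqrt (b - a) * ee q \<le> 1 * ee q" using ba1 ee_nonneg by (intro mult_right_mono) auto
    finally show "mS (W (Suc q) u) \<le> 2 * ee q" by simp
  qed
  finally have "KS s N (u - constf w0) \<le> \<epsilon> + 2 * yy s N" using e(5) by linarith
  moreover have "Y (u - constf w0) = Y u" unfolding Y_def using u_sm by simp
  ultimately show "nrm s N (u - constf w0) \<le> 3 * \<epsilon> + 6 * yy s N" unfolding nrm_def using K by simp
qed

end

context box begin

lemma mx_cong: 
  assumes "\<And>x t. (x,t) \<in> D \<Longrightarrow> g x t = h x t" shows "mx (nS a b) g = mx (nS a b) h" "mx (n2 a b) g = mx (n2 a b) h"
proof -
  have 1: "dT g = dT h" by (rule dT_cong) (rule assms)
  have 2: "nS a b (\<lambda>x. g x t) = nS a b (\<lambda>x. h x t)" "n2 a b (\<lambda>x. g x t) = n2 a b (\<lambda>x. h x t)" if "t \<in> {c..d}" for t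
  proof -
    have "x \<in> {a..b} \<Longrightarrow> g x t = h x t" for x using assms QD' that by blast
    then show "nS a b (\<lambda>x. g x t) = nS a b (\<lambda>x. h x t)" "n2 a b (\<lambda>x. g x t) = n2 a b (\<lambda>x. h x t)"
      unfolding nS_def by (auto intro!: SUP_cong n2_cong)
  qed
  show "mx (nS a b) g = mx (nS a b) h" "mx (n2 a b) g = mx (n2 a b) h"
    unfolding mx_def 1 nS_def[of c d] using 2 by (auto intro!: SUP_cong arg_cong2[of _ _ _ _ plus])
qed

lemma mS_ge:
  assumes g: "g \<in> sm" and x: "x \<in> {a..b}" and t: "t \<in> {c..d}" shows "\<bar>g x t\<bar> \<le> mS g"
proof -
  have "\<bar>g x t\<bar> \<le> nS a b (\<lambda>x. g x t)" by (rule nS_ge[OF cont_x[OF g t] x])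
  also have "\<dots> \<le> \<bar>nS a b (\<lambda>x. g x t)\<bar>" by simp
  also have "\<dots> \<le> nS c d (\<lambda>t. nS a b (\<lambda>x. g x t))" by (rule nS_ge[OF cont_xnorm[OF xn(1) g] t])
  also have "\<dots> \<le> mS g" unfolding mx_def using n2_nonneg by simp
  finally show ?thesis .
qed

end

context wbox begin

lemma dTT_ft: "dT (dT ft) = 0"
proof -
  have "dT (dT ft) = dT 1" by (rule dT_cong) (simp add: dT_ft)
  then show ?thesis by simp
qed

lemma W_dT_ft: "W (Suc q) (dT ft) = 0"
  unfolding W_def funpow_Suc_right o_apply dTT_ft dTn_0 by simp

lemma MX_split0: "MX s \<alpha> N g = mx \<alpha> g + (\<Sum>q<N. s ^ Suc q * mx \<alpha> (W (Suc q) g))"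
  unfolding MX_def sum.atMost_shift by simp

lemma nrm_fx: "nrm s N (fx - constf x0) = mS (fx - constf x0)"
proof -
  have W0: "W (Suc q) (fx - constf x0) = 0" for q
  proof -
    have "dT (fx - constf x0) = 0" by simp
    then show ?thesis unfolding W_def funpow_Suc_right o_apply by (simp add: dTn_0)
  qed
  have "Y (fx - constf x0) = 0" unfolding Y_def by simp
  then show ?thesis unfolding nrm_def MX_split0[of s "nS a b"] W0 mx_0[OF xn(1)] by (simp add: MX_zero[OF xn(2)])
qed

text \<open>Of t - t0 only the indices 0 and 1 survive, with W 1 giving \<rho>; and Y t = m, which
  is annihilated by T.\<close>

lemma nrm_ft:
  assumes s: "0 \<le> s"
  shows "nrm s N (ft - constf t0) \<le> mS (ft - constf t0) + s * mS \<rho> + m2 m"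
proof -
  have d: "dT (ft - constf t0) = dT ft" by simp
  have W1: "mS (W (Suc 0) (ft - constf t0)) = mS \<rho>"
  proof (rule mx_cong(1))
    fix x t assume "(x,t) \<in> D"
    then show "W (Suc 0) (ft - constf t0) x t = \<rho> x t" unfolding W_def by (simp add: dT_ft)
  qed
  have W2: "W (Suc (Suc q)) (ft - constf t0) = 0" for q
    unfolding W_def funpow_Suc_right o_apply d dTT_ft dTn_0 by simp
  have "(\<Sum>q<N. s ^ Suc q * mS (W (Suc q) (ft - constf t0))) \<le> s * mS \<rho>"
  proof (cases N)
    case (Suc M)
    show ?thesis unfolding Suc sum.lessThan_Suc_shift W1 W2 mx_0[OF xn(1)] by simp
  qed (use s in \<open>simp add: mx_nonneg[OF xn(1)]\<close>)
  then have 1: "KS s N (ft - constf t0) \<le> mS (ft - constf t0) + s * mS \<rho>"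
    unfolding MX_split0 by simp
  have "K2 s N (Y (ft - constf t0)) = m2 (m * dT ft)"
    unfolding MX_split0 Y_def d W_const_mult[OF m_sm dT_m dT_sm[OF sm_basic(3)]] W_dT_ft by (simp add: mx_0[OF xn(2)])
  also have "\<dots> = m2 m" by (rule mx_cong(2)) (simp add: dT_ft)
  finally show ?thesis unfolding nrm_def using 1 by simp
qed

end

section \<open>The a priori estimate by continuity in \<open>s\<close>\<close>

context pde_box begin

text \<open>The right side of \<open>yy_bound\<close> with every norm replaced by its bound in terms
  of \<open>\<eta>\<close>. Each summand has a factor \<open>\<epsilon>\<close> or is at least
  quadratic in \<open>\<eta>\<close>; this is what allows the value to drop below a small
  \<theta>.\<close>

definition poly_bound :: "real \<Rightarrow> real \<Rightarrow> real \<Rightarrow> real \<Rightarrow> real \<Rightarrow> real" where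
  "poly_bound c0 f0 L \<epsilon> \<eta> = 2 * (\<epsilon> * (4 + c0\<^sup>2) * \<eta> + L * \<eta> * (L * \<eta> + 2 * \<bar>c0\<bar>) * \<eta>
     + 2 * \<epsilon> * (\<bar>f0\<bar> + L * \<eta> + (\<bar>c0\<bar> + L * \<eta>) * (L * \<eta>) * \<eta>))"

text \<open>Inserts \<open>K_bounds\<close> into \<open>yy_bound\<close>. The last two premises are
  the conclusions of \<open>ps3_compose\<close> for the coefficient and the right side, available
  only while \<open>\<eta>\<close> stays within half the radius of convergence. The quadratic term
  of \<open>G\<close> is estimated as \<open>KS\<close> times \<open>K2\<close> times
  \<open>K2\<close>.\<close>

lemma apriori_step:
  assumes cd1: "d - c \<le> 1" and ba1: "b - a \<le> 1" and \<kappa>: "mS (dT \<rho>) \<le> \<kappa>" "mS \<beta> \<le> \<kappa>" and s: "0 \<le> s"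
    and e: "s * \<kappa> \<le> \<epsilon>" "\<epsilon> \<le> 1/2" "m2 (dX u) \<le> \<epsilon>" "m2 (Y u) \<le> \<epsilon>" "mS (u - constf w0) \<le> \<epsilon>"
      "s * mS \<rho> \<le> \<epsilon>" "mS (fx - constf x0) \<le> \<epsilon>" "mS (ft - constf t0) \<le> \<epsilon>" "m2 m \<le> \<epsilon>" "sqrt (b - a) \<le> \<epsilon>"
    and \<eta>: "\<eta> = 3 * \<epsilon> + 6 * yy s N" "\<eta> \<le> e / 2" and L: "0 \<le> L"
    and H: "nrm s N (fx - constf x0) \<le> \<eta> \<Longrightarrow> nrm s N (ft - constf t0) \<le> \<eta> \<Longrightarrow> nrm s N (u - constf w0) \<le> \<eta> \<Longrightarrow>
      \<eta> \<le> e / 2 \<Longrightarrow> nrm s N (H - constf c0) \<le> L * \<eta>"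
    and F: "nrm s N (fx - constf x0) \<le> \<eta> \<Longrightarrow> nrm s N (ft - constf t0) \<le> \<eta> \<Longrightarrow> nrm s N (u - constf w0) \<le> \<eta> \<Longrightarrow>
      \<eta> \<le> e / 2 \<Longrightarrow> nrm s N (F - constf f0) \<le> L * \<eta>"
  shows "yy s N \<le> poly_bound c0 f0 L \<epsilon> \<eta>"
proof -
  have y0: "0 \<le> yy s N" unfolding yy_def by (intro sum_nonneg mult_nonneg_nonneg zero_le_power s ee_nonneg)
  have e0: "0 \<le> \<epsilon>" using e(3) mx_nonneg[OF xn(2) dX_sm[OF u_sm]] by linarith
  have eta0: "0 \<le> \<eta>" using \<eta> y0 e0 by simp
  note KB = K_bounds[OF cd1 ba1 \<kappa> s e(1-5), of N, folded \<eta>(1)]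
  have nx: "nrm s N (fx - constf x0) \<le> \<eta>" using e(7) \<eta>(1) y0 e0 unfolding nrm_fx by linarith
  have nt: "nrm s N (ft - constf t0) \<le> \<eta>"
    using nrm_ft[OF s, of N t0] e(6,8,9) \<eta>(1) y0 e0 by linarith
  have nH: "nrm s N (H - constf c0) \<le> L * \<eta>" by (rule H[OF nx nt KB(3) \<eta>(2)])
  have nF: "nrm s N (F - constf f0) \<le> L * \<eta>" by (rule F[OF nx nt KB(3) \<eta>(2)])
  define h where "h = H - constf c0"
  have hsm: "h \<in> sm" unfolding h_def by (intro sm_minus H_sm sm_basic)
  have Hh: "H = h + constf c0" unfolding h_def by simp
  have Kpos: "0 \<le> KS s N g" "0 \<le> K2 s N g" "0 \<le> K1 s N g" if "g \<in> sm" for g by (intro MX_nonneg xn that s)+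
  have Kh: "KS s N h \<le> L * \<eta>" "K2 s N (Y h) \<le> L * \<eta>"
    using nH Kpos[OF hsm] Kpos[OF Y_sm[OF hsm]] unfolding nrm_def h_def[symmetric] by linarith+
  have KSc: "KS s N (constf z) \<le> \<bar>z\<bar>" for z unfolding MX_constf[OF xn(1)] by (rule mx_constf)
  have KH: "KS s N H \<le> \<bar>c0\<bar> + L * \<eta>"
    using MX_add[OF xn(1) hsm sm_basic(1) s, of N c0] Kh(1) KSc[of c0] unfolding Hh by linarith
  have YH: "Y H = Y h" unfolding Hh Y_def using hsm by simp
  have KE: "KS s N (H * H - constf (c0\<^sup>2)) \<le> L * \<eta> * (L * \<eta> + 2 * \<bar>c0\<bar>)"
  proof -
    have eq: "H * H - constf (c0\<^sup>2) = h * (h + constf (2 * c0))"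
      unfolding Hh by (simp add: fun_eq_iff power2_eq_square algebra_simps)
    have "KS s N (h * (h + constf (2 * c0))) \<le> KS s N h * KS s N (h + constf (2 * c0))"
      by (intro KS_mult hsm sm_add sm_basic s)
    also have "\<dots> \<le> (L * \<eta>) * (L * \<eta> + 2 * \<bar>c0\<bar>)"
    proof (intro mult_mono Kh)
      show "KS s N (h + constf (2 * c0)) \<le> L * \<eta> + 2 * \<bar>c0\<bar>"
        using MX_add[OF xn(1) hsm sm_basic(1) s, of N "2 * c0"] Kh(1) KSc[of "2 * c0"] by (simp add: abs_mult)
    qed (use L eta0 hsm in \<open>auto intro!: Kpos\<close>)
    finally show ?thesis unfolding eq .
  qed
  have KF: "K1 s N F \<le> \<bar>f0\<bar> + L * \<eta>"
  proof -
    have "KS s N F \<le> \<bar>f0\<bar> + L * \<eta>"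
    proof -
      have Ff: "F = (F - constf f0) + constf f0" by simp
      have "KS s N (F - constf f0) \<le> L * \<eta>"
        using nF Kpos(2)[OF Y_sm[OF sm_minus[OF F_sm sm_basic(1)]], of f0] unfolding nrm_def by linarith
      then show ?thesis
        using MX_add[OF xn(1) sm_minus[OF F_sm sm_basic(1)] sm_basic(1) s, of N f0 f0] KSc[of f0] Ff by simp
    qed
    \<comment> \<open>Multiplication by 1 converts the supremum norm into the L1 norm, at the price
      of the length \<open>b - a \<le> 1\<close>.\<close>
    moreover have "K1 s N (F * constf 1) \<le> KS s N F * K1 s N (constf 1)"
      by (intro K1_mult F_sm sm_basic s)
    moreover have "K1 s N (constf 1) \<le> 1"
    proof -
      have "n1 a b (\<lambda>x. 1) = b - a" "n1 a b (\<lambda>x. 0) = 0" using ab by (simp_all add: n1_def)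
      moreover have "nS c d (\<lambda>t. b - a) \<le> b - a" by (rule nS_le[OF cd_le]) (use ab in simp)
      ultimately show ?thesis unfolding MX_constf[OF xn(3)] unfolding mx_def using ba1 by (simp add: n2_def)
    qed
    moreover have "F * constf 1 = F" by simp
    ultimately show ?thesis using Kpos(1)[OF F_sm] mult_left_mono[of "K1 s N (constf 1)" 1 "KS s N F"] by simp
  qed
  have KHYY: "K1 s N (H * Y H * Y u) \<le> (\<bar>c0\<bar> + L * \<eta>) * (L * \<eta>) * \<eta>"
  proof -
    have "K1 s N (H * (Y H * Y u)) \<le> KS s N H * K1 s N (Y H * Y u)"
      by (intro K1_mult sm_mult H_sm Y_sm u_sm s)
    also have "\<dots> \<le> (\<bar>c0\<bar> + L * \<eta>) * ((L * \<eta>) * \<eta>)"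
    proof (intro mult_mono KH)
      have "K1 s N (Y H * Y u) \<le> K2 s N (Y H) * K2 s N (Y u)" by (intro K1_mult2 Y_sm H_sm u_sm s)
      also have "\<dots> \<le> (L * \<eta>) * \<eta>"
        unfolding YH using L eta0 u_sm by (intro mult_mono Kh KB Kpos) auto
      finally show "K1 s N (Y H * Y u) \<le> (L * \<eta>) * \<eta>" .
    qed (use L eta0 H_sm u_sm in \<open>auto intro!: Kpos\<close>)
    finally show ?thesis by (simp only: mult.assoc)
  qed
  have KG: "K1 s N G \<le> \<bar>f0\<bar> + L * \<eta> + (\<bar>c0\<bar> + L * \<eta>) * (L * \<eta>) * \<eta>"
  proof -
    have sm3: "H * Y H * Y u \<in> sm" by (intro sm_mult H_sm Y_sm u_sm)
    have "K1 s N (constf (-1) * F) \<le> KS s N (constf (-1)) * K1 s N F" by (intro K1_mult sm_basic F_sm s)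
    also have "\<dots> \<le> 1 * K1 s N F" using KSc[of "-1"] by (intro mult_right_mono Kpos F_sm) simp
    finally have "K1 s N (constf (-1) * F) \<le> K1 s N F" by simp
    moreover have "G = H * Y H * Y u + constf (-1) * F" unfolding G_def by (simp add: fun_eq_iff)
    ultimately show ?thesis using MX_add[OF xn(3) sm3 sm_mult[OF sm_basic(1) F_sm] s, of N "-1"] KF KHYY by simp
  qed
  define A where "A = 1 + (1 + c0\<^sup>2)"
  have A: "0 \<le> A" by (simp add: A_def)
  have "yy s N \<le> 2 * (2 * (s * \<kappa>) * K2 s N (dX u) + A * (s * \<kappa>) * K2 s N (Y u)
     + KS s N (H * H - constf (c0\<^sup>2)) * K2 s N (Y u) + sqrt (b - a) * (1 + s * \<kappa>) * K1 s N G)"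
    unfolding A_def by (rule yy_bound[OF refl \<kappa> s])
  also have "\<dots> \<le> 2 * (2 * \<epsilon> * \<eta> + A * \<epsilon> * \<eta> + L * \<eta> * (L * \<eta> + 2 * \<bar>c0\<bar>) * \<eta>
     + \<epsilon> * 2 * (\<bar>f0\<bar> + L * \<eta> + (\<bar>c0\<bar> + L * \<eta>) * (L * \<eta>) * \<eta>))"
  proof -
    have k0: "0 \<le> s * \<kappa>" using \<kappa>(2) mx_nonneg[OF xn(1) beta_sm] s by simp
    have 1: "2 * (s * \<kappa>) * K2 s N (dX u) \<le> 2 * \<epsilon> * \<eta>"
      using e(1) e0 u_sm k0 by (intro mult_mono KB Kpos) auto
    have 2: "A * (s * \<kappa>) * K2 s N (Y u) \<le> A * \<epsilon> * \<eta>"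
      using e(1) e0 u_sm A k0 by (intro mult_mono KB Kpos mult_left_mono) auto
    have 3: "KS s N (H * H - constf (c0\<^sup>2)) * K2 s N (Y u) \<le> L * \<eta> * (L * \<eta> + 2 * \<bar>c0\<bar>) * \<eta>"
      using L eta0 u_sm by (intro mult_mono KE KB Kpos mult_nonneg_nonneg add_nonneg_nonneg) auto
    have 4: "sqrt (b - a) * (1 + s * \<kappa>) * K1 s N G \<le> \<epsilon> * 2 * (\<bar>f0\<bar> + L * \<eta> + (\<bar>c0\<bar> + L * \<eta>) * (L * \<eta>) * \<eta>)"
      using e(1,2,10) k0 ab e0 by (intro mult_mono KG Kpos G_sm) auto
    show ?thesis by (intro mult_left_mono add_mono 1 2 3 4) simp
  qed
  also have "\<dots> = poly_bound c0 f0 L \<epsilon> \<eta>" by (simp add: poly_bound_def A_def algebra_simps)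
  finally show ?thesis .
qed

text \<open>If the sum failed to stay below \<open>\<theta>\<close> at \<open>s0\<close>, the
  intermediate value theorem would give a smaller \<open>s\<close> where it equals
  \<open>\<theta>\<close>, and there \<open>apriori_step\<close> bounds it by a number less than
  \<open>\<theta>\<close>. The smallness conditions at \<open>s0\<close> pass to smaller
  \<open>s\<close> because they are linear in it.\<close>

lemma apriori:
  assumes cd1: "d - c \<le> 1" and ba1: "b - a \<le> 1" and \<kappa>: "mS (dT \<rho>) \<le> \<kappa>" "mS \<beta> \<le> \<kappa>" and s0: "0 \<le> s0"
    and e: "s0 * \<kappa> \<le> \<epsilon>" "\<epsilon> \<le> 1/2" "m2 (dX u) \<le> \<epsilon>" "m2 (Y u) \<le> \<epsilon>" "mS (u - constf w0) \<le> \<epsilon>"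
      "s0 * mS \<rho> \<le> \<epsilon>" "mS (fx - constf x0) \<le> \<epsilon>" "mS (ft - constf t0) \<le> \<epsilon>" "m2 m \<le> \<epsilon>" "sqrt (b - a) \<le> \<epsilon>"
    and L: "0 \<le> L" and th: "0 < \<theta>" "3 * \<epsilon> + 6 * \<theta> \<le> e / 2" "poly_bound c0 f0 L \<epsilon> (3 * \<epsilon> + 6 * \<theta>) < \<theta>"
    and H: "\<And>s N \<eta>. 0 \<le> s \<Longrightarrow> nrm s N (fx - constf x0) \<le> \<eta> \<Longrightarrow> nrm s N (ft - constf t0) \<le> \<eta> \<Longrightarrow> nrm s N (u - constf w0) \<le> \<eta> \<Longrightarrow>
      \<eta> \<le> e / 2 \<Longrightarrow> nrm s N (H - constf c0) \<le> L * \<eta>"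
    and F: "\<And>s N \<eta>. 0 \<le> s \<Longrightarrow> nrm s N (fx - constf x0) \<le> \<eta> \<Longrightarrow> nrm s N (ft - constf t0) \<le> \<eta> \<Longrightarrow> nrm s N (u - constf w0) \<le> \<eta> \<Longrightarrow>
      \<eta> \<le> e / 2 \<Longrightarrow> nrm s N (F - constf f0) \<le> L * \<eta>"
  shows "yy s0 N < \<theta>"
proof (rule ccontr)
  assume "\<not> yy s0 N < \<theta>"
  have "yy 0 N = 0" by (simp add: yy_def)
  moreover have "continuous_on {0..s0} (\<lambda>s. yy s N)" unfolding yy_def by (intro continuous_intros)
  ultimately obtain s where s: "0 \<le> s" "s \<le> s0" "yy s N = \<theta>"
    using IVT'[of "\<lambda>s. yy s N" 0 \<theta> s0] th(1) s0 \<open>\<not> yy s0 N < \<theta>\<close> by auto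
  have k0: "0 \<le> \<kappa>" using \<kappa>(2) mx_nonneg[OF xn(1) beta_sm] by linarith
  have "s * \<kappa> \<le> s0 * \<kappa>" "s * mS \<rho> \<le> s0 * mS \<rho>"
    using s k0 mx_nonneg[OF xn(1) rho_sm] by (auto intro!: mult_right_mono)
  then have e': "s * \<kappa> \<le> \<epsilon>" "s * mS \<rho> \<le> \<epsilon>" using e by linarith+
  have "yy s N \<le> poly_bound c0 f0 L \<epsilon> (3 * \<epsilon> + 6 * \<theta>)"
    by (rule apriori_step[OF cd1 ba1 \<kappa> s(1) e'(1) e(2-5) e'(2) e(7-10) _ th(2) L H[OF s(1)] F[OF s(1)]]) (simp add: s)
  then show False using th(3) s(3) by simp
qed

text \<open>A single summand of \<open>yy\<close> is bounded by the whole sum, uniformly in the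
  truncation, which gives geometric growth of W (Suc q) u and so factorial growth of the
  t-derivative.\<close>

lemma dTn_u_bound:
  assumes cd1: "d - c \<le> 1" and ba1: "b - a \<le> 1" and s: "0 < s" and y: "\<And>N. yy s N < \<theta>"
    and x: "x \<in> {a..b}" and t: "t \<in> {c..d}"
  shows "\<bar>\<rho> x t\<bar> ^ Suc q * \<bar>(dT ^^ Suc q) u x t\<bar> \<le> 2 * \<theta> * fact (Suc q) / s ^ Suc q"
proof -
  have "s ^ Suc q * ee q \<le> yy s (Suc q)"
    unfolding yy_def using s ee_nonneg by (intro member_le_sum) auto
  then have "s ^ Suc q * ee q \<le> \<theta>" using y[of "Suc q"] by linarith
  then have eeq: "ee q \<le> \<theta> / s ^ Suc q" using s by (simp add: pos_le_divide_eq mult.commute)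
  have "\<bar>W (Suc q) u x t\<bar> \<le> mS (W (Suc q) u)" by (rule mS_ge[OF W_sm[OF u_sm] x t])
  also have "\<dots> \<le> 2 * (sqrt (b - a) * ee q)" using m2_W_le(3)[OF cd1, of q] by (simp only: mult.assoc)
  also have "sqrt (b - a) * ee q \<le> 1 * ee q" using ba1 ee_nonneg by (intro mult_right_mono) auto
  also have "2 * (1 * ee q) \<le> 2 * (\<theta> / s ^ Suc q)" using eeq by simp
  finally have "\<bar>\<rho> x t ^ Suc q * (dT ^^ Suc q) u x t / fact (Suc q)\<bar> \<le> 2 * (\<theta> / s ^ Suc q)"
    unfolding W_def by (simp del: funpow.simps power_Suc fact_Suc)
  then show ?thesis
    by (simp add: abs_mult power_abs field_simps del: funpow.simps power_Suc fact_Suc)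
qed

end

section \<open>Growth of the t-derivatives\<close>

lemma small_params:
  fixes L c0 f0 e :: real
  assumes L: "0 \<le> L" and e: "0 < e"
  obtains \<epsilon> \<theta> where "0 < \<epsilon>" "\<epsilon> \<le> 1/2" "0 < \<theta>" "3 * \<epsilon> + 6 * \<theta> \<le> e / 2"
    "\<And>\<eta>. \<eta> = 3 * \<epsilon> + 6 * \<theta> \<Longrightarrow> 2 * (\<epsilon> * (4 + c0\<^sup>2) * \<eta> + L * \<eta> * (L * \<eta> + 2 * \<bar>c0\<bar>) * \<eta>
     + 2 * \<epsilon> * (\<bar>f0\<bar> + L * \<eta> + (\<bar>c0\<bar> + L * \<eta>) * (L * \<eta>) * \<eta>)) < \<theta>"
proof -
  \<comment> \<open>\<open>P\<close> and \<open>M\<close> bound the coefficients of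
    \<open>poly_bound\<close> for \<eta> \<le> 1; \<open>Q\<close> collects everything multiplied by
    \<open>\<epsilon>\<close>.\<close>
  define P where "P = L * (9 * L + 2 * \<bar>c0\<bar>)"
  define M where "M = \<bar>f0\<bar> + 9 * L + (\<bar>c0\<bar> + 9 * L) * (9 * L) * 9"
  define Q where "Q = 9 * (4 + c0\<^sup>2) + 2 * M"
  have P: "0 \<le> P" and M: "0 \<le> M" and Q: "0 \<le> Q" using L by (simp_all add: P_def M_def Q_def)
  \<comment> \<open>As \<open>\<epsilon> \<le> \<theta>\<close> below, \<eta> is at most 9 \<theta>.
    The quadratic part is then at most 162 P \<theta>^2, and 648 = 4 * 162 makes it at most
    \<theta>/4. Next \<epsilon> is chosen so that its part is at most \<theta>/4 too.\<close>
  define \<theta> where "\<theta> = min (1/9) (min (e / 18) (1 / (648 * (P + 1))))"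
  have th: "0 < \<theta>" "9 * \<theta> \<le> 1" "9 * \<theta> \<le> e / 2" "\<theta> \<le> 1 / (648 * (P + 1))"
    using e P by (auto simp: \<theta>_def)
  define \<epsilon> where "\<epsilon> = min \<theta> (\<theta> / (8 * (Q + 1)))"
  have ep: "0 < \<epsilon>" "\<epsilon> \<le> \<theta>" "\<epsilon> \<le> \<theta> / (8 * (Q + 1))" using th Q by (auto simp: \<epsilon>_def)
  show ?thesis
  proof (rule that[of \<epsilon> \<theta>])
    fix \<eta> assume eta: "\<eta> = 3 * \<epsilon> + 6 * \<theta>"
    have eta': "0 \<le> \<eta>" "\<eta> \<le> 9 * \<theta>" "\<eta> \<le> 1" using eta ep th by auto
    have Le: "L * \<eta> \<le> 9 * L" using L eta'(3) mult_left_mono[of \<eta> 9 L] by simp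
    have Le0: "0 \<le> L * \<eta>" using L eta' by simp
    have 1: "\<epsilon> * (4 + c0\<^sup>2) * \<eta> \<le> \<epsilon> * (9 * (4 + c0\<^sup>2))"
    proof -
      have "(4 + c0\<^sup>2) * \<eta> \<le> (4 + c0\<^sup>2) * 9" using eta' by (intro mult_left_mono) auto
      from mult_left_mono[OF this less_imp_le[OF ep(1)]] show ?thesis by (simp only: mult_ac)
    qed
    have 2: "L * \<eta> * (L * \<eta> + 2 * \<bar>c0\<bar>) * \<eta> \<le> 81 * P * \<theta> * \<theta>"
    proof -
      have "L * (L * \<eta> + 2 * \<bar>c0\<bar>) \<le> P" unfolding P_def using L Le by (intro mult_left_mono) auto
      moreover have "\<eta> * \<eta> \<le> (9 * \<theta>) * (9 * \<theta>)" using eta' by (intro mult_mono) auto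
      ultimately have "(L * (L * \<eta> + 2 * \<bar>c0\<bar>)) * (\<eta> * \<eta>) \<le> P * ((9 * \<theta>) * (9 * \<theta>))"
        using P eta' th by (intro mult_mono) auto
      then show ?thesis by (simp add: algebra_simps)
    qed
    have 3: "\<bar>f0\<bar> + L * \<eta> + (\<bar>c0\<bar> + L * \<eta>) * (L * \<eta>) * \<eta> \<le> M"
    proof -
      have gen: "\<bar>f0\<bar> + A + (\<bar>c0\<bar> + A) * A * \<eta> \<le> \<bar>f0\<bar> + B + (\<bar>c0\<bar> + B) * B * 9" if "0 \<le> A" "A \<le> B" for A B
        using that eta' by (intro add_mono mult_mono) auto
      show ?thesis unfolding M_def by (rule gen[OF Le0 Le])
    qed
    have "2 * (\<epsilon> * (4 + c0\<^sup>2) * \<eta> + L * \<eta> * (L * \<eta> + 2 * \<bar>c0\<bar>) * \<eta>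
        + 2 * \<epsilon> * (\<bar>f0\<bar> + L * \<eta> + (\<bar>c0\<bar> + L * \<eta>) * (L * \<eta>) * \<eta>))
      \<le> 2 * (\<epsilon> * (9 * (4 + c0\<^sup>2)) + 81 * P * \<theta> * \<theta> + 2 * \<epsilon> * M)"
      using 1 2 3 ep by (intro mult_left_mono add_mono) auto
    also have "\<dots> = 162 * P * \<theta> * \<theta> + 2 * (\<epsilon> * Q)" by (simp add: Q_def algebra_simps)
    also have "\<dots> < \<theta>"
    proof -
      have "\<theta> * (648 * (P + 1)) \<le> 1" using th(4) P by (simp add: pos_le_divide_eq)
      then have "648 * (\<theta> * P) \<le> 1" using th by (simp add: algebra_simps)
      then have "648 * (\<theta> * P) * \<theta> \<le> 1 * \<theta>" using th by (intro mult_right_mono) auto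
      then have a: "162 * P * \<theta> * \<theta> \<le> \<theta> / 4" by (simp add: mult_ac)
      have "\<epsilon> * (8 * (Q + 1)) \<le> \<theta>" using ep(3) Q by (simp add: pos_le_divide_eq)
      then have "2 * (\<epsilon> * Q) \<le> \<theta> / 4" using ep by (simp add: algebra_simps)
      then show ?thesis using a th by linarith
    qed
    finally show "2 * (\<epsilon> * (4 + c0\<^sup>2) * \<eta> + L * \<eta> * (L * \<eta> + 2 * \<bar>c0\<bar>) * \<eta>
     + 2 * \<epsilon> * (\<bar>f0\<bar> + L * \<eta> + (\<bar>c0\<bar> + L * \<eta>) * (L * \<eta>) * \<eta>)) < \<theta>" .
  qed (use ep th in auto)
qed

lemma ps3_shrink: "ps3 h x0 t0 w0 c e \<Longrightarrow> 0 < e' \<Longrightarrow> e' \<le> e \<Longrightarrow> ps3 h x0 t0 w0 c e'"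
  unfolding ps3_def by auto

lemma ps3_of_analytic3: "real_analytic3_at h x0 t0 w0 \<Longrightarrow> \<exists>c e. ps3 h x0 t0 w0 c e"
  unfolding real_analytic3_at_def ps3_def by blast

text \<open>The right side is regarded as a series in a third variable with zero coefficients, so
  that \<open>ps3_compose\<close> handles it together with the coefficient of the equation.\<close>

lemma ps3_of_analytic2:
  assumes "real_analytic2_at f x0 t0"
  shows "\<exists>c e. ps3 (\<lambda>x t w. f x t) x0 t0 w0 c e"
proof -
  obtain c e where ce: "e > 0 \<and> (\<forall>x t. \<bar>x - x0\<bar> < e \<longrightarrow> \<bar>t - t0\<bar> < e \<longrightarrow>
           ((\<lambda>(j,k). c (j,k) * (x - x0)^j * (t - t0)^k) has_sum f x t) UNIV)"
    using assms unfolding real_analytic2_at_def by (elim exE) (rule that)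
  have e: "e > 0" using ce by (rule conjunct1)
  have hs: "((\<lambda>(j,k). c (j,k) * (x - x0)^j * (t - t0)^k) has_sum f x t) UNIV"
    if "\<bar>x - x0\<bar> < e" "\<bar>t - t0\<bar> < e" for x t
    using ce that by simp
  define c' :: "nat \<times> nat \<times> nat \<Rightarrow> real" where "c' = (\<lambda>(j,k,l). if l = 0 then c (j,k) else 0)"
  have "((\<lambda>(j,k,l). c' (j,k,l) * (x - x0)^j * (t - t0)^k * (w - w0)^l) has_sum f x t) UNIV"
    if "\<bar>x - x0\<bar> < e" "\<bar>t - t0\<bar> < e" for x t w
  proof -
    define g :: "nat \<times> nat \<Rightarrow> nat \<times> nat \<times> nat" where "g = (\<lambda>(j,k). (j,k,0))"
    have inj: "inj_on g UNIV" by (auto simp: g_def inj_on_def)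
    have "((\<lambda>(j,k,l). c' (j,k,l) * (x - x0)^j * (t - t0)^k * (w - w0)^l) has_sum f x t) (range g)"
    proof -
      have "(\<lambda>(j,k,l). c' (j,k,l) * (x - x0)^j * (t - t0)^k * (w - w0)^l) \<circ> g
          = (\<lambda>(j,k). c (j,k) * (x - x0)^j * (t - t0)^k)"
        by (auto simp: g_def c'_def fun_eq_iff)
      then show ?thesis unfolding has_sum_reindex[OF inj] using hs[OF that] by simp
    qed
    then show ?thesis
      by (rule iffD1[OF has_sum_cong_neutral, rotated -1]) (auto simp: g_def c'_def image_iff)
  qed
  then have "ps3 (\<lambda>x t w. f x t) x0 t0 w0 c' e" unfolding ps3_def using e by simp
  then show ?thesis by (intro exI)
qed

context box begin

text \<open>Two separate bounds are kept since u - w0 is small by continuity while T u is merely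
  bounded; the second becomes small through the length of the t-interval.\<close>

lemma mS_small:
  assumes g: "g \<in> sm" and B: "\<And>x t. x \<in> {a..b} \<Longrightarrow> t \<in> {c..d} \<Longrightarrow> \<bar>g x t\<bar> \<le> B0 \<and> \<bar>dT g x t\<bar> \<le> B1"
  shows "mS g \<le> B0 + sqrt (d - c) * B1"
proof -
  have "\<bar>nS a b (\<lambda>x. g x t)\<bar> \<le> B0" "\<bar>nS a b (\<lambda>x. dT g x t)\<bar> \<le> B1" if t: "t \<in> {c..d}" for t
  proof -
    have "nS a b (\<lambda>x. g x t) \<le> B0" "nS a b (\<lambda>x. dT g x t) \<le> B1"
      using B t by (auto intro!: nS_le ab_le)
    then show "\<bar>nS a b (\<lambda>x. g x t)\<bar> \<le> B0" "\<bar>nS a b (\<lambda>x. dT g x t)\<bar> \<le> B1"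
      using nS_nonneg[OF ab_le cont_x[OF g t]] nS_nonneg[OF ab_le cont_x[OF dT_sm[OF g] t]] by linarith+
  qed
  then show ?thesis unfolding mx_def
    by (intro add_mono nS_le[OF cd_le] n2_bound[OF cd_le] cont_xnorm[OF xn(1) dT_sm[OF g]]) auto
qed

text \<open>Here no value of \<open>g\<close> needs to be small: L2 in x over a short interval
  supplies the factor \<open>sqrt (b - a)\<close>.\<close>

lemma m2_small:
  assumes g: "g \<in> sm" and B: "\<And>x t. x \<in> {a..b} \<Longrightarrow> t \<in> {c..d} \<Longrightarrow> \<bar>g x t\<bar> \<le> B \<and> \<bar>dT g x t\<bar> \<le> B"
    and cd1: "d - c \<le> 1"
  shows "m2 g \<le> 2 * sqrt (b - a) * B"
proof -
  have B0: "0 \<le> B" using B[of a c] ab cd by force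
  have "\<bar>n2 a b (\<lambda>x. g x t)\<bar> \<le> sqrt (b - a) * B" "\<bar>n2 a b (\<lambda>x. dT g x t)\<bar> \<le> sqrt (b - a) * B" if t: "t \<in> {c..d}" for t
    using B t n2_nonneg by (auto intro!: n2_bound[OF ab_le] cont_x[OF g t] cont_x[OF dT_sm[OF g] t])
  then have "m2 g \<le> sqrt (b - a) * B + sqrt (d - c) * (sqrt (b - a) * B)" unfolding mx_def
    by (intro add_mono nS_le[OF cd_le] n2_bound[OF cd_le] cont_xnorm[OF xn(2) dT_sm[OF g]]) auto
  also have "sqrt (d - c) * (sqrt (b - a) * B) \<le> 1 * (sqrt (b - a) * B)"
    using cd1 B0 ab by (intro mult_right_mono) auto
  finally show ?thesis by (simp add: mult_ac)
qed

end

section \<open>The equation near the point and the choice of constants\<close>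

locale pde_domain = plane_domain +
  fixes r :: nat and x0 t0 w0 e f0 c0 :: real and ch cf :: "nat \<times> nat \<times> nat \<Rightarrow> real"
    and h :: "real \<Rightarrow> real \<Rightarrow> real \<Rightarrow> real" and u f :: "real \<Rightarrow> real \<Rightarrow> real"
  assumes r: "0 < r" and u_sm: "u \<in> sm"
    and u_bd: "\<And>bs. \<exists>B. \<forall>x t. (x,t) \<in> D \<longrightarrow> \<bar>dw bs u x t\<bar> \<le> B"
    and psh: "ps3 h x0 t0 w0 ch e" and psf: "ps3 (\<lambda>x t w. f x t) x0 t0 w0 cf e"
    and near: "\<And>x t. (x,t) \<in> D \<Longrightarrow> \<bar>x - x0\<bar> \<le> e/4 \<and> \<bar>t - t0\<bar> \<le> e/4 \<and> \<bar>u x t - w0\<bar> \<le> e/4"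
    and P: "\<And>x t. (x,t) \<in> D \<Longrightarrow> P_op r h u u x t = f x t"
    and c0: "c0 = h x0 t0 w0" and f0: "f0 = f x0 t0"
begin

definition HH where "HH = (\<lambda>x t. h x t (u x t))"
definition mm where "mm = fx ^ r"
text \<open>Cut off in the same way as the derivatives, so that the differential equation holds
  between functions on the whole plane.\<close>

definition FF where "FF = (\<lambda>x t. if (x,t) \<in> D then f x t else 0)"
definition LL where "LL = max (2 / e * ps_mass ch e) (2 / e * ps_mass cf e)"

lemma HH_sm: "HH \<in> sm"
  unfolding HH_def by (rule ps3_compose(1)[OF psh u_sm u_bd near])

lemma f_sm: "f \<in> sm"
  using ps3_compose(1)[OF psf u_sm u_bd near] by simp

lemma FF_sm: "FF \<in> sm"
  by (rule sm_cong[OF _ f_sm]) (simp add: FF_def)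

lemma mm_sm: "mm \<in> sm" and dT_mm: "dT mm = 0"
  unfolding mm_def by (auto simp: dT_power simp del: power_fun_app)

lemma e_pos: "0 < e"
  using psh by (simp add: ps3_def)

lemma ps_mass_nonneg: "0 \<le> ps_mass c e"
  unfolding ps_mass_def using e_pos by (intro infsum_nonneg) auto

lemma LL_nonneg: "0 \<le> LL"
  unfolding LL_def using ps_mass_nonneg[of ch] e_pos by (simp add: le_max_iff_disj)

lemma HH_bound:
  assumes "good_norm \<nu>" "\<nu> (fx - constf x0) \<le> \<eta>" "\<nu> (ft - constf t0) \<le> \<eta>" "\<nu> (u - constf w0) \<le> \<eta>" "\<eta> \<le> e/2"
  shows "\<nu> (HH - constf c0) \<le> LL * \<eta>" "\<nu> (f - constf f0) \<le> LL * \<eta>"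
proof -
  have "0 \<le> \<nu> (u - constf w0)" using good_normD(3)[OF assms(1) sm_minus[OF u_sm sm_basic(1)] sm_0] .
  then have eta: "0 \<le> \<eta>" using assms(4) by linarith
  have "\<nu> (HH - constf c0) \<le> 2 / e * ps_mass ch e * \<eta>"
    unfolding HH_def c0 by (rule ps3_compose(2)[OF psh u_sm u_bd near assms])
  also have "\<dots> \<le> LL * \<eta>" unfolding LL_def using eta by (intro mult_right_mono) auto
  finally show "\<nu> (HH - constf c0) \<le> LL * \<eta>" .
  have "\<nu> (f - constf f0) \<le> 2 / e * ps_mass cf e * \<eta>"
    unfolding f0 by (rule ps3_compose(2)[OF psf u_sm u_bd near assms])
  also have "\<dots> \<le> LL * \<eta>" unfolding LL_def using eta by (intro mult_right_mono) auto
  finally show "\<nu> (f - constf f0) \<le> LL * \<eta>" .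
qed

lemma pde_raw: 
  "dX (dX u) + mm * dT (mm * dT u) + mm * HH * dT (mm * HH * dT u) = - FF"
proof (intro ext)
  fix x t
  show "(dX (dX u) + mm * dT (mm * dT u) + mm * HH * dT (mm * HH * dT u)) x t = (- FF) x t"
  proof (cases "(x,t) \<in> D")
    case True
    have 1: "pdx (pdx u) x t = dX (dX u) x t"
      using pdx_cong[of "pdx u" "dX u"] True by (simp add: dX_def)
    have 2: "pdt (\<lambda>y s. y ^ r * pdt u y s) x t = dT (mm * dT u) x t"
      using pdt_cong[of "\<lambda>y s. y ^ r * pdt u y s" "mm * dT u" x t] True by (simp add: dT_def mm_def)
    have 3: "pdt (\<lambda>y s. y ^ r * h y s (u y s) * pdt u y s) x t = dT (mm * HH * dT u) x t"
      using pdt_cong[of "\<lambda>y s. y ^ r * h y s (u y s) * pdt u y s" "mm * HH * dT u" x t] True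
      by (simp add: dT_def mm_def HH_def)
    show ?thesis using P[OF True] True unfolding P_op_def Dx_sq_def aDt_sq_def 1 2 3
      by (simp add: FF_def mm_def HH_def)
  qed (simp add: dX_out dT_out FF_def)
qed

text \<open>With Y = m T one has (H Y)(H Y u) = Y (H^2 Y u) - H (Y H)(Y u). Divergence form is what
  integration by parts needs; the price is the term with the product of Y H and Y u on the
  right.\<close>

lemma pde_div:
  "dX (dX u) + mm * dT ((1 + HH * HH) * (mm * dT u)) = HH * (mm * dT HH) * (mm * dT u) - FF"
proof -
  note s = mm_sm HH_sm u_sm dT_sm sm_mult sm_add sm_1
  have e1: "dT (mm * dT u) = mm * dT (dT u)"
    using s by (simp only: dT_mult dT_mm mult_zero_left add_0_left)
  have e2: "dT (mm * HH * dT u) = mm * dT HH * dT u + mm * HH * dT (dT u)"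
    using s by (simp only: dT_mult dT_mm mult_zero_left add_0_left)
  have e3: "dT ((1 + HH * HH) * (mm * dT u)) = (dT HH * HH + HH * dT HH) * (mm * dT u) + (1 + HH * HH) * (mm * dT (dT u))"
    using s by (simp only: dT_mult dT_add dXT_01 dT_mm mult_zero_left add_0_left)
  show ?thesis using pde_raw unfolding e1 e2 e3 by (simp add: fun_eq_iff algebra_simps)
qed

end

context wbox begin

lemma nrm_cong:
  assumes "\<And>x t. (x,t) \<in> D \<Longrightarrow> g x t = h x t" shows "nrm s N g = nrm s N h"
proof -
  have T: "dT g = dT h" by (rule dT_cong) (rule assms)
  have Wg: "W p g x t = W p h x t" if "(x,t) \<in> D" for p x t
    using assms[OF that] by (cases p) (simp_all add: W_def funpow_Suc_right T del: funpow.simps)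
  have "mS (W p g) = mS (W p h)" for p by (rule mx_cong(1)) (rule Wg)
  then show ?thesis unfolding nrm_def MX_def Y_def T by simp
qed

end

text \<open>\<open>x0R\<close> places the square either symmetrically about the degenerate line x =
  0 or on one side of it. A cutoff in the variable x^(r+1) that vanishes on the vertical edges then
  has no further zeros between them.\<close>

locale pde_square = pde_domain +
  fixes R :: real
  assumes R: "0 < R" and D_eq: "D = {x0 - R<..<x0 + R} \<times> {t0 - R<..<t0 + R}"
    and uw: "u x0 t0 = w0" and x0R: "x0 = 0 \<or> R \<le> \<bar>x0\<bar>"
begin

lemma center: "(x0, t0) \<in> D"
  using R by (simp add: D_eq)

lemma u_cont: assumes "0 < \<epsilon>" shows "\<exists>\<delta>>0. \<forall>x t. (x,t) \<in> D \<longrightarrow> \<bar>x - x0\<bar> < \<delta> \<longrightarrow> \<bar>t - t0\<bar> < \<delta> \<longrightarrow> \<bar>u x t - w0\<bar> < \<epsilon>"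
proof -
  obtain d where d: "d > 0" "\<And>z. z \<in> D \<Longrightarrow> dist z (x0,t0) < d \<Longrightarrow> dist (u (fst z) (snd z)) w0 < \<epsilon>"
    using sm_cont[OF u_sm] center assms uw unfolding continuous_on_iff by (force simp: case_prod_beta)
  have "\<bar>u x t - w0\<bar> < \<epsilon>" if "(x,t) \<in> D" "\<bar>x - x0\<bar> < d/2" "\<bar>t - t0\<bar> < d/2" for x t
  proof -
    have "dist (x,t) (x0,t0) \<le> \<bar>x - x0\<bar> + \<bar>t - t0\<bar>"
      using sqrt_sum_squares_le_sum_abs by (simp add: dist_Pair_Pair dist_real_def)
    then have "dist (x,t) (x0,t0) < d" using that by linarith
    then show ?thesis using d(2)[OF that(1)] by (simp add: dist_real_def)
  qed
  then show ?thesis using d(1) by (intro exI[of _ "d/2"]) auto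
qed

text \<open>Equal powers force equal absolute values. For x0 = 0 the edges have the largest absolute
  value in the interval; otherwise the interval avoids 0 and the absolute value is injective on
  it.\<close>

lemma power_neq:
  assumes x: "\<bar>x - x0\<bar> < \<delta>" and d: "\<delta> < R" and v: "v = x0 - \<delta> \<or> v = x0 + \<delta>"
  shows "x ^ Suc r \<noteq> v ^ Suc r"
proof
  assume "x ^ Suc r = v ^ Suc r"
  then have "\<bar>x\<bar> ^ Suc r = \<bar>v\<bar> ^ Suc r" by (metis power_abs)
  then have "\<bar>x\<bar> = \<bar>v\<bar>" using power_eq_imp_eq_base[of "\<bar>x\<bar>" "Suc r" "\<bar>v\<bar>"] by simp
  then show False using x d v x0R by (auto simp: abs_if split: if_splits)
qed

text \<open>The constants depend on each other in one order: \<epsilon> and \<theta> from the series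
  data, then the size \<delta> of the square, then the cutoff, and finally the generating parameter,
  which compensates the size of the derivatives of the cutoff.\<close>

lemma dTn_bound:
  "\<exists>\<delta> C K. 0 < \<delta> \<and> \<delta> \<le> R \<and> 0 < C \<and> 0 < K \<and> (\<forall>x t p. \<bar>x - x0\<bar> < \<delta> \<longrightarrow> \<bar>t - t0\<bar> < \<delta> \<longrightarrow> \<bar>(dT ^^ p) u x t\<bar> \<le> C * K ^ p * fact p)"
proof -
  obtain \<epsilon> \<theta> where et: "0 < \<epsilon>" "\<epsilon> \<le> 1/2" "0 < \<theta>" "3 * \<epsilon> + 6 * \<theta> \<le> e / 2"
    and pb: "\<And>\<eta>. \<eta> = 3 * \<epsilon> + 6 * \<theta> \<Longrightarrow> 2 * (\<epsilon> * (4 + c0\<^sup>2) * \<eta> + LL * \<eta> * (LL * \<eta> + 2 * \<bar>c0\<bar>) * \<eta>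
     + 2 * \<epsilon> * (\<bar>f0\<bar> + LL * \<eta> + (\<bar>c0\<bar> + LL * \<eta>) * (LL * \<eta>) * \<eta>)) < \<theta>"
    using small_params[OF LL_nonneg e_pos, of c0 f0] by metis
  have sub0: "{x0 - R/2..x0 + R/2} \<times> {t0 - R/2..t0 + R/2} \<subseteq> D" using R by (auto simp: D_eq)
  \<comment> \<open>The bound \<open>B\<close> must be known before \<open>\<delta>\<close> is
    chosen, hence it is taken on a fixed larger square.\<close>
  interpret B0: box D "x0 - R/2" "x0 + R/2" "t0 - R/2" "t0 + R/2"
    by unfold_locales (use R sub0 in auto)
  define gs where "gs = [dX u, dT (dX u), mm * dT u, dT (mm * dT u), mm, dT u, 1]"
  have gsm: "g \<in> sm" if "g \<in> set gs" for g
    using that u_sm mm_sm unfolding gs_def by (auto simp del: times_fun_apply)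
  have "\<exists>B\<ge>1. \<forall>g\<in>set gs. \<forall>x t. \<bar>x - x0\<bar> \<le> R/2 \<longrightarrow> \<bar>t - t0\<bar> \<le> R/2 \<longrightarrow> \<bar>g x t\<bar> \<le> B"
  proof -
    have "\<exists>B. \<forall>x t. \<bar>x - x0\<bar> \<le> R/2 \<longrightarrow> \<bar>t - t0\<bar> \<le> R/2 \<longrightarrow> \<bar>g x t\<bar> \<le> B" if "g \<in> set gs" for g
    proof -
      have g: "g \<in> sm" by (rule gsm[OF that])
      obtain B where B: "0 \<le> B" "\<And>x t. x \<in> {x0 - R/2..x0 + R/2} \<Longrightarrow> t \<in> {t0 - R/2..t0 + R/2} \<Longrightarrow> \<bar>g x t\<bar> \<le> B"
        using B0.bddQ[OF g] by metis
      have "\<bar>g x t\<bar> \<le> B" if "\<bar>x - x0\<bar> \<le> R/2" "\<bar>t - t0\<bar> \<le> R/2" for x t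
      proof (rule B(2))
        show "x \<in> {x0 - R/2..x0 + R/2}" "t \<in> {t0 - R/2..t0 + R/2}"
          using that unfolding abs_le_iff atLeastAtMost_iff by linarith+
      qed
      then show ?thesis by blast
    qed
    then obtain Bf where Bf: "\<And>g x t. g \<in> set gs \<Longrightarrow> \<bar>x - x0\<bar> \<le> R/2 \<Longrightarrow> \<bar>t - t0\<bar> \<le> R/2 \<Longrightarrow> \<bar>g x t\<bar> \<le> Bf g"
      by metis
    define B where "B = Max (insert 1 (Bf ` set gs))"
    have "Bf g \<le> B" if "g \<in> set gs" for g unfolding B_def using that by (intro Max_ge) auto
    moreover have "1 \<le> B" unfolding B_def by (intro Max_ge) auto
    ultimately show ?thesis using Bf by (meson order_trans)
  qed
  then obtain B where B: "1 \<le> B" "\<And>g x t. g \<in> set gs \<Longrightarrow> \<bar>x - x0\<bar> \<le> R/2 \<Longrightarrow> \<bar>t - t0\<bar> \<le> R/2 \<Longrightarrow> \<bar>g x t\<bar> \<le> B"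
    by metis
  obtain \<delta>1 where \<delta>1: "\<delta>1 > 0" "\<And>x t. (x,t) \<in> D \<Longrightarrow> \<bar>x - x0\<bar> < \<delta>1 \<Longrightarrow> \<bar>t - t0\<bar> < \<delta>1 \<Longrightarrow> \<bar>u x t - w0\<bar> < \<epsilon> / 2"
    using u_cont[of "\<epsilon>/2"] et by (metis half_gt_zero)
  \<comment> \<open>The sides have length 2 \<delta>. The last entry gives 2 sqrt(2 \<delta>) B
    \<le> \<epsilon>, as required by \<open>m2_small\<close> and by the second term of
    \<open>mS_small\<close>.\<close>
  define \<delta> where "\<delta> = min (min (R/2) (1/2)) (min (\<delta>1 / 2) (min (\<epsilon>/2) ((\<epsilon> / (2 * B))\<^sup>2 / 2)))"
  have dl: "0 < \<delta>" "\<delta> \<le> R/2" "\<delta> \<le> 1/2" "\<delta> < \<delta>1" "\<delta> \<le> \<epsilon>/2" "2 * \<delta> \<le> (\<epsilon> / (2 * B))\<^sup>2"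
    using R \<delta>1 et B by (auto simp: \<delta>_def)
  have sq: "sqrt (2 * \<delta>) \<le> \<epsilon> / (2 * B)" using dl(6) et B by (intro real_le_lsqrt) auto
  have sqB: "2 * sqrt (2 * \<delta>) * B \<le> \<epsilon>" using sq B et by (simp add: field_simps)
  have sqn: "0 \<le> sqrt (2 * \<delta>)" using dl by simp
  have sq1: "2 * sqrt (2 * \<delta>) \<le> \<epsilon>" using sqB mult_left_mono[OF B(1), of "2 * sqrt (2 * \<delta>)"] sqn by simp
  have gin: "dX u \<in> set gs" "dT (dX u) \<in> set gs" "mm * dT u \<in> set gs" "dT (mm * dT u) \<in> set gs" "mm \<in> set gs" "dT u \<in> set gs"
    by (simp_all only: gs_def list.set insert_iff simp_thms)
  define q where "q = fx ^ Suc r"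
  define v1 where "v1 = (x0 - \<delta>) ^ Suc r"
  define v2 where "v2 = (x0 + \<delta>) ^ Suc r"
  define kk where "kk = ((q - constf v1) * (q - constf v2))\<^sup>2"
  \<comment> \<open>The double zero makes T of the cutoff vanish on the horizontal edges as
    well.\<close>
  define ll where "ll = ((ft - constf (t0 - \<delta>)) * (ft - constf (t0 + \<delta>)))\<^sup>2"
  define \<rho> where "\<rho> = kk * ll"
  \<comment> \<open>What is left of X \<rho> after removing m, since X (x^(r+1)) = (r+1) x^r. The
    factor \<open>dX fx\<close>, equal to 1 on \<open>D\<close> and 0 elsewhere, keeps the identity
    valid off \<open>D\<close>.\<close>
  define \<beta> where "\<beta> = constf (2 * real (Suc r)) * dX fx * ((q - constf v1) * (q - constf v2)) * ((q - constf v1) + (q - constf v2)) * ll"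
  note sms = sm_mult sm_power sm_minus sm_add sm_basic dX_sm dT_sm
  have qsm: "q \<in> sm" unfolding q_def by (intro sms)
  have ksm: "kk \<in> sm" unfolding kk_def by (intro sms qsm)
  have lsm: "ll \<in> sm" unfolding ll_def by (intro sms)
  have rsm: "\<rho> \<in> sm" unfolding \<rho>_def by (intro sms ksm lsm)
  have bsm: "\<beta> \<in> sm" unfolding \<beta>_def by (intro sms qsm lsm)
  have dXq: "dX q = constf (real (Suc r)) * mm * dX fx"
    unfolding q_def mm_def by (simp only: dX_power sm_basic diff_Suc_1)
  have dTq: "dT q = 0" unfolding q_def by (simp add: dT_power del: power_Suc power_fun_app)
  have dXll: "dX ll = 0"
    unfolding ll_def by (simp add: dX_power sms del: power_fun_app)
  have dTkk: "dT kk = 0"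
    unfolding kk_def using qsm by (simp add: dT_power dTq sms del: power_fun_app)
  have dXkk: "dX kk = constf 2 * ((q - constf v1) * (q - constf v2)) * (dX q * ((q - constf v1) + (q - constf v2)))"
  proof -
    have "dX kk = constf (real 2) * ((q - constf v1) * (q - constf v2)) ^ (2 - 1) * dX ((q - constf v1) * (q - constf v2))"
      unfolding kk_def by (rule dX_power) (intro sms qsm)
    also have "dX ((q - constf v1) * (q - constf v2)) = dX q * ((q - constf v1) + (q - constf v2))"
      using qsm by (simp add: sms) (simp add: fun_eq_iff algebra_simps)
    finally show ?thesis by (simp add: fun_eq_iff)
  qed
  have dXrho: "dX \<rho> = mm * \<beta>"
  proof -
    have "dX \<rho> = dX kk * ll" unfolding \<rho>_def using ksm lsm by (simp only: dX_mult dXll mult_zero_right add_0_right)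
    then show ?thesis unfolding dXkk dXq \<beta>_def by (simp add: fun_eq_iff algebra_simps)
  qed
  have dTrho: "dT \<rho> = kk * dT ll" unfolding \<rho>_def using ksm lsm by (simp only: dT_mult dTkk mult_zero_left add_0_left)
  have k0: "kk (x0 - \<delta>) t = 0" "kk (x0 + \<delta>) t = 0" for t
    unfolding kk_def q_def v1_def v2_def by simp_all
  have l0: "ll x (t0 - \<delta>) = 0" "ll x (t0 + \<delta>) = 0" for x unfolding ll_def by simp_all
  have dl0: "dT ll x (t0 - \<delta>) = 0" "dT ll x (t0 + \<delta>) = 0" for x
  proof -
    have "dT ll = constf (real 2) * ((ft - constf (t0 - \<delta>)) * (ft - constf (t0 + \<delta>))) ^ (2 - 1) * dT ((ft - constf (t0 - \<delta>)) * (ft - constf (t0 + \<delta>)))"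
      unfolding ll_def by (rule dT_power) (intro sms)
    then show "dT ll x (t0 - \<delta>) = 0" "dT ll x (t0 + \<delta>) = 0" by simp_all
  qed
  define G where "G = HH * (mm * dT HH) * (mm * dT u) - FF"
  have subQ: "{x0 - \<delta>..x0 + \<delta>} \<times> {t0 - \<delta>..t0 + \<delta>} \<subseteq> D" using R dl by (auto simp: D_eq)
  interpret wb: wbox D "x0 - \<delta>" "x0 + \<delta>" "t0 - \<delta>" "t0 + \<delta>" mm \<rho>
    by unfold_locales (use dl subQ mm_sm dT_mm rsm in auto)
  have Y: "wb.Y g = mm * dT g" for g by (rule wb.Y_def)
  interpret pb: pde_box D "x0 - \<delta>" "x0 + \<delta>" "t0 - \<delta>" "t0 + \<delta>" mm \<rho> \<beta> u HH FF G
  proof unfold_locales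
    show "dX (dX u) + wb.Y ((1 + HH * HH) * wb.Y u) = G" unfolding Y G_def by (rule pde_div)
    show "G = HH * wb.Y HH * wb.Y u - FF" unfolding Y G_def ..
    show "dX \<rho> = mm * \<beta>" by (rule dXrho)
    show "\<rho> (x0 - \<delta>) t = 0 \<and> \<rho> (x0 + \<delta>) t = 0 \<and> dT \<rho> (x0 - \<delta>) t = 0 \<and> dT \<rho> (x0 + \<delta>) t = 0" for t
      unfolding dTrho by (simp add: \<rho>_def k0)
    show "\<rho> x (t0 - \<delta>) = 0 \<and> \<rho> x (t0 + \<delta>) = 0 \<and> dT \<rho> x (t0 - \<delta>) = 0 \<and> dT \<rho> x (t0 + \<delta>) = 0 \<and> dX \<rho> x (t0 - \<delta>) = 0" for x
      unfolding dTrho dXrho by (simp add: \<rho>_def \<beta>_def l0 dl0)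
  qed (use bsm u_sm HH_sm FF_sm in auto)
  define \<kappa> where "\<kappa> = max (wb.mS (dT \<rho>)) (wb.mS \<beta>)"
  have kap: "wb.mS (dT \<rho>) \<le> \<kappa>" "wb.mS \<beta> \<le> \<kappa>" by (simp_all add: \<kappa>_def)
  have nn: "0 \<le> wb.mS g" if "g \<in> sm" for g by (rule wb.mx_nonneg[OF wb.xn(1) that])
  have kap0: "0 \<le> \<kappa>" using kap nn[OF bsm] by linarith
  have rho0: "0 \<le> wb.mS \<rho>" by (rule nn[OF rsm])
  \<comment> \<open>\<open>\<kappa>\<close> and the norm of \<open>\<rho>\<close> depend on
    \<open>\<delta>\<close> and have no smallness; only now can the generating parameter be adjusted
    to them.\<close>
  define s0 where "s0 = \<epsilon> / (\<kappa> + wb.mS \<rho> + 1)"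
  have s0: "0 < s0" "s0 * \<kappa> \<le> \<epsilon>" "s0 * wb.mS \<rho> \<le> \<epsilon>"
  proof -
    have den: "0 < \<kappa> + wb.mS \<rho> + 1" using kap0 rho0 by linarith
    show "0 < s0" unfolding s0_def using den et by simp
    have *: "s0 * (\<kappa> + wb.mS \<rho> + 1) = \<epsilon>" unfolding s0_def using den by simp
    show "s0 * \<kappa> \<le> \<epsilon>" "s0 * wb.mS \<rho> \<le> \<epsilon>"
      using * \<open>0 < s0\<close> mult_nonneg_nonneg[OF less_imp_le[OF \<open>0 < s0\<close>] kap0]
        mult_nonneg_nonneg[OF less_imp_le[OF \<open>0 < s0\<close>] rho0] unfolding distrib_left by linarith+
  qed
  have inQ: "\<bar>x - x0\<bar> \<le> R/2 \<and> \<bar>t - t0\<bar> \<le> R/2 \<and> (x,t) \<in> D \<and> \<bar>x - x0\<bar> \<le> \<delta> \<and> \<bar>t - t0\<bar> \<le> \<delta>"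
    if "x \<in> {x0 - \<delta>..x0 + \<delta>}" "t \<in> {t0 - \<delta>..t0 + \<delta>}" for x t
  proof -
    have "\<bar>x - x0\<bar> \<le> \<delta>" "\<bar>t - t0\<bar> \<le> \<delta>"
      using that unfolding abs_le_iff atLeastAtMost_iff by linarith+
    moreover have "(x,t) \<in> D" using subQ that by blast
    ultimately show ?thesis using dl(2) by linarith
  qed
  have d2: "(t0 + \<delta>) - (t0 - \<delta>) = 2 * \<delta>" "(x0 + \<delta>) - (x0 - \<delta>) = 2 * \<delta>" by simp_all
  have s1: "wb.m2 g \<le> \<epsilon>" if "g \<in> sm" "\<And>x t. \<bar>x - x0\<bar> \<le> R/2 \<Longrightarrow> \<bar>t - t0\<bar> \<le> R/2 \<Longrightarrow> \<bar>g x t\<bar> \<le> B \<and> \<bar>dT g x t\<bar> \<le> B" for g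
  proof -
    have "wb.m2 g \<le> 2 * sqrt (x0 + \<delta> - (x0 - \<delta>)) * B"
    proof (rule wb.m2_small[OF that(1)])
      show "\<bar>g x t\<bar> \<le> B \<and> \<bar>dT g x t\<bar> \<le> B" if "x \<in> {x0 - \<delta>..x0 + \<delta>}" "t \<in> {t0 - \<delta>..t0 + \<delta>}" for x t
        using that(1,2) inQ[OF that] \<open>\<And>x t. \<bar>x - x0\<bar> \<le> R/2 \<Longrightarrow> \<bar>t - t0\<bar> \<le> R/2 \<Longrightarrow> \<bar>g x t\<bar> \<le> B \<and> \<bar>dT g x t\<bar> \<le> B\<close> by blast
    qed (use dl in simp)
    then show ?thesis unfolding d2 using sqB by linarith
  qed
  have y: "pb.yy s0 N < \<theta>" for N
  proof (rule pb.apriori[where e = e and L = LL and ?c0.0 = c0 and ?f0.0 = f0 and \<epsilon> = \<epsilon> and \<kappa> = \<kappa> and ?w0.0 = w0 and ?x0.0 = x0 and ?t0.0 = t0])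
    show "wb.m2 (dX u) \<le> \<epsilon>" by (rule s1, intro dX_sm u_sm, intro conjI B(2)[OF gin(1)] B(2)[OF gin(2)])
    show "wb.m2 (wb.Y u) \<le> \<epsilon>" unfolding Y 
      by (rule s1, intro sm_mult mm_sm dT_sm u_sm, intro conjI B(2)[OF gin(3)] B(2)[OF gin(4)])
    show "wb.m2 mm \<le> \<epsilon>" 
      by (rule s1, rule mm_sm, intro conjI B(2)[OF gin(5)]) (use B(1) in \<open>simp_all add: dT_mm\<close>)
    show "wb.mS (u - constf w0) \<le> \<epsilon>"
    proof -
      have "\<bar>(u - constf w0) x t\<bar> \<le> \<epsilon>/2 \<and> \<bar>dT (u - constf w0) x t\<bar> \<le> B"
        if "x \<in> {x0 - \<delta>..x0 + \<delta>}" "t \<in> {t0 - \<delta>..t0 + \<delta>}" for x t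
        using \<delta>1(2)[of x t] inQ[OF that] dl(4) B(2)[OF gin(6), of x t] u_sm by auto
      then have "wb.mS (u - constf w0) \<le> \<epsilon>/2 + sqrt (t0 + \<delta> - (t0 - \<delta>)) * B"
        using u_sm by (intro wb.mS_small) auto
      then show ?thesis unfolding d2 using sqB by simp
    qed
    show "wb.mS (fx - constf x0) \<le> \<epsilon>"
    proof -
      have "\<bar>(fx - constf x0) x t\<bar> \<le> \<epsilon>/2 \<and> \<bar>dT (fx - constf x0) x t\<bar> \<le> 0"
        if "x \<in> {x0 - \<delta>..x0 + \<delta>}" "t \<in> {t0 - \<delta>..t0 + \<delta>}" for x t
        using inQ[OF that] dl(5) by auto
      then have "wb.mS (fx - constf x0) \<le> \<epsilon>/2 + sqrt (t0 + \<delta> - (t0 - \<delta>)) * 0"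
        by (intro wb.mS_small) auto
      then show ?thesis using et by simp
    qed
    show "wb.mS (ft - constf t0) \<le> \<epsilon>"
    proof -
      have "\<bar>(ft - constf t0) x t\<bar> \<le> \<epsilon>/2 \<and> \<bar>dT (ft - constf t0) x t\<bar> \<le> 1"
        if "x \<in> {x0 - \<delta>..x0 + \<delta>}" "t \<in> {t0 - \<delta>..t0 + \<delta>}" for x t
        using inQ[OF that] dl(5) dT_ft by auto
      then have "wb.mS (ft - constf t0) \<le> \<epsilon>/2 + sqrt (t0 + \<delta> - (t0 - \<delta>)) * 1"
        by (intro wb.mS_small) auto
      then show ?thesis unfolding d2 using sq1 by simp
    qed
    show "sqrt (x0 + \<delta> - (x0 - \<delta>)) \<le> \<epsilon>" unfolding d2 using sq1 sqn by linarith
    show "pb.poly_bound c0 f0 LL \<epsilon> (3 * \<epsilon> + 6 * \<theta>) < \<theta>" unfolding pb.poly_bound_def by (rule pb) simp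
    show "wb.nrm s N (HH - constf c0) \<le> LL * \<eta>"
      if "0 \<le> s" "wb.nrm s N (fx - constf x0) \<le> \<eta>" "wb.nrm s N (ft - constf t0) \<le> \<eta>" "wb.nrm s N (u - constf w0) \<le> \<eta>" "\<eta> \<le> e / 2" for s N \<eta>
      by (rule HH_bound(1)[OF wb.good_norm_nrm[OF that(1)] that(2-5)])
    show "wb.nrm s N (FF - constf f0) \<le> LL * \<eta>"
      if "0 \<le> s" "wb.nrm s N (fx - constf x0) \<le> \<eta>" "wb.nrm s N (ft - constf t0) \<le> \<eta>" "wb.nrm s N (u - constf w0) \<le> \<eta>" "\<eta> \<le> e / 2" for s N \<eta>
    proof -
      have "wb.nrm s N (FF - constf f0) = wb.nrm s N (f - constf f0)" by (rule wb.nrm_cong) (simp add: FF_def)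
      from ord_eq_le_trans[OF this HH_bound(2)[OF wb.good_norm_nrm[OF that(1)] that(2-5)]] show ?thesis .
    qed
  qed (use kap s0 et LL_nonneg dl in auto)
  \<comment> \<open>On the square of half size the cutoff has no zeros, by \<open>power_neq\<close>,
    so compactness bounds it away from 0. Dividing W p u by \<rho>^p then costs only a geometric
    factor, which is why \<open>K\<close> below is 1 / (s0 \<rho>0).\<close>
  have "\<exists>\<rho>0>0. \<forall>x t. \<bar>x - x0\<bar> \<le> \<delta>/2 \<longrightarrow> \<bar>t - t0\<bar> \<le> \<delta>/2 \<longrightarrow> \<rho>0 \<le> \<bar>\<rho> x t\<bar>"
  proof -
    let ?S = "{x0 - \<delta>/2..x0 + \<delta>/2} \<times> {t0 - \<delta>/2..t0 + \<delta>/2}"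
    have "continuous_on ?S (\<lambda>z. \<bar>(\<lambda>(x,t). \<rho> x t) z\<bar>)"
      by (intro continuous_on_rabs continuous_on_subset[OF sm_cont[OF rsm]]) (use R dl in \<open>auto simp: D_eq\<close>)
    moreover have "compact ?S" "?S \<noteq> {}" using dl by (auto intro: compact_Times)
    ultimately obtain z where z: "z \<in> ?S" "\<And>y. y \<in> ?S \<Longrightarrow> \<bar>(\<lambda>(x,t). \<rho> x t) z\<bar> \<le> \<bar>(\<lambda>(x,t). \<rho> x t) y\<bar>"
      using continuous_attains_inf by metis
    obtain x t where xt: "z = (x,t)" by (cases z)
    have x: "\<bar>x - x0\<bar> < \<delta>" and t: "\<bar>t - t0\<bar> < \<delta>" using z(1) dl by (auto simp: xt abs_less_iff)
    have "x ^ Suc r \<noteq> v1" "x ^ Suc r \<noteq> v2"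
      unfolding v1_def v2_def using power_neq[OF x] dl R by auto
    then have "\<rho> x t \<noteq> 0" using t unfolding \<rho>_def kk_def ll_def q_def by auto
    moreover have "\<bar>\<rho> x t\<bar> \<le> \<bar>\<rho> y s\<bar>" if "\<bar>y - x0\<bar> \<le> \<delta>/2" "\<bar>s - t0\<bar> \<le> \<delta>/2" for y s
    proof -
      have "y \<in> {x0 - \<delta>/2..x0 + \<delta>/2}" "s \<in> {t0 - \<delta>/2..t0 + \<delta>/2}"
        using that unfolding abs_le_iff atLeastAtMost_iff by linarith+
      then show ?thesis using z(2)[of "(y,s)"] by (simp add: xt)
    qed
    ultimately show ?thesis by (intro exI[of _ "\<bar>\<rho> x t\<bar>"]) simp
  qed
  then obtain \<rho>0 where r0: "\<rho>0 > 0" "\<And>x t. \<bar>x - x0\<bar> \<le> \<delta>/2 \<Longrightarrow> \<bar>t - t0\<bar> \<le> \<delta>/2 \<Longrightarrow> \<rho>0 \<le> \<bar>\<rho> x t\<bar>" by metis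
  define K where "K = 1 / (s0 * \<rho>0)"
  define C where "C = 2 * \<theta> + \<bar>w0\<bar> + \<epsilon>"
  have main: "\<bar>(dT ^^ p) u x t\<bar> \<le> C * K ^ p * fact p" if xt: "\<bar>x - x0\<bar> < \<delta>/2" "\<bar>t - t0\<bar> < \<delta>/2" for x t p
  proof -
    have xQ: "x \<in> {x0 - \<delta>..x0 + \<delta>}" "t \<in> {t0 - \<delta>..t0 + \<delta>}"
      using xt dl(1) unfolding abs_less_iff atLeastAtMost_iff by linarith+
    show ?thesis
    proof (cases p)
      case 0
      have "\<bar>u x t - w0\<bar> < \<epsilon> / 2" using \<delta>1(2)[of x t] inQ[OF xQ] dl(4) by auto
      moreover have "\<bar>u x t\<bar> \<le> \<bar>u x t - w0\<bar> + \<bar>w0\<bar>" by linarith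
      ultimately have "\<bar>u x t\<bar> \<le> C" using et unfolding C_def by linarith
      then show ?thesis unfolding 0 by simp
    next
      case (Suc q)
      have K0: "0 < K" using s0 r0 by (simp add: K_def)
      have "\<rho>0 ^ p * \<bar>(dT ^^ p) u x t\<bar> \<le> \<bar>\<rho> x t\<bar> ^ p * \<bar>(dT ^^ p) u x t\<bar>"
        using r0 xt by (intro mult_right_mono power_mono) auto
      also have "\<dots> \<le> 2 * \<theta> * fact p / s0 ^ p"
        unfolding Suc by (rule pb.dTn_u_bound[OF _ _ s0(1) y xQ]) (use dl in auto)
      finally have "\<bar>(dT ^^ p) u x t\<bar> \<le> 2 * \<theta> * fact p / s0 ^ p / \<rho>0 ^ p"
        by (intro iffD2[OF pos_le_divide_eq[OF zero_less_power[OF r0(1)]]]) (simp only: mult.commute)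
      also have "\<dots> = 2 * \<theta> * K ^ p * fact p" by (simp add: K_def power_mult_distrib power_divide)
      also have "\<dots> \<le> C * K ^ p * fact p" using et K0 by (intro mult_right_mono) (auto simp: C_def)
      finally show ?thesis .
    qed
  qed
  have "0 < C" "0 < K" using et s0 r0 by (auto simp: C_def K_def)
  then show ?thesis using main dl R by (intro exI[of _ "\<delta>/2"] exI[of _ C] exI[of _ K]) auto
qed

end

section \<open>Growth of the mixed derivatives\<close>

text \<open>The left side is one summand of Vandermonde's identity.\<close>

lemma choose_mult_le: "i \<le> p \<Longrightarrow> j \<le> q \<Longrightarrow> (p choose i) * (q choose j) \<le> (p + q) choose (i + j)"
proof -
  have "(p choose i) * (q choose ((i + j) - i)) \<le> (\<Sum>k\<le>i + j. (p choose k) * (q choose (i + j - k)))"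
    by (rule member_le_sum) auto
  then show ?thesis by (simp add: vandermonde)
qed

lemma choose_shift_le: "n choose i \<le> (n + k + l) choose (i + k)"
proof -
  have "n choose i \<le> (n + l) choose i" by (rule binomial_right_mono) simp
  also have "\<dots> \<le> (n + l + k) choose (i + k)" by (induction k) auto
  finally show ?thesis by (simp add: add_ac)
qed

context plane_domain begin

definition EE :: "nat \<Rightarrow> nat \<Rightarrow> (real \<Rightarrow> real \<Rightarrow> real) \<Rightarrow> real \<Rightarrow> real \<Rightarrow> real" where
  "EE p q g = (dX ^^ q) ((dT ^^ p) g)"

lemma EE_sm: "g \<in> sm \<Longrightarrow> EE p q g \<in> sm"
  unfolding EE_def by (intro dXn_sm dTn_sm)

lemma EE_dw: "EE p q g = dw (replicate q True @ replicate p False) g"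
  by (simp only: EE_def dw_append dw_replicate dw_replicate_X)

lemma EE_add: "g \<in> sm \<Longrightarrow> h \<in> sm \<Longrightarrow> EE p q (g + h) = EE p q g + EE p q h"
  unfolding EE_dw by (rule dw_add)

lemma dT_EE: "g \<in> sm \<Longrightarrow> dT (EE p q g) = EE (Suc p) q g"
  unfolding EE_def by (simp only: dT_dXn dTn_sm funpow.simps o_apply)

lemma dX_EE: "dX (EE p q g) = EE p (Suc q) g"
  unfolding EE_def by (simp only: funpow.simps o_apply)

lemma EE_dT: "EE p q (dT g) = EE (Suc p) q g"
  unfolding EE_def by (simp only: funpow_Suc_right o_apply)

lemma EE_dX: "g \<in> sm \<Longrightarrow> EE p q (dX g) = EE p (Suc q) g"
  unfolding EE_def by (simp only: dX_dTn[symmetric] funpow_Suc_right o_apply)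

lemma EE_cong: "(\<And>x t. (x,t) \<in> D \<Longrightarrow> g x t = h x t) \<Longrightarrow> (x,t) \<in> D \<Longrightarrow> EE p q g x t = EE p q h x t"
proof -
  assume gh: "\<And>x t. (x,t) \<in> D \<Longrightarrow> g x t = h x t" and xt: "(x,t) \<in> D"
  have "dw bs g x t = dw bs h x t" if "(x,t) \<in> D" for bs x t
    using that
  proof (induction bs arbitrary: x t)
    case (Cons b bs)
    then have "dX (dw bs g) = dX (dw bs h)" "dT (dw bs g) = dT (dw bs h)" by (auto intro!: dX_cong dT_cong)
    then show ?case by simp
  qed (simp add: gh)
  then show ?thesis unfolding EE_dw using xt by blast
qed

text \<open>The Leibniz rule in two variables: first for pure t-derivatives, then by induction on
  the number of x-derivatives applied to that formula.\<close>

lemma EE_mult: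
  assumes g: "g \<in> sm" and h: "h \<in> sm"
  shows "EE p q (g * h) x t = (\<Sum>i\<le>p. \<Sum>j\<le>q. real (p choose i) * real (q choose j) * (EE i j g x t * EE (p - i) (q - j) h x t))"
proof -
  \<comment> \<open>Pascal's rule in the form of one Leibniz step, stated for an abstract
    \<open>f\<close> so that it serves both variables.\<close>
  have bin: "(\<Sum>i\<le>n. real (n choose i) * (f (Suc i) (n - i) + f i (Suc (n - i)))) = (\<Sum>i\<le>Suc n. real (Suc n choose i) * f i (Suc n - i))"
    for n :: nat and f :: "nat \<Rightarrow> nat \<Rightarrow> real"
  proof -
    have 1: "(\<Sum>i\<le>Suc n. real (Suc n choose i) * f i (Suc n - i))
        = f 0 (Suc n) + (\<Sum>i\<le>n. (real (n choose i) + real (n choose Suc i)) * f (Suc i) (n - i))"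
      unfolding sum.atMost_Suc_shift[of _ n] by simp
    have 2: "(\<Sum>i\<le>n. real (n choose i) * f i (Suc (n - i))) = f 0 (Suc n) + (\<Sum>i\<le>n. real (n choose Suc i) * f (Suc i) (n - i))"
    proof -
      have "(\<Sum>i\<le>n. real (n choose i) * f i (Suc (n - i))) = (\<Sum>i\<le>Suc n. real (n choose i) * f i (Suc n - i))"
        by (simp add: Suc_diff_le)
      also have "\<dots> = f 0 (Suc n) + (\<Sum>i\<le>n. real (n choose Suc i) * f (Suc i) (n - i))"
        unfolding sum.atMost_Suc_shift[of _ n] by simp
      finally show ?thesis .
    qed
    show ?thesis unfolding 1 using 2 by (simp add: sum.distrib algebra_simps)
  qed
  have T: "EE p 0 (g * h) = (\<Sum>i\<le>p. constf (real (p choose i)) * (EE i 0 g * EE (p - i) 0 h))" for p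
  proof (induction p)
    case 0
    then show ?case by (simp add: EE_def)
  next
    case (Suc p)
    have IH: "EE p 0 (g * h) = (\<Sum>i\<le>p. constf (real (p choose i)) * (EE i 0 g * EE (p - i) 0 h))" using Suc by blast
    have "EE (Suc p) 0 (g * h) = dT (EE p 0 (g * h))" using g h by (simp only: dT_EE sm_mult)
    also have "\<dots> = (\<Sum>i\<le>p. constf (real (p choose i)) * (EE (Suc i) 0 g * EE (p - i) 0 h + EE i 0 g * EE (Suc (p - i)) 0 h))"
      unfolding IH using EE_sm[OF g] EE_sm[OF h] g h
      by (simp only: dT_sum sm_mult sm_basic dT_mult dT_constf dT_EE mult_zero_left add_0_left)
    also have "\<dots> = (\<Sum>i\<le>Suc p. constf (real (Suc p choose i)) * (EE i 0 g * EE (Suc p - i) 0 h))"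
    proof (intro ext)
      fix x t
      show "(\<Sum>i\<le>p. constf (real (p choose i)) * (EE (Suc i) 0 g * EE (p - i) 0 h + EE i 0 g * EE (Suc (p - i)) 0 h)) x t
          = (\<Sum>i\<le>Suc p. constf (real (Suc p choose i)) * (EE i 0 g * EE (Suc p - i) 0 h)) x t"
        using bin[of p "\<lambda>i j. EE i 0 g x t * EE j 0 h x t"] by (simp del: sum.atMost_Suc binomial_Suc_Suc)
    qed
    finally show ?case .
  qed
  have X: "EE p q (g * h) x t = (\<Sum>i\<le>p. real (p choose i) * (\<Sum>j\<le>q. real (q choose j) * (EE i j g x t * EE (p - i) (q - j) h x t)))" for p q x t
  proof (induction q arbitrary: x t)
    case 0
    then show ?case unfolding T by simp
  next
    case (Suc q)
    have IH: "EE p q (g * h) = (\<Sum>i\<le>p. constf (real (p choose i)) * (\<Sum>j\<le>q. constf (real (q choose j)) * (EE i j g * EE (p - i) (q - j) h)))"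
      by (intro ext, rule trans[OF Suc]) simp
    have sm1: "(\<Sum>j\<le>q. constf (real (q choose j)) * (EE i j g * EE k (q - j) h)) \<in> sm" for i k
      by (intro sm_sum sm_mult sm_basic EE_sm g h)
    have "EE p (Suc q) (g * h) = dX (EE p q (g * h))" by (simp only: dX_EE)
    also have "\<dots> = (\<Sum>i\<le>p. constf (real (p choose i)) * (\<Sum>j\<le>q. constf (real (q choose j)) * (EE i (Suc j) g * EE (p - i) (q - j) h + EE i j g * EE (p - i) (Suc (q - j)) h)))"
      unfolding IH using EE_sm[OF g] EE_sm[OF h] g h sm1
      by (simp only: dX_sum sm_mult sm_basic dX_mult dX_constf dX_EE mult_zero_left add_0_left)
    finally have "EE p (Suc q) (g * h) x t = (\<Sum>i\<le>p. real (p choose i) * (\<Sum>j\<le>q. real (q choose j) * (EE i (Suc j) g x t * EE (p - i) (q - j) h x t + EE i j g x t * EE (p - i) (Suc (q - j)) h x t)))"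
      by (simp add: fun_eq_iff)
    also have "\<dots> = (\<Sum>i\<le>p. real (p choose i) * (\<Sum>j\<le>Suc q. real (Suc q choose j) * (EE i j g x t * EE (p - i) (Suc q - j) h x t)))"
      using bin[of q "\<lambda>j k. EE i j g x t * EE (p - i) k h x t" for i] by (simp del: sum.atMost_Suc binomial_Suc_Suc)
    finally show ?case .
  qed
  show ?thesis unfolding X by (simp add: sum_distrib_left mult.assoc)
qed

end

section \<open>Pointwise generating norms for mixed derivatives\<close>

locale point_norm = plane_domain +
  fixes x t s \<epsilon> :: real
  assumes xt: "(x,t) \<in> D" and s: "0 < s" and ep: "0 \<le> \<epsilon>"
begin

text \<open>All derivatives of total order \<open>n\<close> at the fixed point, weighted by
  direction. The value \<open>\<epsilon> = 0\<close> is allowed: as 0^0 = 1, only the pure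
  t-derivative remains, and this is the starting point of the continuity argument.\<close>

definition an :: "(real \<Rightarrow> real \<Rightarrow> real) \<Rightarrow> nat \<Rightarrow> real" where
  "an g n = (\<Sum>p\<le>n. \<bar>EE p (n - p) g x t\<bar> * s ^ p * \<epsilon> ^ (n - p))"

text \<open>The shift k counts derivatives: a product of shifts k and l has shift k + l, and T g has
  shift one more than g.\<close>

definition nu :: "nat \<Rightarrow> nat \<Rightarrow> (real \<Rightarrow> real \<Rightarrow> real) \<Rightarrow> real" where
  "nu k M g = (\<Sum>n\<le>M. an g n / fact (n + k))"

lemma an_nonneg: "0 \<le> an g n"
  unfolding an_def using s ep by (intro sum_nonneg mult_nonneg_nonneg) auto

lemma nu_nonneg: "0 \<le> nu k M g"
  unfolding nu_def by (intro sum_nonneg divide_nonneg_nonneg an_nonneg) auto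

lemma an_add: "g \<in> sm \<Longrightarrow> h \<in> sm \<Longrightarrow> an (g + h) n \<le> an g n + an h n"
  unfolding an_def sum.distrib[symmetric]
  by (intro sum_mono) (use s ep in \<open>simp add: EE_add distrib_right[symmetric] mult_right_mono abs_triangle_ineq\<close>)

lemma nu_add: "g \<in> sm \<Longrightarrow> h \<in> sm \<Longrightarrow> nu k M (g + h) \<le> nu k M g + nu k M h"
  unfolding nu_def sum.distrib[symmetric] add_divide_distrib[symmetric]
  by (intro sum_mono divide_right_mono an_add) auto

text \<open>The product of binomials in the two-variable Leibniz rule is at most the binomial of the
  total orders, so grouping by the total order k of the first factor leaves a one-variable Leibniz
  rule.\<close>

lemma an_mult:
  assumes g: "g \<in> sm" and h: "h \<in> sm"
  shows "an (g * h) n \<le> (\<Sum>k\<le>n. real (n choose k) * (an g k * an h (n - k)))"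
proof -
  define A where "A i j = \<bar>EE i j g x t\<bar> * s ^ i * \<epsilon> ^ j" for i j
  define B where "B i j = \<bar>EE i j h x t\<bar> * s ^ i * \<epsilon> ^ j" for i j
  have pos: "0 \<le> A i j" "0 \<le> B i j" for i j using s ep by (auto simp: A_def B_def)
  have "an (g * h) n \<le> (\<Sum>p\<le>n. \<Sum>i\<le>p. \<Sum>j\<le>n - p. real (n choose (i + j)) * (A i j * B (p - i) (n - p - j)))"
    unfolding an_def
  proof (rule sum_mono)
    fix p assume p: "p \<in> {..n}"
    have "\<bar>EE p (n - p) (g * h) x t\<bar> \<le> (\<Sum>i\<le>p. \<bar>\<Sum>j\<le>n - p. real (p choose i) * real ((n - p) choose j) * (EE i j g x t * EE (p - i) (n - p - j) h x t)\<bar>)"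
      unfolding EE_mult[OF g h] by (rule sum_abs)
    also have "\<dots> \<le> (\<Sum>i\<le>p. \<Sum>j\<le>n - p. \<bar>real (p choose i) * real ((n - p) choose j) * (EE i j g x t * EE (p - i) (n - p - j) h x t)\<bar>)"
      by (intro sum_mono sum_abs)
    finally have "\<bar>EE p (n - p) (g * h) x t\<bar> * (s ^ p * \<epsilon> ^ (n - p))
       \<le> (\<Sum>i\<le>p. \<Sum>j\<le>n - p. \<bar>real (p choose i) * real ((n - p) choose j) * (EE i j g x t * EE (p - i) (n - p - j) h x t)\<bar>) * (s ^ p * \<epsilon> ^ (n - p))"
      using s ep by (intro mult_right_mono) auto
    also have "\<dots> = (\<Sum>i\<le>p. \<Sum>j\<le>n - p. \<bar>real (p choose i) * real ((n - p) choose j) * (EE i j g x t * EE (p - i) (n - p - j) h x t)\<bar> * (s ^ p * \<epsilon> ^ (n - p)))"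
      by (simp only: sum_distrib_right)
    also have "\<dots> \<le> (\<Sum>i\<le>p. \<Sum>j\<le>n - p. real (n choose (i + j)) * (A i j * B (p - i) (n - p - j)))"
    proof (intro sum_mono)
      fix i j assume i: "i \<in> {..p}" and j: "j \<in> {..n - p}"
      have e: "s ^ p = s ^ i * s ^ (p - i)" "\<epsilon> ^ (n - p) = \<epsilon> ^ j * \<epsilon> ^ (n - p - j)"
      proof -
        have "i + (p - i) = p" "j + (n - p - j) = n - p" using i j by auto
        then show "s ^ p = s ^ i * s ^ (p - i)" "\<epsilon> ^ (n - p) = \<epsilon> ^ j * \<epsilon> ^ (n - p - j)" by (metis power_add)+
      qed
      have "\<bar>real (p choose i) * real ((n - p) choose j) * (EE i j g x t * EE (p - i) (n - p - j) h x t)\<bar> * (s ^ p * \<epsilon> ^ (n - p))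
          = real ((p choose i) * ((n - p) choose j)) * (A i j * B (p - i) (n - p - j))"
        unfolding e A_def B_def by (simp add: abs_mult)
      also have "\<dots> \<le> real (n choose (i + j)) * (A i j * B (p - i) (n - p - j))"
      proof (intro mult_right_mono mult_nonneg_nonneg pos)
        have "(p choose i) * ((n - p) choose j) \<le> (p + (n - p)) choose (i + j)"
          using i j by (intro choose_mult_le) auto
        then have "(p choose i) * ((n - p) choose j) \<le> n choose (i + j)" using p by simp
        then show "real ((p choose i) * ((n - p) choose j)) \<le> real (n choose (i + j))" by (simp only: of_nat_le_iff)
      qed
      finally show "\<bar>real (p choose i) * real ((n - p) choose j) * (EE i j g x t * EE (p - i) (n - p - j) h x t)\<bar> * (s ^ p * \<epsilon> ^ (n - p))
          \<le> real (n choose (i + j)) * (A i j * B (p - i) (n - p - j))" .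
    qed
    finally show "\<bar>EE p (n - p) (g * h) x t\<bar> * s ^ p * \<epsilon> ^ (n - p)
       \<le> (\<Sum>i\<le>p. \<Sum>j\<le>n - p. real (n choose (i + j)) * (A i j * B (p - i) (n - p - j)))" by (simp only: mult.assoc)
  qed
  also have "\<dots> = (\<Sum>(p,i,j)\<in>(SIGMA p:{..n}. {..p} \<times> {..n - p}). real (n choose (i + j)) * (A i j * B (p - i) (n - p - j)))"
    by (simp add: sum.Sigma sum.cartesian_product)
  \<comment> \<open>The new index k = i + j is the total order falling on \<open>g\<close>,
    \<open>i\<close> its number of t-derivatives, and l = p - i the number of t-derivatives falling
    on \<open>h\<close>.\<close>
  also have "\<dots> = (\<Sum>(k,i,l)\<in>(SIGMA k:{..n}. {..k} \<times> {..n - k}). real (n choose k) * (A i (k - i) * B l (n - k - l)))"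
  proof (rule sum.reindex_bij_witness[where i = "\<lambda>(k,i,l). (i + l, i, k - i)" and j = "\<lambda>(p,i,j). (i + j, i, p - i)"])
    show "(\<lambda>(k,i,l). (i + l, i, k - i)) z \<in> (SIGMA p:{..n}. {..p} \<times> {..n - p})" if "z \<in> (SIGMA k:{..n}. {..k} \<times> {..n - k})" for z
      using that by auto
    show "(\<lambda>(p,i,j). (i + j, i, p - i)) z \<in> (SIGMA k:{..n}. {..k} \<times> {..n - k})" if "z \<in> (SIGMA p:{..n}. {..p} \<times> {..n - p})" for z
      using that by auto
  qed (auto simp: add.commute)
  also have "\<dots> = (\<Sum>k\<le>n. \<Sum>(i,l)\<in>{..k} \<times> {..n - k}. real (n choose k) * (A i (k - i) * B l (n - k - l)))"
    by (simp add: sum.Sigma)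
  also have "\<dots> = (\<Sum>k\<le>n. real (n choose k) * (an g k * an h (n - k)))"
  proof (rule sum.cong[OF refl])
    fix k
    have "an g k * an h (n - k) = (\<Sum>i\<le>k. A i (k - i)) * (\<Sum>l\<le>n - k. B l (n - k - l))"
      by (simp only: an_def A_def B_def)
    also have "\<dots> = (\<Sum>(i,l)\<in>{..k} \<times> {..n - k}. A i (k - i) * B l (n - k - l))"
      by (simp only: sum_product sum.cartesian_product)
    finally show "(\<Sum>(i,l)\<in>{..k} \<times> {..n - k}. real (n choose k) * (A i (k - i) * B l (n - k - l)))
        = real (n choose k) * (an g k * an h (n - k))"
      by (simp only: sum_distrib_left) (simp add: case_prod_beta)
  qed
  finally show ?thesis .
qed

text \<open>\<open>choose_shift_le\<close> says that enlarging the factorials by the shifts only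
  helps: (n choose i) (i+k)! (n-i+l)! \<le> (n+k+l)!. The powers of 1 in the proof bring the sums
  into the form of \<open>trunc_cauchy\<close>.\<close>

lemma nu_mult:
  assumes g: "g \<in> sm" and h: "h \<in> sm"
  shows "nu (k + l) M (g * h) \<le> nu k M g * nu l M h"
proof -
  have "an (g * h) n / fact (n + (k + l)) \<le> 1 ^ n * (\<Sum>i\<le>n. (an g i / fact (i + k)) * (an h (n - i) / fact (n - i + l)))" for n
  proof -
    have "an (g * h) n / fact (n + (k + l)) \<le> (\<Sum>i\<le>n. real (n choose i) * (an g i * an h (n - i))) / fact (n + (k + l))"
      by (intro divide_right_mono an_mult g h) auto
    also have "\<dots> \<le> (\<Sum>i\<le>n. (an g i / fact (i + k)) * (an h (n - i) / fact (n - i + l)))"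
      unfolding sum_divide_distrib
    proof (rule sum_mono)
      fix i assume "i \<in> {..n}"
      then have i: "i \<le> n" by simp
      have "real (n choose i) \<le> real ((n + k + l) choose (i + k))" using choose_shift_le of_nat_le_iff by blast
      also have "\<dots> = fact (n + k + l) / (fact (i + k) * fact (n - i + l))"
        using i binomial_fact[of "i + k" "n + k + l"] by simp
      finally have "real (n choose i) * (an g i * an h (n - i)) \<le> fact (n + k + l) / (fact (i + k) * fact (n - i + l)) * (an g i * an h (n - i))"
        by (intro mult_right_mono mult_nonneg_nonneg an_nonneg)
      then show "real (n choose i) * (an g i * an h (n - i)) / fact (n + (k + l)) \<le> (an g i / fact (i + k)) * (an h (n - i) / fact (n - i + l))"
        by (simp add: pos_divide_le_eq add.assoc mult_ac)
    qed
    finally show ?thesis by simp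
  qed
  then have "nu (k + l) M (g * h) \<le> (\<Sum>n\<le>M. 1 ^ n * (\<Sum>i\<le>n. (an g i / fact (i + k)) * (an h (n - i) / fact (n - i + l))))"
    unfolding nu_def by (rule sum_mono)
  also have "\<dots> \<le> (\<Sum>n\<le>M. 1 ^ n * (an g n / fact (n + k))) * (\<Sum>n\<le>M. 1 ^ n * (an h n / fact (n + l)))"
    by (rule trunc_cauchy) (auto intro!: divide_nonneg_nonneg an_nonneg)
  finally show ?thesis by (simp add: nu_def)
qed

lemma an_dT: assumes g: "g \<in> sm" shows "s * an (dT g) n \<le> an g (Suc n)"
proof -
  have "s * an (dT g) n = (\<Sum>p\<le>n. \<bar>EE (Suc p) (Suc n - Suc p) g x t\<bar> * s ^ Suc p * \<epsilon> ^ (Suc n - Suc p))"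
    unfolding an_def EE_dT by (simp add: sum_distrib_left mult_ac)
  also have "\<dots> \<le> an g (Suc n)"
    unfolding an_def sum.atMost_Suc_shift[of _ n] using s ep by simp
  finally show ?thesis .
qed

text \<open>(n + k + 1)! is at once the factorial for order n at shift k + 1 and for order n + 1 at
  shift k, so a t-derivative costs 1/s and one more order in the truncation, but no factor growing
  with n.\<close>

lemma nu_dT: assumes g: "g \<in> sm" shows "nu (Suc k) M (dT g) \<le> nu k (Suc M) g / s"
proof -
  have "s * nu (Suc k) M (dT g) \<le> (\<Sum>n\<le>M. an g (Suc n) / fact (Suc n + k))"
    unfolding nu_def sum_distrib_left using an_dT[OF g] by (intro sum_mono) (simp add: divide_right_mono)
  also have "\<dots> \<le> nu k (Suc M) g"
    unfolding nu_def sum.atMost_Suc_shift[of _ M] using an_nonneg by simp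
  finally show ?thesis using s by (simp add: pos_le_divide_eq mult.commute)
qed

lemma nu_mono_M: "M \<le> M' \<Longrightarrow> nu k M g \<le> nu k M' g"
  unfolding nu_def by (intro sum_mono2) (auto intro!: divide_nonneg_nonneg an_nonneg)

lemma nu_mono_k: "k \<le> k' \<Longrightarrow> nu k' M g \<le> nu k M g"
  unfolding nu_def by (intro sum_mono divide_left_mono an_nonneg) (auto intro: fact_mono)

lemma EE_constf: "p + q \<noteq> 0 \<Longrightarrow> EE p q (constf c) = 0"
proof -
  assume pq: "p + q \<noteq> 0"
  have 0: "EE p q 0 = 0" for p q unfolding EE_dw by (rule dw_0)
  show ?thesis
  proof (cases p)
    case (Suc p')
    show ?thesis unfolding Suc EE_dT[symmetric] dT_constf by (rule 0)
  next
    case z: 0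
    then obtain q' where q: "q = Suc q'" using pq by (cases q) auto
    show ?thesis unfolding q EE_dX[OF sm_basic(1), symmetric] dX_constf by (rule 0)
  qed
qed

lemma nu_constf: "nu k M (constf c) \<le> \<bar>c\<bar>"
proof -
  have "an (constf c) n = 0" if "n \<noteq> 0" for n
    unfolding an_def using that by (intro sum.neutral) (auto simp: EE_constf)
  then have "nu k M (constf c) = (\<Sum>n\<in>{0}. an (constf c) n / fact (n + k))"
    unfolding nu_def by (intro sum.mono_neutral_right) auto
  also have "\<dots> = \<bar>c\<bar> / fact k" by (simp add: an_def EE_def)
  also have "\<dots> \<le> \<bar>c\<bar>" by (simp add: pos_divide_le_eq mult_left_mono[of 1 "fact k" "\<bar>c\<bar>", simplified])
  finally show ?thesis .
qed

lemma good_norm_nu: "good_norm (nu 0 M)"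
  unfolding good_norm_def
proof (intro conjI ballI allI)
  show "nu 0 M (g + h) \<le> nu 0 M g + nu 0 M h" if "g \<in> sm" "h \<in> sm" for g h by (rule nu_add[OF that])
  show "nu 0 M (g * h) \<le> nu 0 M g * nu 0 M h" if "g \<in> sm" "h \<in> sm" for g h
    using nu_mult[OF that, of 0 0] by simp
  show "nu 0 M (constf c) \<le> \<bar>c\<bar>" for c by (rule nu_constf)
  define C where "C = (\<Sum>n\<le>M. (\<Sum>p\<le>n. s ^ p * \<epsilon> ^ (n - p)) / fact (n + 0))"
  have "nu 0 M g \<le> C * B" if "g \<in> sm" and B: "\<forall>bs x t. length bs \<le> M \<longrightarrow> (x,t) \<in> D \<longrightarrow> \<bar>dw bs g x t\<bar> \<le> B" for g B
  proof -
    have "an g n \<le> (\<Sum>p\<le>n. s ^ p * \<epsilon> ^ (n - p)) * B" if "n \<le> M" for n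
      unfolding an_def sum_distrib_right
    proof (rule sum_mono)
      fix p assume "p \<in> {..n}"
      then have "\<bar>EE p (n - p) g x t\<bar> \<le> B" unfolding EE_dw using B xt that by simp
      then have "\<bar>EE p (n - p) g x t\<bar> * (s ^ p * \<epsilon> ^ (n - p)) \<le> B * (s ^ p * \<epsilon> ^ (n - p))"
        using s ep by (intro mult_right_mono) auto
      then show "\<bar>EE p (n - p) g x t\<bar> * s ^ p * \<epsilon> ^ (n - p) \<le> s ^ p * \<epsilon> ^ (n - p) * B" by (simp add: mult_ac)
    qed
    then have "nu 0 M g \<le> (\<Sum>n\<le>M. ((\<Sum>p\<le>n. s ^ p * \<epsilon> ^ (n - p)) * B) / fact (n + 0))"
      unfolding nu_def by (intro sum_mono divide_right_mono) auto
    then show ?thesis by (simp add: C_def sum_distrib_right)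
  qed
  moreover have "0 \<le> C" unfolding C_def using s ep by (intro sum_nonneg divide_nonneg_nonneg mult_nonneg_nonneg) auto
  ultimately show "\<exists>k C. 0 \<le> C \<and> (\<forall>g\<in>sm. \<forall>B. (\<forall>bs x t. length bs \<le> k \<longrightarrow> (x, t) \<in> D \<longrightarrow> \<bar>dw bs g x t\<bar> \<le> B) \<longrightarrow> nu 0 M g \<le> C * B)"
    by blast
qed (rule nu_nonneg)

end

text \<open>Two applications of the mean value theorem: some slope in the interval is at most 2A/l,
  and the derivative varies by at most lB. It is used since the equation yields the second
  x-derivatives, while the first ones appear in no other estimate.\<close>

lemma deriv_interpolation:
  fixes g g' g'' :: "real \<Rightarrow> real"
  assumes l: "0 < l" and g: "\<And>y. x \<le> y \<Longrightarrow> y \<le> x + l \<Longrightarrow> (g has_real_derivative g' y) (at y)"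
    and g': "\<And>y. x \<le> y \<Longrightarrow> y \<le> x + l \<Longrightarrow> (g' has_real_derivative g'' y) (at y)"
    and A: "\<And>y. x \<le> y \<Longrightarrow> y \<le> x + l \<Longrightarrow> \<bar>g y\<bar> \<le> A" and B: "\<And>y. x \<le> y \<Longrightarrow> y \<le> x + l \<Longrightarrow> \<bar>g'' y\<bar> \<le> B"
  shows "\<bar>g' x\<bar> \<le> 2 * A / l + l * B"
proof -
  obtain z where z: "x < z" "z < x + l" "g (x + l) - g x = (x + l - x) * g' z"
    using MVT2[of x "x + l" g g'] l g by auto
  have "\<bar>l * g' z\<bar> \<le> 2 * A" using z(3) A[of x] A[of "x + l"] l by simp
  then have gz: "\<bar>g' z\<bar> \<le> 2 * A / l" using l by (simp add: abs_mult pos_le_divide_eq mult.commute)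
  obtain y where y: "x < y" "y < z" "g' z - g' x = (z - x) * g'' y"
    using MVT2[of x z g' g''] z g' by auto
  have "\<bar>(z - x) * g'' y\<bar> \<le> l * B"
    unfolding abs_mult using z y B[of y] by (intro mult_mono) auto
  then show ?thesis using gz y(3) by linarith
qed

context point_norm begin

lemma nu_cong: "(\<And>x t. (x,t) \<in> D \<Longrightarrow> g x t = h x t) \<Longrightarrow> nu k M g = nu k M h"
proof -
  assume "\<And>x t. (x,t) \<in> D \<Longrightarrow> g x t = h x t"
  then have "EE p q g x t = EE p q h x t" for p q using EE_cong xt by blast
  then show ?thesis unfolding nu_def an_def by simp
qed

lemma nu_scale: "g \<in> sm \<Longrightarrow> h \<in> sm \<Longrightarrow> nu k M (g * h) \<le> nu 0 M g * nu k M h"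
  using nu_mult[of g h 0 k M] by simp

lemma nu_neg: assumes "g \<in> sm" shows "nu k M (- g) \<le> nu k M g"
proof -
  have "nu k M (constf (-1) * g) \<le> nu 0 M (constf (-1)) * nu k M g" by (intro nu_scale sm_basic assms)
  also have "\<dots> \<le> 1 * nu k M g" using nu_constf[of 0 M "-1"] by (intro mult_right_mono nu_nonneg) simp
  finally show ?thesis unfolding uminus_constf[of g, symmetric] by simp
qed

lemma EE_0: "EE p q 0 = 0"
  unfolding EE_dw by (rule dw_0)

lemma an_fx: "nu 0 M (fx - constf a) \<le> \<bar>x - a\<bar> + \<epsilon>"
proof -
  let ?g = "fx - constf a"
  have T: "EE (Suc p) q ?g = 0" for p q
  proof -
    have "dT ?g = 0" by simp
    then show ?thesis unfolding EE_dT[symmetric] using EE_0 by simp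
  qed
  have X: "EE 0 (Suc q) ?g x t = EE 0 q (constf 1) x t" for q
    unfolding EE_dX[OF sm_minus[OF sm_basic(2) sm_basic(1)], symmetric]
    by (rule EE_cong[OF _ xt]) (simp add: dX_fx)
  have 0: "an ?g 0 = \<bar>x - a\<bar>" by (simp add: an_def EE_def)
  have 1: "an ?g (Suc 0) = \<epsilon>" using X[of 0] by (simp add: an_def T EE_def[of 0 0])
  have 2: "an ?g (Suc (Suc n)) = 0" for n
    unfolding an_def
  proof (rule sum.neutral, rule ballI)
    fix p assume "p \<in> {..Suc (Suc n)}"
    show "\<bar>EE p (Suc (Suc n) - p) ?g x t\<bar> * s ^ p * \<epsilon> ^ (Suc (Suc n) - p) = 0"
      by (cases p) (simp_all add: T X EE_constf del: constf_1)
  qed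
  have "nu 0 M ?g \<le> nu 0 (Suc (Suc M)) ?g" by (rule nu_mono_M) simp
  also have "\<dots> = \<bar>x - a\<bar> + \<epsilon>"
    unfolding nu_def sum.atMost_Suc_shift 0 1 2 by simp
  finally show ?thesis .
qed

lemma an_ft: "nu 0 M (ft - constf a) \<le> \<bar>t - a\<bar> + s"
proof -
  let ?g = "ft - constf a"
  have X: "EE p (Suc q) ?g = 0" for p q
  proof -
    have "dX ?g = 0" by simp
    then show ?thesis unfolding EE_dX[OF sm_minus[OF sm_basic(3) sm_basic(1)], symmetric] using EE_0 by simp
  qed
  have T: "EE (Suc p) 0 ?g x t = EE p 0 (constf 1) x t" for p
    unfolding EE_dT[symmetric] by (rule EE_cong[OF _ xt]) (simp add: dT_ft)
  have 0: "an ?g 0 = \<bar>t - a\<bar>" by (simp add: an_def EE_def)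
  have 1: "an ?g (Suc 0) = s" using T[of 0] s by (simp add: an_def X EE_def[of 0 0])
  have 2: "an ?g (Suc (Suc n)) = 0" for n
    unfolding an_def
  proof (rule sum.neutral, rule ballI)
    fix p assume p: "p \<in> {..Suc (Suc n)}"
    show "\<bar>EE p (Suc (Suc n) - p) ?g x t\<bar> * s ^ p * \<epsilon> ^ (Suc (Suc n) - p) = 0"
    proof (cases "p = Suc (Suc n)")
      case True
      then show ?thesis by (simp add: T EE_constf del: constf_1)
    next
      case False
      then obtain q where "Suc (Suc n) - p = Suc q" using p by (cases "Suc (Suc n) - p") auto
      then show ?thesis by (simp add: X)
    qed
  qed
  have "nu 0 M ?g \<le> nu 0 (Suc (Suc M)) ?g" by (rule nu_mono_M) simp
  also have "\<dots> = \<bar>t - a\<bar> + s"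
    unfolding nu_def sum.atMost_Suc_shift 0 1 2 by simp
  finally show ?thesis .
qed

text \<open>Separates the derivatives with no or one X, which the equation does not reach, from
  those containing X^2; the latter come with \<epsilon>^2.\<close>

lemma an_split:
  assumes g: "g \<in> sm"
  shows "an g (Suc m) = \<bar>EE (Suc m) 0 g x t\<bar> * s ^ Suc m + \<bar>EE m 1 g x t\<bar> * s ^ m * \<epsilon>
     + (case m of 0 \<Rightarrow> 0 | Suc k \<Rightarrow> \<epsilon>\<^sup>2 * an (dX (dX g)) k)"
proof (cases m)
  case 0
  then show ?thesis by (simp add: an_def)
next
  case (Suc k)
  have "(\<Sum>p\<le>k. \<bar>EE p (Suc m - p) g x t\<bar> * s ^ p * \<epsilon> ^ (Suc m - p)) = \<epsilon>\<^sup>2 * an (dX (dX g)) k"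
    unfolding an_def sum_distrib_left
  proof (rule sum.cong[OF refl])
    fix p assume "p \<in> {..k}"
    then have e: "Suc m - p = Suc (Suc (k - p))" using Suc by auto
    show "\<bar>EE p (Suc m - p) g x t\<bar> * s ^ p * \<epsilon> ^ (Suc m - p) = \<epsilon>\<^sup>2 * (\<bar>EE p (k - p) (dX (dX g)) x t\<bar> * s ^ p * \<epsilon> ^ (k - p))"
      unfolding e EE_dX[OF dX_sm[OF g]] EE_dX[OF g] by (simp add: power2_eq_square)
  qed
  then show ?thesis using Suc by (simp add: an_def)
qed

lemma an_const_diff: assumes g: "g \<in> sm" shows "an (g - constf c) (Suc n) = an g (Suc n)"
proof -
  have "EE p (Suc n - p) (g - constf c) = EE p (Suc n - p) g" if "p \<le> Suc n" for p
  proof -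
    have "EE p (Suc n - p) (g - constf c) = EE p (Suc n - p) g - EE p (Suc n - p) (constf c)"
      unfolding EE_dw using g by (intro dw_minus sm_basic)
    also have "EE p (Suc n - p) (constf c) = 0" using that by (intro EE_constf) auto
    finally show ?thesis by (simp only: diff_zero)
  qed
  then show ?thesis unfolding an_def by simp
qed

end

section \<open>The x-derivatives from the equation\<close>

locale pde_point = pde_square + point_norm
begin

text \<open>Built from the data of the equation alone and independent of the point, of
  \<open>s\<close> and of \<open>\<epsilon>\<close>, so that interpretations at different points
  share the same constant.\<close>

definition Gam :: real where
  "Gam = (\<bar>f0\<bar> + LL * (e/2)) + ((\<bar>x0\<bar> + e/2) ^ r)\<^sup>2 * ((\<bar>w0\<bar> + e/2) * (1 + (\<bar>c0\<bar> + LL * (e/2))\<^sup>2))"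

text \<open>Since T m = 0, the equation reads X X u = -f - m^2 (T T u + H T (H T u)). Each of the
  two T costs 1/s, raises the shift by one and uses one more order, which explains shift 2 on the
  left and \<open>Suc (Suc M)\<close> in the premises; all factors are bounded as long as u - w0
  stays within \<open>e/2\<close>.\<close>

lemma G_bound:
  assumes s1: "s \<le> 1" and nx: "nu 0 (Suc (Suc M)) (fx - constf x0) \<le> e/2" and nt: "nu 0 (Suc (Suc M)) (ft - constf t0) \<le> e/2"
    and nu: "nu 0 (Suc (Suc M)) (u - constf w0) \<le> e/2"
  shows "nu 2 M (dX (dX u)) \<le> Gam / s\<^sup>2"
proof -
  let ?N = "Suc (Suc M)"
  have e0: "0 < e" by (rule e_pos)
  have add: "nu 0 ?N g \<le> \<bar>z\<bar> + B" if "g \<in> sm" "nu 0 ?N (g - constf z) \<le> B" for g z B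
  proof -
    have "nu 0 ?N ((g - constf z) + constf z) \<le> nu 0 ?N (g - constf z) + nu 0 ?N (constf z)"
      by (intro nu_add sm_minus sm_basic that)
    then show ?thesis using that(2) nu_constf[of 0 ?N z] by simp
  qed
  have H: "nu 0 ?N HH \<le> \<bar>c0\<bar> + LL * (e/2)"
    by (rule add[OF HH_sm HH_bound(1)[OF good_norm_nu, OF nx nt nu order_refl]])
  have F: "nu 0 ?N f \<le> \<bar>f0\<bar> + LL * (e/2)"
    by (rule add[OF f_sm HH_bound(2)[OF good_norm_nu, OF nx nt nu order_refl]])
  have U: "nu 0 ?N u \<le> \<bar>w0\<bar> + e/2" by (rule add[OF u_sm nu])
  have Xb: "nu 0 ?N fx \<le> \<bar>x0\<bar> + e/2" by (rule add[OF sm_basic(2) nx])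
  have mb: "nu 0 M mm \<le> (\<bar>x0\<bar> + e/2) ^ r"
    using good_norm_power[OF good_norm_nu, OF sm_basic(2), OF Xb, of r] nu_mono_M[of M ?N 0 mm] unfolding mm_def by simp
  have Hb: "nu 0 M HH \<le> \<bar>c0\<bar> + LL * (e/2)" "nu 0 (Suc M) HH \<le> \<bar>c0\<bar> + LL * (e/2)"
    using H nu_mono_M[of M ?N 0 HH] nu_mono_M[of "Suc M" ?N 0 HH] by simp_all
  define hb where "hb = \<bar>c0\<bar> + LL * (e/2)"
  have hb0: "0 \<le> hb" unfolding hb_def using LL_nonneg e0 by simp
  define W where "W = \<bar>w0\<bar> + e/2"
  have W0: "0 \<le> W" unfolding W_def using e0 by simp
  note sms = u_sm HH_sm mm_sm dT_sm dX_sm sm_mult sm_add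
  have t1: "nu 1 (Suc M) (dT u) \<le> W / s"
    using nu_dT[OF u_sm, of 0 "Suc M"] divide_right_mono[OF U, of s] s unfolding W_def by simp
  have t2: "nu 2 M (dT (dT u)) \<le> W / s\<^sup>2"
    using nu_dT[OF dT_sm[OF u_sm], of 1 M] divide_right_mono[OF t1, of s] s
    by (simp add: power2_eq_square numeral_2_eq_2[symmetric] One_nat_def[symmetric] del: One_nat_def)
  have t3: "nu 2 M (HH * dT (HH * dT u)) \<le> hb\<^sup>2 * (W / s\<^sup>2)"
  proof -
    have "nu 1 (Suc M) (HH * dT u) \<le> nu 0 (Suc M) HH * nu 1 (Suc M) (dT u)" by (intro nu_scale sms)
    also have "\<dots> \<le> hb * (W / s)" using Hb(2) t1 hb0 unfolding hb_def[symmetric] by (intro mult_mono nu_nonneg)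
    finally have a: "nu 1 (Suc M) (HH * dT u) \<le> hb * (W / s)" .
    have "nu 2 M (dT (HH * dT u)) \<le> nu 1 (Suc M) (HH * dT u) / s"
      using nu_dT[of "HH * dT u" 1 M] sms by (simp add: numeral_2_eq_2)
    also have "\<dots> \<le> hb * (W / s) / s" using a s by (intro divide_right_mono) auto
    finally have b: "nu 2 M (dT (HH * dT u)) \<le> hb * (W / s) / s" .
    have "nu 2 M (HH * dT (HH * dT u)) \<le> nu 0 M HH * nu 2 M (dT (HH * dT u))" by (intro nu_scale sms)
    also have "\<dots> \<le> hb * (hb * (W / s) / s)" using Hb(1) b hb0 unfolding hb_def[symmetric] by (intro mult_mono nu_nonneg)
    finally show ?thesis by (simp add: power2_eq_square)
  qed
  define Z where "Z = dT (dT u) + HH * dT (HH * dT u)"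
  have Zsm: "Z \<in> sm" unfolding Z_def by (intro sms)
  have "nu 2 M Z \<le> W / s\<^sup>2 + hb\<^sup>2 * (W / s\<^sup>2)"
    unfolding Z_def using nu_add[of "dT (dT u)" "HH * dT (HH * dT u)" 2 M] t2 t3 sms by (smt (verit))
  then have Zb: "nu 2 M Z \<le> W * (1 + hb\<^sup>2) / s\<^sup>2" by (simp add: algebra_simps add_divide_distrib)
  have eq: "dX (dX u) = - FF + - (mm * (mm * Z))"
  proof -
    have e1: "dT (mm * dT u) = mm * dT (dT u)"
      using sms by (simp only: dT_mult dT_mm mult_zero_left add_0_left)
    have e2: "dT (mm * HH * dT u) = mm * dT (HH * dT u)"
      unfolding mult.assoc using sms by (simp only: dT_mult[of mm "HH * dT u"] dT_mm mult_zero_left add_0_left)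
    have "dX (dX u) + mm * (mm * dT (dT u)) + mm * HH * (mm * dT (HH * dT u)) = - FF"
      using pde_raw unfolding e1 e2 .
    then have "dX (dX u) + (mm * (mm * dT (dT u)) + mm * HH * (mm * dT (HH * dT u))) = - FF"
      by (simp only: add.assoc)
    then have "dX (dX u) = - FF - (mm * (mm * dT (dT u)) + mm * HH * (mm * dT (HH * dT u)))"
      by (simp only: eq_diff_eq)
    also have "mm * (mm * dT (dT u)) + mm * HH * (mm * dT (HH * dT u)) = mm * (mm * Z)"
      unfolding Z_def by (simp only: distrib_left mult_ac)
    finally show ?thesis by (simp only: diff_conv_add_uminus)
  qed
  have F2: "nu 2 M (- FF) \<le> (\<bar>f0\<bar> + LL * (e/2)) / s\<^sup>2"
  proof -
    have "nu 2 M (- FF) \<le> nu 2 M FF" by (rule nu_neg[OF FF_sm])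
    also have "\<dots> = nu 2 M f" by (rule nu_cong) (simp add: FF_def)
    also have "\<dots> \<le> nu 0 M f" by (rule nu_mono_k) simp
    also have "\<dots> \<le> nu 0 ?N f" by (rule nu_mono_M) simp
    also have "\<dots> \<le> \<bar>f0\<bar> + LL * (e/2)" by (rule F)
    also have "\<dots> \<le> (\<bar>f0\<bar> + LL * (e/2)) / s\<^sup>2"
      using s s1 LL_nonneg e0 by (simp add: pos_le_divide_eq mult_left_le power_le_one)
    finally show ?thesis .
  qed
  have mmZ: "nu 2 M (- (mm * (mm * Z))) \<le> ((\<bar>x0\<bar> + e/2) ^ r)\<^sup>2 * (W * (1 + hb\<^sup>2) / s\<^sup>2)"
  proof -
    define q where "q = (\<bar>x0\<bar> + e/2) ^ r"
    have q0: "0 \<le> q" unfolding q_def using e0 by simp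
    have "nu 2 M (- (mm * (mm * Z))) \<le> nu 2 M (mm * (mm * Z))" by (intro nu_neg sms Zsm)
    also have "\<dots> \<le> nu 0 M mm * nu 2 M (mm * Z)" by (intro nu_scale sms Zsm)
    also have "\<dots> \<le> q * (q * (W * (1 + hb\<^sup>2) / s\<^sup>2))"
    proof (intro mult_mono nu_nonneg q0)
      show "nu 0 M mm \<le> q" using mb unfolding q_def .
      have "nu 2 M (mm * Z) \<le> nu 0 M mm * nu 2 M Z" by (intro nu_scale sms Zsm)
      also have "\<dots> \<le> q * (W * (1 + hb\<^sup>2) / s\<^sup>2)" using mb Zb q0 unfolding q_def by (intro mult_mono nu_nonneg)
      finally show "nu 2 M (mm * Z) \<le> q * (W * (1 + hb\<^sup>2) / s\<^sup>2)" .
    qed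
    finally show ?thesis by (simp add: q_def power2_eq_square)
  qed
  have "nu 2 M (dX (dX u)) \<le> nu 2 M (- FF) + nu 2 M (- (mm * (mm * Z)))"
    unfolding eq by (intro nu_add sm_uminus FF_sm sms Zsm)
  also have "\<dots> \<le> Gam / s\<^sup>2"
    using F2 mmZ unfolding Gam_def hb_def W_def by (simp add: add_divide_distrib)
  finally show ?thesis .
qed

end

lemma geometric_le:
  fixes z :: real
  assumes "0 \<le> z" "z \<le> 1/2"
  shows "(\<Sum>m<M. z ^ m) \<le> 2" and "(\<Sum>m<M. z ^ Suc m) \<le> 2 * z"
proof -
  have "(\<Sum>m<M. z ^ m) \<le> 1 / (1 - z)"
    using sum_le_suminf[of "\<lambda>m. z ^ m" "{..<M}"] assms suminf_geometric[of z] by (simp add: summable_geometric)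
  also have "\<dots> \<le> 2" using assms by (simp add: field_simps)
  finally show *: "(\<Sum>m<M. z ^ m) \<le> 2" .
  have "(\<Sum>m<M. z ^ Suc m) = z * (\<Sum>m<M. z ^ m)" by (simp add: sum_distrib_left)
  also have "\<dots> \<le> z * 2" by (rule mult_left_mono[OF * assms(1)])
  finally show "(\<Sum>m<M. z ^ Suc m) \<le> 2 * z" by simp
qed

lemma le_two_power: "real (m + 2) \<le> 2 * 2 ^ m"
  by (induction m) auto

context pde_square begin

lemma nearD: "(x,t) \<in> D \<Longrightarrow> \<bar>x - x0\<bar> \<le> e/4" "(x,t) \<in> D \<Longrightarrow> \<bar>t - t0\<bar> \<le> e/4" "(x,t) \<in> D \<Longrightarrow> \<bar>u x t - w0\<bar> \<le> e/4"
  using near by blast+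

lemma pde_pointI: "(x,t) \<in> D \<Longrightarrow> 0 < s \<Longrightarrow> 0 \<le> \<epsilon> \<Longrightarrow> pde_point D r x0 t0 w0 e f0 c0 ch cf h u f R x t s \<epsilon>"
  by (intro pde_point.intro pde_square_axioms point_norm.intro plane_domain_axioms point_norm_axioms.intro)

lemma inD: "\<delta> \<le> R \<Longrightarrow> \<bar>x - x0\<bar> < \<delta> \<Longrightarrow> \<bar>t - t0\<bar> < \<delta> \<Longrightarrow> (x,t) \<in> D"
  unfolding D_eq by (auto simp: abs_less_iff)

text \<open>With \<epsilon> = 0 the norm of u - w0 involves only t-derivatives, which are under
  control, so \<open>G_bound\<close> applies at once and bounds X^2 T^p u. Interpolation between T^p
  u and X^2 T^p u then gives X T^p u.\<close>

lemma EE_X_bound: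
  "\<exists>\<delta> C K A. 0 < \<delta> \<and> \<delta> \<le> R \<and> 0 < C \<and> 0 < K \<and> 0 \<le> A \<and> (\<forall>x t p. \<bar>x - x0\<bar> < \<delta> \<longrightarrow> \<bar>t - t0\<bar> < \<delta> \<longrightarrow>
     \<bar>EE p 0 u x t\<bar> \<le> C * K ^ p * fact p \<and> \<bar>EE p 1 u x t\<bar> \<le> A * K ^ p * fact (p + 2))"
proof -
  obtain \<delta> C K where d: "0 < \<delta>" "\<delta> \<le> R" and CK: "0 < C" "0 < K"
    and bound: "\<And>x t p. \<bar>x - x0\<bar> < \<delta> \<Longrightarrow> \<bar>t - t0\<bar> < \<delta> \<Longrightarrow> \<bar>(dT ^^ p) u x t\<bar> \<le> C * K ^ p * fact p"
    using dTn_bound by metis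
  have EE0: "EE p 0 u = (dT ^^ p) u" for p by (simp add: EE_def)
  have e0: "0 < e" by (rule e_pos)
  define s where "s = min (min 1 (e / 4)) (min (1 / (2 * K)) (e / (8 * C * K)))"
  have s: "0 < s" "s \<le> 1" "s \<le> e/4" "K * s \<le> 1/2" "2 * C * (K * s) \<le> e/4"
  proof -
    show "0 < s" "s \<le> 1" "s \<le> e/4" using CK e0 by (auto simp: s_def)
    have "s \<le> 1 / (2 * K)" by (simp add: s_def)
    then show "K * s \<le> 1/2" using CK by (simp add: pos_le_divide_eq mult_ac)
    have "s \<le> e / (8 * C * K)" by (simp add: s_def)
    then show "2 * C * (K * s) \<le> e/4" using CK by (simp add: pos_le_divide_eq mult_ac)
  qed
  obtain \<Gamma> where XX: "\<And>x t p. \<bar>x - x0\<bar> < \<delta> \<Longrightarrow> \<bar>t - t0\<bar> < \<delta> \<Longrightarrow> \<bar>EE p 2 u x t\<bar> \<le> \<Gamma> * (1 / s) ^ p * fact (p + 2)"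
  proof -
    \<comment> \<open>Interpreted at the center only to name the constant \<open>Gam\<close> before
      the point varies.\<close>
    interpret c: pde_point D r x0 t0 w0 e f0 c0 ch cf h u f R x0 t0 s 0
      by (rule pde_pointI) (use center s in auto)
    have "\<bar>EE p 2 u x t\<bar> \<le> c.Gam / s\<^sup>2 * (1 / s) ^ p * fact (p + 2)" if "\<bar>x - x0\<bar> < \<delta>" "\<bar>t - t0\<bar> < \<delta>" for x t p
    proof -
      have xt: "(x,t) \<in> D" using inD d that by blast
      interpret q: pde_point D r x0 t0 w0 e f0 c0 ch cf h u f R x t s 0
        by (rule pde_pointI) (use xt s in auto)
      have "q.nu 0 N (u - constf w0) \<le> e/2" for N
      proof -
        have sm0: "u - constf w0 \<in> sm" by (intro sm_minus u_sm sm_basic)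
        have "q.an (u - constf w0) (Suc n) \<le> C * (K * s) ^ Suc n * fact (Suc n)" for n
        proof -
          have "q.an (u - constf w0) (Suc n) = \<bar>(dT ^^ Suc n) u x t\<bar> * s ^ Suc n"
            unfolding q.an_const_diff[OF u_sm] q.an_split[OF u_sm] EE0 by (simp split: nat.split)
          also have "\<dots> \<le> C * K ^ Suc n * fact (Suc n) * s ^ Suc n"
            using bound[OF that, of "Suc n"] s by (intro mult_right_mono) auto
          finally show ?thesis by (simp only: power_mult_distrib mult_ac)
        qed
        then have "q.an (u - constf w0) (Suc n) / fact (Suc n) \<le> C * (K * s) ^ Suc n" for n
          by (simp add: pos_divide_le_eq del: power_Suc fact_Suc)
        then have "(\<Sum>n<N. q.an (u - constf w0) (Suc n) / fact (Suc n)) \<le> (\<Sum>n<N. C * (K * s) ^ Suc n)"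
          by (rule sum_mono)
        also have "\<dots> \<le> C * (2 * (K * s))"
          unfolding sum_distrib_left[symmetric] using CK s by (intro mult_left_mono geometric_le) auto
        finally have "(\<Sum>n<N. q.an (u - constf w0) (Suc n) / fact (Suc n)) \<le> e/4" using s(5) by simp
        moreover have "q.an (u - constf w0) 0 \<le> e/4" using nearD(3)[OF xt] by (simp add: q.an_def EE_def)
        ultimately show ?thesis unfolding q.nu_def sum.atMost_shift by (simp del: fact_Suc)
      qed
      moreover have "q.nu 0 N (fx - constf x0) \<le> e/2" for N
        using q.an_fx[of N x0] nearD(1)[OF xt] e0 by linarith
      moreover have "q.nu 0 N (ft - constf t0) \<le> e/2" for N
        using q.an_ft[of N t0] nearD(2)[OF xt] s by linarith
      ultimately have G: "q.nu 2 p (dX (dX u)) \<le> q.Gam / s\<^sup>2" by (intro q.G_bound s)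
      have "\<bar>EE p 0 (dX (dX u)) x t\<bar> * s ^ p \<le> q.an (dX (dX u)) p"
      proof -
        have "\<bar>EE p (p - p) (dX (dX u)) x t\<bar> * s ^ p * 0 ^ (p - p) \<le> q.an (dX (dX u)) p"
          unfolding q.an_def by (rule member_le_sum) (use s in auto)
        then show ?thesis by simp
      qed
      moreover have "q.an (dX (dX u)) p / fact (p + 2) \<le> q.nu 2 p (dX (dX u))"
        unfolding q.nu_def by (rule member_le_sum) (auto intro!: divide_nonneg_nonneg q.an_nonneg)
      moreover from this G have "q.an (dX (dX u)) p / fact (p + 2) \<le> q.Gam / s\<^sup>2" by linarith
      then have "q.an (dX (dX u)) p \<le> q.Gam / s\<^sup>2 * fact (p + 2)" by (simp only: pos_divide_le_eq[OF fact_gt_zero])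
      ultimately have "\<bar>EE p 0 (dX (dX u)) x t\<bar> * s ^ p \<le> q.Gam / s\<^sup>2 * fact (p + 2)" by linarith
      then have "\<bar>EE p 0 (dX (dX u)) x t\<bar> \<le> q.Gam / s\<^sup>2 * fact (p + 2) / s ^ p"
        by (intro iffD2[OF pos_le_divide_eq[OF zero_less_power[OF s(1)]]])
      moreover have "EE p 0 (dX (dX u)) = EE p 2 u"
        unfolding EE_dX[OF dX_sm[OF u_sm]] EE_dX[OF u_sm] by (simp add: numeral_2_eq_2)
      moreover have "q.Gam = c.Gam" unfolding q.Gam_def c.Gam_def ..
      ultimately show ?thesis by (simp add: power_one_over mult_ac)
    qed
    then show ?thesis using that by blast
  qed
  define \<Gamma>' where "\<Gamma>' = \<bar>\<Gamma>\<bar>"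
  define K' where "K' = max K (1 / s)"
  have K': "0 < K'" "K \<le> K'" "1 / s \<le> K'" using CK by (auto simp: K'_def)
  have XX': "\<bar>EE p 2 u x t\<bar> \<le> \<Gamma>' * K' ^ p * fact (p + 2)" if "\<bar>x - x0\<bar> < \<delta>" "\<bar>t - t0\<bar> < \<delta>" for x t p
  proof -
    have "\<Gamma> * (1 / s) ^ p * fact (p + 2) \<le> \<Gamma>' * K' ^ p * fact (p + 2)"
      unfolding \<Gamma>'_def using K' s by (intro mult_right_mono mult_mono power_mono) auto
    then show ?thesis using XX[OF that, of p] by linarith
  qed
  have U': "\<bar>EE p 0 u x t\<bar> \<le> C * K' ^ p * fact p" if "\<bar>x - x0\<bar> < \<delta>" "\<bar>t - t0\<bar> < \<delta>" for x t p
  proof -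
    have "C * K ^ p * fact p \<le> C * K' ^ p * fact p"
      using K' CK by (intro mult_right_mono mult_left_mono power_mono) auto
    then show ?thesis using bound[OF that, of p] unfolding EE0 by linarith
  qed
  \<comment> \<open>Half the radius, so that the interval from x to x + l used by the interpolation
    stays where the bounds hold.\<close>
  define l where "l = \<delta> / 2"
  define A where "A = 2 * C / l + l * \<Gamma>'"
  have l: "0 < l" using d by (simp add: l_def)
  have A: "0 \<le> A" unfolding A_def \<Gamma>'_def using l CK by simp
  have "\<bar>EE p 1 u x t\<bar> \<le> A * K' ^ p * fact (p + 2)" if xt: "\<bar>x - x0\<bar> < l" "\<bar>t - t0\<bar> < l" for x t p
  proof -
    have tt: "\<bar>t - t0\<bar> < \<delta>" using xt l by (simp add: l_def)
    have yy: "\<bar>y - x0\<bar> < \<delta>" if "x \<le> y" "y \<le> x + l" for y using xt(1) that unfolding l_def by linarith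
    have "\<bar>EE p 1 u x t\<bar> \<le> 2 * (C * K' ^ p * fact p) / l + l * (\<Gamma>' * K' ^ p * fact (p + 2))"
    proof (rule deriv_interpolation[where g = "\<lambda>y. EE p 0 u y t" and g' = "\<lambda>y. EE p 1 u y t" and g'' = "\<lambda>y. EE p 2 u y t", OF l])
      fix y assume y: "x \<le> y" "y \<le> x + l"
      have yD: "(y,t) \<in> D" using inD[OF d(2) yy[OF y] tt] .
      show "((\<lambda>y. EE p 0 u y t) has_real_derivative EE p 1 u y t) (at y)"
        using sm_dx[OF EE_sm[OF u_sm] yD, of p 0] by (simp add: dX_EE)
      show "((\<lambda>y. EE p 1 u y t) has_real_derivative EE p 2 u y t) (at y)"
        using sm_dx[OF EE_sm[OF u_sm] yD, of p 1] by (simp add: dX_EE numeral_2_eq_2)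
      show "\<bar>EE p 0 u y t\<bar> \<le> C * K' ^ p * fact p" by (rule U'[OF yy[OF y] tt])
      show "\<bar>EE p 2 u y t\<bar> \<le> \<Gamma>' * K' ^ p * fact (p + 2)" by (rule XX'[OF yy[OF y] tt])
    qed
    also have "\<dots> \<le> 2 * (C * K' ^ p * fact (p + 2)) / l + l * (\<Gamma>' * K' ^ p * fact (p + 2))"
    proof -
      have "(fact p :: real) \<le> fact (p + 2)" by (rule fact_mono) simp
      then show ?thesis using l CK K' by (intro add_right_mono divide_right_mono mult_left_mono) auto
    qed
    also have "\<dots> = A * K' ^ p * fact (p + 2)"
    proof -
      have "2 * (C * k * F) / l + l * (\<Gamma>' * k * F) = A * k * F" for k F by (simp add: A_def algebra_simps add_divide_distrib)
      then show ?thesis .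
    qed
    finally show ?thesis .
  qed
  moreover have "\<bar>EE p 0 u x t\<bar> \<le> C * K' ^ p * fact p" if "\<bar>x - x0\<bar> < l" "\<bar>t - t0\<bar> < l" for x t p
    by (rule U') (use that l in \<open>auto simp: l_def\<close>)
  ultimately show ?thesis using l d CK K' A unfolding l_def
    by (intro exI[of _ "\<delta>/2"] exI[of _ C] exI[of _ K'] exI[of _ A]) auto
qed

end

context pde_point begin

text \<open>\<open>an_split\<close> summed over all orders. The unknown part carries \<epsilon>^2,
  and it is measured by exactly the quantity that \<open>G_bound\<close> estimates.\<close>

lemma nu_u_split:
  "nu 0 (Suc (Suc M)) (u - constf w0) \<le> \<bar>u x t - w0\<bar> + (\<Sum>m<Suc (Suc M). \<bar>EE (Suc m) 0 u x t\<bar> * s ^ Suc m / fact (Suc m))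
     + \<epsilon> * (\<Sum>m<Suc (Suc M). \<bar>EE m 1 u x t\<bar> * s ^ m / fact (Suc m)) + \<epsilon>\<^sup>2 * nu 2 M (dX (dX u))"
proof -
  have 0: "an (u - constf w0) 0 = \<bar>u x t - w0\<bar>" by (simp add: an_def EE_def)
  \<comment> \<open>Order one contains no X^2. At order m + 1 with m = k + 1, the factorial is (k +
    2)!, which is how the shift 2 arises.\<close>
  have c: "(\<Sum>m<Suc (Suc M). (case m of 0 \<Rightarrow> 0 | Suc k \<Rightarrow> \<epsilon>\<^sup>2 * an (dX (dX u)) k) / fact (Suc m)) = \<epsilon>\<^sup>2 * nu 2 M (dX (dX u))"
  proof -
    define Q where "Q m = (case m of 0 \<Rightarrow> 0 | Suc k \<Rightarrow> \<epsilon>\<^sup>2 * an (dX (dX u)) k) / fact (Suc m)" for m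
    have "(\<Sum>m<Suc (Suc M). Q m) = Q 0 + (\<Sum>m<Suc M. Q (Suc m))" by (rule sum.lessThan_Suc_shift)
    also have "\<dots> = Q 0 + (\<Sum>m\<le>M. Q (Suc m))" by (simp only: lessThan_Suc_atMost)
    also have "\<dots> = \<epsilon>\<^sup>2 * nu 2 M (dX (dX u))"
      unfolding nu_def sum_distrib_left by (simp add: Q_def numeral_2_eq_2 del: fact_Suc)
    finally show ?thesis by (simp only: Q_def)
  qed
  have 1: "nu 0 (Suc (Suc M)) (u - constf w0) = \<bar>u x t - w0\<bar> + (\<Sum>m<Suc (Suc M). an u (Suc m) / fact (Suc m))"
    unfolding nu_def sum.atMost_shift an_const_diff[OF u_sm] 0 by (simp del: fact_Suc sum.lessThan_Suc)
  have 2: "(\<Sum>m<Suc (Suc M). an u (Suc m) / fact (Suc m))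
     = (\<Sum>m<Suc (Suc M). \<bar>EE (Suc m) 0 u x t\<bar> * s ^ Suc m / fact (Suc m)) + \<epsilon> * (\<Sum>m<Suc (Suc M). \<bar>EE m 1 u x t\<bar> * s ^ m / fact (Suc m))
       + (\<Sum>m<Suc (Suc M). (case m of 0 \<Rightarrow> 0 | Suc k \<Rightarrow> \<epsilon>\<^sup>2 * an (dX (dX u)) k) / fact (Suc m))"
    unfolding an_split[OF u_sm] sum_distrib_left sum.distrib[symmetric]
    by (intro sum.cong refl) (simp add: add_divide_distrib mult_ac del: fact_Suc)
  show ?thesis unfolding 1 2 c by (simp only: add.assoc order_refl)
qed

end
context pde_square begin

text \<open>The parameter \<open>\<epsilon>0\<close> reached by the continuity argument is the same
  for all points and all orders of truncation; the weights \<open>s\<close> and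
  \<open>\<epsilon>0\<close> then give the growth rate \<open>L\<close>.\<close>

lemma EE_bound:
  "\<exists>\<delta> B L. 0 < \<delta> \<and> \<delta> \<le> R \<and> 0 < B \<and> 0 < L \<and> (\<forall>x t p q. \<bar>x - x0\<bar> < \<delta> \<longrightarrow> \<bar>t - t0\<bar> < \<delta> \<longrightarrow>
     \<bar>EE p q u x t\<bar> \<le> B * L ^ (p + q) * fact (p + q))"
proof -
  obtain \<delta> C K A where d: "0 < \<delta>" "\<delta> \<le> R" and CK: "0 < C" "0 < K" "0 \<le> A"
    and bound: "\<And>x t p. \<bar>x - x0\<bar> < \<delta> \<Longrightarrow> \<bar>t - t0\<bar> < \<delta> \<Longrightarrow> \<bar>EE p 0 u x t\<bar> \<le> C * K ^ p * fact p"
      "\<And>x t p. \<bar>x - x0\<bar> < \<delta> \<Longrightarrow> \<bar>t - t0\<bar> < \<delta> \<Longrightarrow> \<bar>EE p 1 u x t\<bar> \<le> A * K ^ p * fact (p + 2)"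
    using EE_X_bound by metis
  have e0: "0 < e" by (rule e_pos)
  define s where "s = min (min 1 (e / 4)) (min (1 / (4 * K)) (e / (32 * C * K)))"
  have s: "0 < s" "s \<le> 1" "s \<le> e/4" "2 * K * s \<le> 1/2" "2 * C * (K * s) \<le> e/16"
  proof -
    show "0 < s" "s \<le> 1" "s \<le> e/4" using CK e0 by (auto simp: s_def)
    have "s \<le> 1 / (4 * K)" by (simp add: s_def)
    then show "2 * K * s \<le> 1/2" using CK by (simp add: pos_le_divide_eq mult_ac)
    have "s \<le> e / (32 * C * K)" by (simp add: s_def)
    then show "2 * C * (K * s) \<le> e/16" using CK by (simp add: pos_le_divide_eq mult_ac)
  qed
  have Ks: "0 \<le> K * s" "K * s \<le> 1/2" "0 \<le> 2 * K * s" using CK s mult_pos_pos[OF CK(2) s(1)] by auto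
  interpret c: pde_point D r x0 t0 w0 e f0 c0 ch cf h u f R x0 t0 s 0
    by (rule pde_pointI) (use center s in auto)
  define \<Gamma> where "\<Gamma> = \<bar>c.Gam\<bar>"
  \<comment> \<open>The last two entries bound the contributions of the first and of the higher
    x-derivatives by e/16 each; another e/16 comes from the t-derivatives and e/4 from u - w0
    itself, altogether 7/16 e.\<close>
  define \<epsilon>0 where "\<epsilon>0 = min (min 1 (e / 4)) (min (e / (64 * (A + 1))) (e * s\<^sup>2 / (16 * (\<Gamma> + 1))))"
  have ep0: "0 < \<epsilon>0" "\<epsilon>0 \<le> 1" "\<epsilon>0 \<le> e/4" "4 * A * \<epsilon>0 \<le> e/16" "\<epsilon>0 * (\<Gamma> / s\<^sup>2) \<le> e/16"
  proof -
    have G0: "0 \<le> \<Gamma>" by (simp add: \<Gamma>_def)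
    show p: "0 < \<epsilon>0" "\<epsilon>0 \<le> 1" using CK e0 s G0 by (auto simp: \<epsilon>0_def)
    show "\<epsilon>0 \<le> e/4" unfolding \<epsilon>0_def by (rule min.coboundedI1, rule min.cobounded2)
    have "\<epsilon>0 \<le> e / (64 * (A + 1))" by (simp add: \<epsilon>0_def)
    then have "\<epsilon>0 * (64 * (A + 1)) \<le> e" using CK by (simp add: pos_le_divide_eq)
    then show "4 * A * \<epsilon>0 \<le> e/16" using p by (simp add: algebra_simps)
    have "\<epsilon>0 \<le> e * s\<^sup>2 / (16 * (\<Gamma> + 1))" by (simp add: \<epsilon>0_def)
    then have "\<epsilon>0 * (16 * (\<Gamma> + 1)) \<le> e * s\<^sup>2" using G0 by (simp add: pos_le_divide_eq)
    then have "16 * (\<epsilon>0 * \<Gamma>) \<le> e * s\<^sup>2" using p by (simp add: algebra_simps)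
    then have "\<epsilon>0 * \<Gamma> \<le> e / 16 * s\<^sup>2" by simp
    then have "\<epsilon>0 * \<Gamma> / s\<^sup>2 \<le> e / 16" using s by (simp add: pos_divide_le_eq)
    then show "\<epsilon>0 * (\<Gamma> / s\<^sup>2) \<le> e/16" by simp
  qed
  define v where "v = u - constf w0"
  define L where "L = max (1 / s) (1 / \<epsilon>0)"
  define B where "B = e + \<bar>w0\<bar>"
  have main: "\<bar>EE p q u x t\<bar> \<le> B * L ^ (p + q) * fact (p + q)" if near: "\<bar>x - x0\<bar> < \<delta>" "\<bar>t - t0\<bar> < \<delta>" for x t p q
  proof -
    have xt: "(x,t) \<in> D" using inD d near by blast
    define N where "N = Suc (Suc (p + q))"
    \<comment> \<open>This is \<open>nu 0 N v\<close> written out, because \<open>\<epsilon>\<close>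
      is a fixed parameter of the locale while here it has to vary.\<close>
    define Yf where "Yf \<epsilon> = (\<Sum>n\<le>N. (\<Sum>p\<le>n. \<bar>EE p (n - p) v x t\<bar> * s ^ p * \<epsilon> ^ (n - p)) / fact (n + 0))" for \<epsilon> :: real
    have split: "Yf \<epsilon> \<le> 5/16 * e + \<epsilon> * (4 * A) + \<epsilon>\<^sup>2 * point_norm.nu D x t s \<epsilon> 2 (p + q) (dX (dX u))" if ep: "0 \<le> \<epsilon>" for \<epsilon>
    proof -
      interpret z: pde_point D r x0 t0 w0 e f0 c0 ch cf h u f R x t s \<epsilon>
        by (rule pde_pointI) (use xt s ep in auto)
      have Y: "Yf \<epsilon> = z.nu 0 N v" unfolding Yf_def z.nu_def z.an_def ..
      have 1: "\<bar>u x t - w0\<bar> \<le> e/4" by (rule nearD(3)[OF xt])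
      have 2: "(\<Sum>m<N. \<bar>EE (Suc m) 0 u x t\<bar> * s ^ Suc m / fact (Suc m)) \<le> e/16"
      proof -
        have "\<bar>EE (Suc m) 0 u x t\<bar> * s ^ Suc m / fact (Suc m) \<le> C * (K * s) ^ Suc m" for m
        proof -
          have "\<bar>EE (Suc m) 0 u x t\<bar> * s ^ Suc m \<le> C * K ^ Suc m * fact (Suc m) * s ^ Suc m"
            using bound(1)[OF near, of "Suc m"] s by (intro mult_right_mono) auto
          also have "\<dots> = C * (K * s) ^ Suc m * fact (Suc m)" by (simp only: power_mult_distrib mult_ac)
          finally show ?thesis by (simp only: pos_divide_le_eq[OF fact_gt_zero])
        qed
        then have "(\<Sum>m<N. \<bar>EE (Suc m) 0 u x t\<bar> * s ^ Suc m / fact (Suc m)) \<le> (\<Sum>m<N. C * (K * s) ^ Suc m)"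
          by (rule sum_mono)
        also have "\<dots> \<le> C * (2 * (K * s))"
          unfolding sum_distrib_left[symmetric] using CK Ks by (intro mult_left_mono geometric_le) auto
        finally show ?thesis using s(5) by simp
      qed
      have 3: "(\<Sum>m<N. \<bar>EE m 1 u x t\<bar> * s ^ m / fact (Suc m)) \<le> 4 * A"
      proof -
        have "\<bar>EE m 1 u x t\<bar> * s ^ m / fact (Suc m) \<le> 2 * A * (2 * K * s) ^ m" for m
        proof -
          have "\<bar>EE m 1 u x t\<bar> * s ^ m \<le> A * K ^ m * fact (m + 2) * s ^ m"
            using bound(2)[OF near, of m] s by (intro mult_right_mono) auto
          \<comment> \<open>The bound for X T^m u has (m + 2)! against the divisor (m + 1)!; the
            surplus m + 2 is at most 2 * 2^m and is absorbed by doubling the geometric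
            ratio.\<close>
          also have "\<dots> = A * (K * s) ^ m * real (m + 2) * fact (Suc m)"
            by (simp add: power_mult_distrib)
          also have "\<dots> \<le> A * (K * s) ^ m * (2 * 2 ^ m) * fact (Suc m)"
            using CK Ks le_two_power[of m] by (intro mult_right_mono mult_left_mono) auto
          also have "\<dots> = 2 * A * (2 * K * s) ^ m * fact (Suc m)" by (simp add: power_mult_distrib del: fact_Suc)
          finally show ?thesis by (simp only: pos_divide_le_eq[OF fact_gt_zero])
        qed
        then have "(\<Sum>m<N. \<bar>EE m 1 u x t\<bar> * s ^ m / fact (Suc m)) \<le> (\<Sum>m<N. 2 * A * (2 * K * s) ^ m)"
          by (rule sum_mono)
        also have "\<dots> \<le> 2 * A * 2"
          unfolding sum_distrib_left[symmetric] using CK Ks s(4) by (intro mult_left_mono geometric_le) auto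
        finally show ?thesis by simp
      qed
      have "Yf \<epsilon> \<le> \<bar>u x t - w0\<bar> + (\<Sum>m<N. \<bar>EE (Suc m) 0 u x t\<bar> * s ^ Suc m / fact (Suc m))
        + \<epsilon> * (\<Sum>m<N. \<bar>EE m 1 u x t\<bar> * s ^ m / fact (Suc m)) + \<epsilon>\<^sup>2 * z.nu 2 (p + q) (dX (dX u))"
        unfolding Y v_def N_def by (rule z.nu_u_split)
      moreover have "\<epsilon> * (\<Sum>m<N. \<bar>EE m 1 u x t\<bar> * s ^ m / fact (Suc m)) \<le> \<epsilon> * (4 * A)"
        by (rule mult_left_mono[OF 3 ep])
      ultimately show ?thesis using 1 2 by linarith
    qed
    have Y0: "Yf 0 < e/2" using split[of 0] e0 by simp
    \<comment> \<open>\<open>e/2\<close> is the largest value at which \<open>G_bound\<close>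
      applies, and applying it there forces the strictly smaller bound 7/16 e.\<close>
    have Ystep: "Yf \<epsilon> \<noteq> e/2" if ep: "0 \<le> \<epsilon>" "\<epsilon> \<le> \<epsilon>0" for \<epsilon>
    proof
      assume eq: "Yf \<epsilon> = e/2"
      interpret z: pde_point D r x0 t0 w0 e f0 c0 ch cf h u f R x t s \<epsilon>
        by (rule pde_pointI) (use xt s ep in auto)
      have Y: "Yf \<epsilon> = z.nu 0 N v" unfolding Yf_def z.nu_def z.an_def ..
      have G: "z.nu 2 (p + q) (dX (dX u)) \<le> z.Gam / s\<^sup>2"
      proof (rule z.G_bound[OF s(2)])
        show "z.nu 0 (Suc (Suc (p + q))) (fx - constf x0) \<le> e/2"
          using z.an_fx[of "Suc (Suc (p + q))" x0] nearD(1)[OF xt] ep ep0 by linarith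
        show "z.nu 0 (Suc (Suc (p + q))) (ft - constf t0) \<le> e/2"
          using z.an_ft[of "Suc (Suc (p + q))" t0] nearD(2)[OF xt] s by linarith
        show "z.nu 0 (Suc (Suc (p + q))) (u - constf w0) \<le> e/2"
          using Y eq unfolding N_def v_def by linarith
      qed
      have "z.Gam \<le> \<Gamma>" unfolding \<Gamma>_def z.Gam_def c.Gam_def by (rule abs_ge_self)
      then have "z.Gam / s\<^sup>2 \<le> \<Gamma> / s\<^sup>2" by (intro divide_right_mono) auto
      then have "z.nu 2 (p + q) (dX (dX u)) \<le> \<Gamma> / s\<^sup>2" using G by linarith
      then have "\<epsilon>\<^sup>2 * z.nu 2 (p + q) (dX (dX u)) \<le> \<epsilon>0 * (\<Gamma> / s\<^sup>2)"
      proof (rule mult_mono[rotated])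
        have "\<epsilon>\<^sup>2 \<le> \<epsilon> * 1" unfolding power2_eq_square using ep ep0 by (intro mult_left_mono) auto
        then show "\<epsilon>\<^sup>2 \<le> \<epsilon>0" using ep by simp
      qed (use ep0 z.nu_nonneg in auto)
      moreover have "\<epsilon> * (4 * A) \<le> e/16"
        using mult_right_mono[OF ep(2), of "4 * A"] CK ep0(4) by (simp add: mult_ac)
      ultimately have "Yf \<epsilon> \<le> 7/16 * e" using split[OF ep(1)] ep0(5) by linarith
      then show False using eq e0 by simp
    qed
    have "continuous_on {0..\<epsilon>0} Yf" unfolding Yf_def by (intro continuous_intros) auto
    then have Yb: "Yf \<epsilon>0 < e/2"
      using IVT'[of Yf 0 "e/2" \<epsilon>0] Y0 Ystep ep0 by (meson less_imp_le not_less)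
    interpret z: pde_point D r x0 t0 w0 e f0 c0 ch cf h u f R x t s \<epsilon>0
      by (rule pde_pointI) (use xt s ep0 in auto)
    have Y: "Yf \<epsilon>0 = z.nu 0 N v" unfolding Yf_def z.nu_def z.an_def ..
    show ?thesis
    proof (cases "p + q")
      case 0
      have "\<bar>u x t\<bar> \<le> \<bar>u x t - w0\<bar> + \<bar>w0\<bar>" by linarith
      then show ?thesis using nearD(3)[OF xt] 0 e0 unfolding B_def by (simp add: EE_def)
    next
      case (Suc n)
      have L: "1 / s \<le> L" "1 / \<epsilon>0 \<le> L" "0 < L" using s by (auto simp: L_def less_max_iff_disj)
      have "\<bar>EE p (Suc n - p) u x t\<bar> * s ^ p * \<epsilon>0 ^ (Suc n - p) \<le> z.an u (Suc n)"
        unfolding z.an_def by (rule member_le_sum) (use Suc s ep0 in auto)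
      moreover have "Suc n - p = q" using Suc by simp
      moreover have "z.an u (Suc n) = z.an v (Suc n)" unfolding v_def by (rule z.an_const_diff[OF u_sm, symmetric])
      moreover have "z.an v (Suc n) / fact (Suc n + 0) \<le> z.nu 0 N v"
        unfolding z.nu_def by (rule member_le_sum) (use Suc in \<open>auto simp: N_def intro!: divide_nonneg_nonneg z.an_nonneg\<close>)
      then have "z.an v (Suc n) \<le> e/2 * fact (Suc n)"
        using Yb Y by (simp only: pos_divide_le_eq[OF fact_gt_zero] add_0_right) (smt (verit) fact_gt_zero mult_right_mono)
      ultimately have "\<bar>EE p q u x t\<bar> * (s ^ p * \<epsilon>0 ^ q) \<le> e/2 * fact (Suc n)" by (simp only: mult.assoc)
      then have "\<bar>EE p q u x t\<bar> \<le> e/2 * fact (Suc n) / (s ^ p * \<epsilon>0 ^ q)"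
        using s ep0 by (intro iffD2[OF pos_le_divide_eq]) auto
      also have "\<dots> = e/2 * ((1 / s) ^ p * (1 / \<epsilon>0) ^ q) * fact (Suc n)" by (simp add: power_one_over field_simps del: fact_Suc)
      also have "\<dots> \<le> B * (L ^ p * L ^ q) * fact (Suc n)"
        using L s ep0 e0 by (intro mult_right_mono mult_mono power_mono) (auto simp: B_def)
      also have "\<dots> = B * L ^ (p + q) * fact (p + q)" by (simp only: power_add Suc[symmetric])
      finally show ?thesis .
    qed
  qed
  have "0 < B" "0 < L" using e0 s by (auto simp: B_def L_def less_max_iff_disj)
  then show ?thesis using main d by blast
qed

end

section \<open>Convergence of the Taylor series\<close>

text \<open>The remainder estimate divides by n! rather than (n + 1)!, so a factor n + 1 is left
  over; it is beaten by the geometric factor q^(n+1) with q < 1.\<close>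

lemma taylor_sums:
  fixes g :: "nat \<Rightarrow> real \<Rightarrow> real"
  assumes der: "\<And>n y. \<bar>y - a\<bar> < \<rho> \<Longrightarrow> (g n has_real_derivative g (Suc n) y) (at y)"
    and bd: "\<And>n y. \<bar>y - a\<bar> < \<rho> \<Longrightarrow> \<bar>g n y\<bar> \<le> B * M ^ n * fact n"
    and z: "\<bar>z - a\<bar> < \<rho>" "M * \<bar>z - a\<bar> < 1" and M: "0 \<le> M"
  shows "(\<lambda>n. g n a / fact n * (z - a) ^ n) sums g 0 z"
proof -
  define q where "q = M * \<bar>z - a\<bar>"
  have q: "0 \<le> q" "q < 1" using z M by (simp_all add: q_def)
  have S: "ball a \<rho> = {y. \<bar>y - a\<bar> < \<rho>}" by (auto simp: ball_def dist_real_def abs_minus_commute)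
  have "norm (g 0 z - (\<Sum>i\<le>n. g i a * (z - a) ^ i / fact i)) \<le> B * (real (Suc n) * q ^ Suc n)" for n
  proof -
    have "norm (g 0 z - (\<Sum>i\<le>n. g i a * (z - a) ^ i / fact i)) \<le> B * M ^ Suc n * fact (Suc n) * norm (z - a) ^ Suc n / fact n"
    proof (rule field_Taylor[where S = "ball a \<rho>" and f = g and n = n and z = z and w = a and B = "B * M ^ Suc n * fact (Suc n)"])
      show "(g i has_real_derivative g (Suc i) y) (at y within ball a \<rho>)" if "y \<in> ball a \<rho>" for y i
        by (rule has_field_derivative_at_within, rule der) (use that in \<open>simp add: dist_real_def abs_minus_commute\<close>)
      show "norm (g (Suc n) y) \<le> B * M ^ Suc n * fact (Suc n)" if "y \<in> ball a \<rho>" for y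
        using bd[of y "Suc n"] that unfolding S by (simp del: power_Suc fact_Suc)
    qed (use z in \<open>auto simp: dist_real_def\<close>)
    also have "\<dots> = B * (real (Suc n) * q ^ Suc n)" by (simp add: q_def power_mult_distrib)
    finally show ?thesis .
  qed
  moreover have "(\<lambda>n. B * (real (Suc n) * q ^ Suc n)) \<longlonglongrightarrow> 0"
    using q by (intro tendsto_mult_right_zero LIMSEQ_Suc[OF powser_times_n_limit_0]) auto
  ultimately have "(\<lambda>n. g 0 z - (\<Sum>i\<le>n. g i a * (z - a) ^ i / fact i)) \<longlonglongrightarrow> 0"
    by (rule Lim_null_comparison[OF always_eventually[OF allI]])
  then have "(\<lambda>n. g 0 z - (g 0 z - (\<Sum>i\<le>n. g i a * (z - a) ^ i / fact i))) \<longlonglongrightarrow> g 0 z - 0"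
    by (intro tendsto_diff tendsto_const)
  then show ?thesis unfolding sums_def_le by simp
qed

lemma (in plane_domain) dw_iter_pd: "(x,t) \<in> D \<Longrightarrow> dw bs g x t = iter_pd bs g x t"
proof (induction bs arbitrary: x t)
  case (Cons b bs)
  show ?case
    using pdx_cong[OF Cons.IH Cons.prems] pdt_cong[OF Cons.IH Cons.prems] Cons.prems by (simp add: dX_def dT_def)
qed simp

text \<open>(p + q)! \<le> 2^(p+q) p! q! decouples the two variables at the price of doubling
  \<open>L\<close>. Around every center in the square, each X^j u is first expanded in t along the
  vertical line through the center, and then u is expanded in x along the horizontal line through
  the target point.\<close>

lemma (in pde_square) analytic_near: "real_analytic2_near u (x0, t0)"
proof -
  obtain \<delta> B L where d: "0 < \<delta>" "\<delta> \<le> R" and BL: "0 < B" "0 < L"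
    and bound: "\<And>x t p q. \<bar>x - x0\<bar> < \<delta> \<Longrightarrow> \<bar>t - t0\<bar> < \<delta> \<Longrightarrow> \<bar>EE p q u x t\<bar> \<le> B * L ^ (p + q) * fact (p + q)"
    using EE_bound by metis
  define M where "M = 2 * L"
  have M: "0 < M" using BL by (simp add: M_def)
  have bound': "\<bar>EE p q u x t\<bar> \<le> B * M ^ p * M ^ q * fact p * fact q" if "\<bar>x - x0\<bar> < \<delta>" "\<bar>t - t0\<bar> < \<delta>" for x t p q
  proof -
    have "(p + q) choose p \<le> 2 ^ (p + q)" by (rule binomial_le_pow2)
    then have "real ((p + q) choose p) \<le> 2 ^ (p + q)" by (metis of_nat_le_iff of_nat_numeral of_nat_power)
    then have "(fact (p + q) :: real) \<le> 2 ^ (p + q) * (fact p * fact q)"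
      using mult_right_mono[of "real ((p + q) choose p)" "2 ^ (p + q)" "fact p * fact q :: real"]
      by (simp add: binomial_fact)
    then have "B * L ^ (p + q) * fact (p + q) \<le> B * L ^ (p + q) * (2 ^ (p + q) * (fact p * fact q))"
      using BL by (intro mult_left_mono) auto
    also have "\<dots> = B * M ^ p * M ^ q * fact p * fact q" by (simp add: M_def power_mult_distrib power_add)
    finally show ?thesis using bound[OF that, of p q] by linarith
  qed
  have "real_analytic2_at u xc tc" if xc: "\<bar>xc - x0\<bar> < \<delta>" and tc: "\<bar>tc - t0\<bar> < \<delta>" for xc tc
  proof -
    define \<rho> where "\<rho> = min (min (\<delta> - \<bar>xc - x0\<bar>) (\<delta> - \<bar>tc - t0\<bar>)) (1 / (2 * M))"
    have rho: "0 < \<rho>" "\<rho> \<le> \<delta> - \<bar>xc - x0\<bar>" "\<rho> \<le> \<delta> - \<bar>tc - t0\<bar>" "M * \<rho> \<le> 1/2"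
    proof -
      show "0 < \<rho>" "\<rho> \<le> \<delta> - \<bar>xc - x0\<bar>" "\<rho> \<le> \<delta> - \<bar>tc - t0\<bar>" using xc tc M by (auto simp: \<rho>_def)
      have "\<rho> \<le> 1 / (2 * M)" by (simp add: \<rho>_def)
      then show "M * \<rho> \<le> 1/2" using M by (simp add: pos_le_divide_eq mult_ac)
    qed
    have near_x: "\<bar>x - x0\<bar> < \<delta>" if "\<bar>x - xc\<bar> < \<rho>" for x using that rho(2) by linarith
    have near_t: "\<bar>t - t0\<bar> < \<delta>" if "\<bar>t - tc\<bar> < \<rho>" for t using that rho(3) by linarith
    have small: "M * \<bar>y\<bar> \<le> 1/2" if "\<bar>y\<bar> < \<rho>" for y
      using mult_left_mono[of "\<bar>y\<bar>" \<rho> M] that M rho(4) by linarith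
    \<comment> \<open>The arguments of \<open>EE\<close> are swapped: \<open>j\<close> counts powers
      of x, whereas \<open>EE\<close> takes the number of t-derivatives first.\<close>
    define c where "c = (\<lambda>(j,k). EE k j u xc tc / (fact j * fact k))"
    have "((\<lambda>(j,k). c (j,k) * (x - xc) ^ j * (t - tc) ^ k) has_sum u x t) UNIV"
      if x: "\<bar>x - xc\<bar> < \<rho>" and t: "\<bar>t - tc\<bar> < \<rho>" for x t
    proof -
      let ?T = "\<lambda>(j,k). c (j,k) * (x - xc) ^ j * (t - tc) ^ k"
      define a where "a = M * \<bar>x - xc\<bar>"
      define b where "b = M * \<bar>t - tc\<bar>"
      have ab: "0 \<le> a" "a < 1" "0 \<le> b" "b < 1" using small[OF x] small[OF t] M by (auto simp: a_def b_def)
      have le: "norm (?T (j,k)) \<le> B * a ^ j * b ^ k" for j k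
      proof -
        have "\<bar>EE k j u xc tc\<bar> / (fact j * fact k) \<le> B * M ^ k * M ^ j"
          using bound'[OF xc tc, of k j] by (simp add: pos_divide_le_eq mult_ac)
        then have "\<bar>EE k j u xc tc\<bar> / (fact j * fact k) * (\<bar>x - xc\<bar> ^ j * \<bar>t - tc\<bar> ^ k)
            \<le> B * M ^ k * M ^ j * (\<bar>x - xc\<bar> ^ j * \<bar>t - tc\<bar> ^ k)"
          by (intro mult_right_mono) auto
        then show ?thesis by (simp add: c_def a_def b_def abs_mult power_abs power_mult_distrib mult_ac)
      qed
      have geo: "((\<lambda>n. q ^ n) has_sum (1 / (1 - q))) UNIV" if "0 \<le> q" "q < 1" for q :: real
        using that by (intro sums_nonneg_imp_has_sum geometric_sums) auto
      have row: "((\<lambda>k. ?T (j,k)) has_sum (EE 0 j u xc t / fact j * (x - xc) ^ j)) UNIV" for j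
      proof -
        have "(\<lambda>k. EE k j u xc tc / fact k * (t - tc) ^ k) sums EE 0 j u xc t"
        proof (rule taylor_sums[where g = "\<lambda>k. EE k j u xc" and \<rho> = \<rho> and B = "B * M ^ j * fact j" and M = M])
          fix k y assume y: "\<bar>y - tc\<bar> < \<rho>"
          show "(EE k j u xc has_real_derivative EE (Suc k) j u xc y) (at y)"
            using sm_dt[OF EE_sm[OF u_sm] inD[OF d(2) xc near_t[OF y]], of k j] by (simp add: dT_EE[OF u_sm])
          show "\<bar>EE k j u xc y\<bar> \<le> B * M ^ j * fact j * M ^ k * fact k"
            using bound'[OF xc near_t[OF y], of k j] by (simp add: mult_ac)
        qed (use t ab M in \<open>auto simp: b_def\<close>)
        then have "(\<lambda>k. EE k j u xc tc / fact k * (t - tc) ^ k * ((x - xc) ^ j / fact j)) sums (EE 0 j u xc t * ((x - xc) ^ j / fact j))"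
          by (rule sums_mult2)
        then have "(\<lambda>k. ?T (j,k)) sums (EE 0 j u xc t / fact j * (x - xc) ^ j)"
          by (simp add: c_def mult_ac)
        moreover have "summable (\<lambda>k. norm (?T (j,k)))"
          by (rule summable_comparison_test'[of "\<lambda>k. B * a ^ j * b ^ k"])
            (use le ab in \<open>auto intro!: summable_mult summable_geometric\<close>)
        ultimately show ?thesis by (intro norm_summable_imp_has_sum)
      qed
      have rows: "((\<lambda>j. EE 0 j u xc t / fact j * (x - xc) ^ j) has_sum u x t) UNIV"
      proof (rule norm_summable_imp_has_sum)
        have b: "\<bar>EE 0 j u y t\<bar> \<le> B * M ^ j * fact j" if "\<bar>y - xc\<bar> < \<rho>" for j y
          using bound'[OF near_x[OF that] near_t[OF t], of 0 j] by simp
        have "(\<lambda>j. EE 0 j u xc t / fact j * (x - xc) ^ j) sums EE 0 0 u x t"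
        proof (rule taylor_sums[where g = "\<lambda>j y. EE 0 j u y t" and \<rho> = \<rho> and B = B and M = M])
          fix j y assume y: "\<bar>y - xc\<bar> < \<rho>"
          show "((\<lambda>y. EE 0 j u y t) has_real_derivative EE 0 (Suc j) u y t) (at y)"
            using sm_dx[OF EE_sm[OF u_sm] inD[OF d(2) near_x[OF y] near_t[OF t]], of 0 j] by (simp add: dX_EE)
          show "\<bar>EE 0 j u y t\<bar> \<le> B * M ^ j * fact j" by (rule b[OF y])
        qed (use x ab M in \<open>auto simp: a_def\<close>)
        then show "(\<lambda>j. EE 0 j u xc t / fact j * (x - xc) ^ j) sums u x t" by (simp add: EE_def)
        show "summable (\<lambda>j. norm (EE 0 j u xc t / fact j * (x - xc) ^ j))"
        proof (rule summable_comparison_test'[of "\<lambda>j. B * a ^ j"])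
          show "summable (\<lambda>j. B * a ^ j)" using ab by (intro summable_mult summable_geometric) auto
          fix j
          have "\<bar>EE 0 j u xc t\<bar> / fact j \<le> B * M ^ j"
            using b[of xc j] rho(1) by (simp add: pos_divide_le_eq)
          then have "\<bar>EE 0 j u xc t\<bar> / fact j * \<bar>x - xc\<bar> ^ j \<le> B * M ^ j * \<bar>x - xc\<bar> ^ j"
            by (intro mult_right_mono) auto
          then show "norm (norm (EE 0 j u xc t / fact j * (x - xc) ^ j)) \<le> B * a ^ j"
            by (simp add: a_def abs_mult power_abs power_mult_distrib mult_ac)
        qed
      qed
      \<comment> \<open>The iterated expansions give only the value of an iterated sum; summability
        of the double family, from the product of two geometric series, makes it the unordered
        sum.\<close>
      have "?T summable_on (UNIV \<times> UNIV)"
      proof (rule abs_summable_summable, rule Infinite_Sum.abs_summable_on_comparison_test')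
        show "(\<lambda>(j,k). B * a ^ j * b ^ k) summable_on (UNIV \<times> UNIV)"
        proof (rule summable_on_SigmaI)
          show "((\<lambda>k. (case (j,k) of (j,k) \<Rightarrow> B * a ^ j * b ^ k)) has_sum (B * a ^ j * (1 / (1 - b)))) UNIV" for j
            using has_sum_cmult_right[OF geo[OF ab(3,4)], of "B * a ^ j"] by simp
          show "(\<lambda>j. B * a ^ j * (1 / (1 - b))) summable_on UNIV"
            using has_sum_imp_summable[OF has_sum_cmult_right[OF geo[OF ab(1,2)], of B]]
            by (rule summable_on_cmult_left)
        qed (use ab BL in auto)
      qed (use le in auto)
      then have "(?T has_sum u x t) (UNIV \<times> UNIV)"
        by (intro has_sum_SigmaI[OF row rows])
      then show ?thesis by simp
    qed
    then show ?thesis unfolding real_analytic2_at_def using rho(1) by blast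
  qed
  moreover have "open ({x0 - \<delta><..<x0 + \<delta>} \<times> {t0 - \<delta><..<t0 + \<delta>})" by (intro open_Times open_greaterThanLessThan)
  ultimately show ?thesis unfolding real_analytic2_near_def using d
    by (intro exI[of _ "{x0 - \<delta><..<x0 + \<delta>} \<times> {t0 - \<delta><..<t0 + \<delta>}"]) (auto simp: abs_less_iff)
qed

theorem mainTheorem1:
  fixes r :: nat
    and h :: "real \<Rightarrow> real \<Rightarrow> real \<Rightarrow> real"
    and u f :: "real \<Rightarrow> real \<Rightarrow> real"
    and x0 t0 :: real
    and U :: "(real \<times> real) set"
  assumes "r > 0"
    and "\<forall>x t w. real_analytic3_at h x t w"
    and "open U" and "(x0, t0) \<in> U"
    and "\<forall>(x,t)\<in>U. real_analytic2_at f x t"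
    and "smooth2_on U u"
    and "\<forall>(x,t)\<in>U. P_op r h u u x t = f x t"
  shows "real_analytic2_near u (x0, t0)"
proof -
  define w0 where "w0 = u x0 t0"
  obtain ch eh where psh: "ps3 h x0 t0 w0 ch eh" using ps3_of_analytic3 assms(2) by blast
  have "real_analytic2_at f x0 t0" using assms(4,5) by blast
  then obtain cf ef where psf: "ps3 (\<lambda>x t w. f x t) x0 t0 w0 cf ef" using ps3_of_analytic2 by blast
  define e where "e = min eh ef"
  have e: "0 < e" using psh psf by (simp add: e_def ps3_def)
  have psh: "ps3 h x0 t0 w0 ch e" and psf: "ps3 (\<lambda>x t w. f x t) x0 t0 w0 cf e"
    using ps3_shrink[OF psh e] ps3_shrink[OF psf e] by (simp_all add: e_def)
  have contU: "continuous_on U (\<lambda>(x,t). iter_pd bs u x t)" for bs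
    using assms(6) unfolding smooth2_on_def by blast
  obtain d1 where d1: "0 < d1" "cball (x0,t0) d1 \<subseteq> U"
    using assms(3,4) open_contains_cball by blast
  obtain d2 where d2: "0 < d2" "\<And>z. z \<in> U \<Longrightarrow> dist z (x0,t0) < d2 \<Longrightarrow> dist (u (fst z) (snd z)) w0 < e/4"
  proof -
    have "0 < e/4" using e by simp
    then have "\<exists>d>0. \<forall>z\<in>U. dist z (x0,t0) < d \<longrightarrow> dist (case z of (x,t) \<Rightarrow> iter_pd [] u x t) (case (x0,t0) of (x,t) \<Rightarrow> iter_pd [] u x t) < e/4"
      using contU[of "[]"] assms(4) unfolding continuous_on_iff by blast
    then show ?thesis using that by (auto simp: case_prod_beta w0_def)
  qed
  \<comment> \<open>Points of the closed square have distance at most 2R from the center, hence the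
    bounds d1/2 and d2/4; \<open>e/4\<close> keeps the coordinates within the series, and the last
    entry gives the dichotomy about x = 0.\<close>
  define R where "R = min (min (d1/2) (d2/4)) (min (e/4) (if x0 = 0 then 1 else \<bar>x0\<bar>))"
  have R: "0 < R" "R \<le> d1/2" "R \<le> d2/4" "R \<le> e/4" "x0 = 0 \<or> R \<le> \<bar>x0\<bar>"
    using d1 d2 e by (auto simp: R_def)
  \<comment> \<open>The closed square is compact inside \<open>U\<close>, so every derivative of
    \<open>u\<close> is bounded on the open square \<open>D\<close>.\<close>
  define C where "C = {x0 - R..x0 + R} \<times> {t0 - R..t0 + R}"
  define D where "D = {x0 - R<..<x0 + R} \<times> {t0 - R<..<t0 + R}"
  have dist: "dist (x,t) (x0,t0) \<le> 2 * R" if "(x,t) \<in> C" for x t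
  proof -
    have "dist (x,t) (x0,t0) \<le> \<bar>x - x0\<bar> + \<bar>t - t0\<bar>"
      using sqrt_sum_squares_le_sum_abs by (simp add: dist_Pair_Pair dist_real_def)
    then show ?thesis using that by (auto simp: C_def)
  qed
  have CU: "C \<subseteq> U"
  proof
    fix z assume "z \<in> C"
    then have "z \<in> cball (x0,t0) d1" using dist[of "fst z" "snd z"] R(2) by (simp add: dist_commute)
    then show "z \<in> U" using d1 by blast
  qed
  have DC: "D \<subseteq> C" by (auto simp: D_def C_def)
  have C: "compact C" unfolding C_def by (intro compact_Times compact_Icc)
  interpret plane_domain D by unfold_locales (simp add: D_def open_Times)
  have sm: "u \<in> sm"
    using assms(6) DC CU continuous_on_subset[of U _ D] unfolding sm_def smooth2_on_def by blast
  interpret pde_square D r x0 t0 w0 e "f x0 t0" "h x0 t0 w0" ch cf h u f R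
  proof
    show "\<exists>B. \<forall>x t. (x,t) \<in> D \<longrightarrow> \<bar>dw bs u x t\<bar> \<le> B" for bs
    proof -
      have "bounded ((\<lambda>(x,t). iter_pd bs u x t) ` C)"
        by (intro compact_imp_bounded compact_continuous_image continuous_on_subset[OF contU CU] C)
      then obtain B where "\<And>z. z \<in> C \<Longrightarrow> norm ((\<lambda>(x,t). iter_pd bs u x t) z) \<le> B"
        unfolding bounded_iff by blast
      then have "\<bar>dw bs u x t\<bar> \<le> B" if "(x,t) \<in> D" for x t
        using that DC dw_iter_pd[OF that, of bs u] by fastforce
      then show ?thesis by blast
    qed
    show "\<bar>x - x0\<bar> \<le> e/4 \<and> \<bar>t - t0\<bar> \<le> e/4 \<and> \<bar>u x t - w0\<bar> \<le> e/4" if xt: "(x,t) \<in> D" for x t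
    proof -
      have "(x,t) \<in> C" "(x,t) \<in> U" using xt DC CU by auto
      then have "dist (u x t) w0 < e/4"
        using d2(2)[of "(x,t)"] dist[of x t] R d2(1) by simp
      moreover have "\<bar>x - x0\<bar> < R" "\<bar>t - t0\<bar> < R" using xt by (auto simp: D_def abs_less_iff)
      ultimately show ?thesis using R(4) unfolding dist_real_def by linarith
    qed
    show "P_op r h u u x t = f x t" if "(x,t) \<in> D" for x t
      using that assms(7) DC CU by blast
  qed (use assms(1) sm psh psf R in \<open>simp_all add: w0_def D_def\<close>)
  show ?thesis by (rule analytic_near)
qed

end
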